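(* Let $m,n\ge0$, $k\ge1$ be integers with $m+n\ge1$, let $\boldsymbol z=(z_1,\dots,z_k)\in\mathbb C^k$ and $\boldsymbol\Lambda=(\Lambda_1,\dots,\Lambda_{m+n})\in\mathbb C^{m+n}$, and let $$\hat B(\boldsymbol z,\boldsymbol\Lambda)=\begin{pmatrix} v-Z & D^t\\ SX & \partial_v-\Lambda\end{pmatrix}$$ be the $(m+n+k)\times(m+n+k)$ matrix over $\mathcal D_v((\partial_v^{-1}))$ with $Z=\mathrm{diag}(z_1,\dots,z_k)$, $\Lambda=\mathrm{diag}(\Lambda_1,\dots,\Lambda_{m+n})$, $D^t$ the $k\times(m+n)$ matrix with $(a,i)$ entry $\partial_{i,a}$, and $SX$ the $(m+n)\times k$ matrix with $(i,a)$ entry $(-1)^{\bar i}x_{i,a}$. Let $\hat{\boldsymbol s}_0=(1,\dots,1,-1,\dots,-1)$ with $k+m$ entries $1$ followed by $n$ entries $-1$. Then $$\mathrm{Ber}^{\hat{\boldsymbol s}_0}\,\hat B(\boldsymbol z,\boldsymbol\Lambda)=\sum_{\mathfrak a\subset\{1,\dots,k\}}\ \sum_{\substack{j_1,j_2\in J(\mathfrak a)\\ j_1\sim j_2}}c(j_1,j_2)\Big(\prod_{i=m+1}^{m+n}|j_2^{-1}(i)|!\Big)\ \boldsymbol x_{j_1}\boldsymbol\partial_{j_2}\ \prod_{a\notin\mathfrak a}(v-z_a)\ \prod_{a\in\mathfrak a}(\partial_v-\Lambda_{j_1(a)})^{-1}\ \times\ \frac{(\partial_v-\Lambda_1)\cdots(\partial_v-\Lambda_m)}{(\partial_v-\Lambda_{m+1})\cdots(\partial_v-\Lambda_{m+n})},$$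 where $J(\mathfrak a)$, $\sim$, $c(j_1,j_2)$, $\boldsymbol x_j$, $\boldsymbol\partial_j$ and $\mathrm{Ber}^{\hat{\boldsymbol s}_0}$ are as defined in the context.
   Context: Everything is over $\mathbb C$; $[a,b]=ab-(-1)^{\bar a\bar b}ba$ is the supercommutator. Put $\bar i=\bar0$ for $1\le i\le m$, $\bar i=\bar1$ for $m+1\le i\le m+n$; $(-1)^{\bar 0}=1$, $(-1)^{\bar1}=-1$. $\mathcal D$ is the superalgebra generated by $x_{i,a},\partial_{i,a}$, $1\le i\le m+n$, $1\le a\le k$, with parities $\bar x_{i,a}=\bar\partial_{i,a}=\bar i$ and relations $[x_{i,a},x_{j,b}]=[\partial_{i,a},\partial_{j,b}]=0$, $[\partial_{i,a},x_{j,b}]=\delta_{i,j}\delta_{a,b}$. $\mathcal D_v=\mathcal D((v^{-1}))$ is the superalgebra of Laurent series in $v^{-1}$ over $\mathcal D$ ($v$ even and central over $\mathcal D$), with derivation $d/dv$, and $\mathcal D_v((\partial_v^{-1}))$ is the superalgebra of pseudodifferential operators: series $\sum_{r\le N}f_r\partial_v^r$, $f_r\in\mathcal D_v$, multiplied by $\partial_v^rf=\sum_{s\ge0}\binom rs f_{(s)}\partial_v^{r-s}$ for $r\in\mathbb Z$, where $f_{(s)}$ is the $s$-th $v$-derivative of $f$. Inverses of $\partial_v-\Lambda_i$ are expanded in powers of $\partial_v^{-1}$. Berezinian: for a square matrix $A$ let $d_i(A)$ (principal quasi-minor) be the inverse of the $(i,i)$ entry of the inverse of the top-left $i\times i$ submatrix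 of $A$. For a sequence $\boldsymbol s=(s_1,\dots,s_N)$ with $s_i\in\{1,-1\}$ and an $N\times N$ matrix $A$, $\mathrm{Ber}^{\boldsymbol s}A=d_1(A)^{s_1}\cdots d_N(A)^{s_N}$. All these are well defined for $A=\hat B(\boldsymbol z,\boldsymbol\Lambda)$, $\boldsymbol s=\hat{\boldsymbol s}_0$. Combinatorial notation. Let $\mathfrak a=\{a_1<\dots<a_l\}\subset\{1,\dots,k\}$, $l=|\mathfrak a|$. $J(\mathfrak a)$ is the set of functions $j:\{1,\dots,k\}\to\{0,1,\dots,m+n\}$ such that $j(a)=0$ if and only if $a\notin\mathfrak a$, and $|j^{-1}(i)|\le1$ for every $i\in\{1,\dots,m\}$. For $j_1,j_2\in J(\mathfrak a)$, $j_1\sim j_2$ means $|j_1^{-1}(i)|=|j_2^{-1}(i)|$ for all $i$. If $j_1\sim j_2$, $\sigma_{j_1,j_2}\in\mathfrak S_l$, acting on $\mathfrak a$ by $a_s\mapsto a_{\sigma_{j_1,j_2}(s)}$, is the unique permutation which maps $j_2^{-1}(i)$ onto $j_1^{-1}(i)$ by an increasing function for each $i=1,\dots,m+n$ (so $j_1(a_{\sigma_{j_1,j_2}(s)})=j_2(a_s)$). $\mathrm{sgn}(j_1,j_2)=(-1)^{\#}$, where $\#$ is the number of pairs $(s,s')$ with $1\le s<s'\le l$, $\sigma_{j_1,j_2}(s)<\sigma_{j_1,j_2}(s')$, $j_2(a_s)>m$ and $j_2(a_{s'})>m$. $c(j_1,j_2)=\mathrm{sgn}(j_1,j_2)\,\mathrm{sgn}(\sigma_{j_1,j_2})\,(-1)^l$,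 where $\mathrm{sgn}(\sigma_{j_1,j_2})$ is the usual sign of the permutation. For $j\in J(\mathfrak a)$: $\boldsymbol x_j=x_{j(a_1),a_1}x_{j(a_2),a_2}\cdots x_{j(a_l),a_l}$ and $\boldsymbol\partial_j=\partial_{j(a_1),a_1}\partial_{j(a_2),a_2}\cdots\partial_{j(a_l),a_l}$ (both equal to $1$ when $\mathfrak a=\emptyset$). *)

theory Defs
  imports
    Complex_Main
    "HOL-Library.Type_Length"
    "HOL-Library.Nat_Bijection"
    "HOL-Library.FuncSet"
    "HOL-Combinatorics.Permutations"
    "HOL-Computational_Algebra.Formal_Laurent_Series"
    "Jordan_Normal_Form.Matrix"
begin

section \<open>The superalgebra of differential operators\<close>

(* The parity of the index i, as an exponent of -1. *)
definition par :: "nat \<Rightarrow> nat \<Rightarrow> nat" where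
  "par m i = (if i \<le> m then 0 else 1)"

(* The superalgebra D is the quotient of the expressions over the generators x_{i,a}, d_{i,a} and
   the complex scalars by the least congruence containing the axioms of unital associative
   complex algebras and the defining relations. *)
datatype weyl_expr =
    Weyl_x nat nat
  | Weyl_d nat nat
  | Weyl_scal complex
  | Weyl_add weyl_expr weyl_expr
  | Weyl_mul weyl_expr weyl_expr

definition supercomm :: "nat \<Rightarrow> nat \<Rightarrow> weyl_expr \<Rightarrow> weyl_expr \<Rightarrow> weyl_expr" where
  "supercomm p q a b = Weyl_add (Weyl_mul a b) (Weyl_mul (Weyl_scal (- ((-1) ^ (p * q)))) (Weyl_mul b a))"

inductive weyl_eq :: "nat \<Rightarrow> nat \<Rightarrow> nat \<Rightarrow> weyl_expr \<Rightarrow> weyl_expr \<Rightarrow> bool"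
  for m n k :: nat
where
  weyl_eq_refl: "weyl_eq m n k p p"
| weyl_eq_sym: "weyl_eq m n k p q \<Longrightarrow> weyl_eq m n k q p"
| weyl_eq_trans: "weyl_eq m n k p q \<Longrightarrow> weyl_eq m n k q r \<Longrightarrow> weyl_eq m n k p r"
| weyl_eq_add_cong: "weyl_eq m n k p p' \<Longrightarrow> weyl_eq m n k q q' \<Longrightarrow> weyl_eq m n k (Weyl_add p q) (Weyl_add p' q')"
| weyl_eq_mul_cong: "weyl_eq m n k p p' \<Longrightarrow> weyl_eq m n k q q' \<Longrightarrow> weyl_eq m n k (Weyl_mul p q) (Weyl_mul p' q')"
| weyl_eq_add_assoc: "weyl_eq m n k (Weyl_add (Weyl_add p q) r) (Weyl_add p (Weyl_add q r))"
| weyl_eq_add_comm: "weyl_eq m n k (Weyl_add p q) (Weyl_add q p)"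
| weyl_eq_add_zero: "weyl_eq m n k (Weyl_add (Weyl_scal 0) p) p"
| weyl_eq_mul_assoc: "weyl_eq m n k (Weyl_mul (Weyl_mul p q) r) (Weyl_mul p (Weyl_mul q r))"
| weyl_eq_mul_one: "weyl_eq m n k (Weyl_mul (Weyl_scal 1) p) p"
| weyl_eq_distrib_left: "weyl_eq m n k (Weyl_mul p (Weyl_add q r)) (Weyl_add (Weyl_mul p q) (Weyl_mul p r))"
| weyl_eq_distrib_right: "weyl_eq m n k (Weyl_mul (Weyl_add p q) r) (Weyl_add (Weyl_mul p r) (Weyl_mul q r))"
| weyl_eq_scal_add: "weyl_eq m n k (Weyl_add (Weyl_scal c) (Weyl_scal d)) (Weyl_scal (c + d))"
| weyl_eq_scal_mul: "weyl_eq m n k (Weyl_mul (Weyl_scal c) (Weyl_scal d)) (Weyl_scal (c * d))"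
| weyl_eq_scal_zero: "weyl_eq m n k (Weyl_mul (Weyl_scal 0) p) (Weyl_scal 0)"
| weyl_eq_scal_central: "weyl_eq m n k (Weyl_mul p (Weyl_scal c)) (Weyl_mul (Weyl_scal c) p)"
| weyl_eq_x_x: "\<lbrakk>i \<in> {1..m+n}; j \<in> {1..m+n}; a \<in> {1..k}; b \<in> {1..k}\<rbrakk> \<Longrightarrow>
    weyl_eq m n k (supercomm (par m i) (par m j) (Weyl_x i a) (Weyl_x j b)) (Weyl_scal 0)"
| weyl_eq_d_d: "\<lbrakk>i \<in> {1..m+n}; j \<in> {1..m+n}; a \<in> {1..k}; b \<in> {1..k}\<rbrakk> \<Longrightarrow>
    weyl_eq m n k (supercomm (par m i) (par m j) (Weyl_d i a) (Weyl_d j b)) (Weyl_scal 0)"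
| weyl_eq_d_x: "\<lbrakk>i \<in> {1..m+n}; j \<in> {1..m+n}; a \<in> {1..k}; b \<in> {1..k}\<rbrakk> \<Longrightarrow>
    weyl_eq m n k (supercomm (par m i) (par m j) (Weyl_d i a) (Weyl_x j b))
      (Weyl_scal (if i = j \<and> a = b then 1 else 0))"
  (* The expressions have generators for all pairs of natural numbers; those outside the index range
     are killed, so that only the x_{i,a}, d_{i,a} with 1 <= i <= m+n, 1 <= a <= k remain. *)
| weyl_eq_x_outside: "\<not> (i \<in> {1..m+n} \<and> a \<in> {1..k}) \<Longrightarrow> weyl_eq m n k (Weyl_x i a) (Weyl_scal 0)"
| weyl_eq_d_outside: "\<not> (i \<in> {1..m+n} \<and> a \<in> {1..k}) \<Longrightarrow> weyl_eq m n k (Weyl_d i a) (Weyl_scal 0)"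

(* Action of the expressions on functions of the exponents of the variables (bosonic/fermionic Fock
   space). It only serves to show that 0 and 1 are different in D, which the class ring_1
   requires. *)
definition fock_sign :: "(nat \<Rightarrow> bool) \<Rightarrow> nat \<Rightarrow> (nat \<Rightarrow> nat) \<Rightarrow> complex" where
  "fock_sign Q c e = (if Q c then (\<Prod>p | p < c \<and> Q p. (-1) ^ e p) else 1)"

definition fock_x :: "(nat \<Rightarrow> bool) \<Rightarrow> nat \<Rightarrow> ((nat \<Rightarrow> nat) \<Rightarrow> complex) \<Rightarrow> (nat \<Rightarrow> nat) \<Rightarrow> complex" where
  "fock_x Q c f e = (if (if Q c then odd (e c) else e c > 0)
     then fock_sign Q c e * f (e(c := e c - 1)) else 0)"

definition fock_d :: "(nat \<Rightarrow> bool) \<Rightarrow> nat \<Rightarrow> ((nat \<Rightarrow> nat) \<Rightarrow> complex) \<Rightarrow> (nat \<Rightarrow> nat) \<Rightarrow> complex" where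
  "fock_d Q c f e = (if Q c then (if even (e c) then fock_sign Q c e * f (e(c := e c + 1)) else 0)
     else of_nat (e c + 1) * f (e(c := e c + 1)))"

lemma fock_sign_other: "\<not> (p < c \<and> Q p) \<or> \<not> Q c \<Longrightarrow> fock_sign Q c (e(p := y)) = fock_sign Q c e"
  by (auto simp: fock_sign_def intro!: prod.cong)

lemma fock_sign_flip:
  assumes "p < c" "Q p" "Q c" "odd (y + e p)"
  shows "fock_sign Q c (e(p := y)) = - fock_sign Q c e"
proof -
  let ?A = "{q. q < c \<and> Q q}"
  have A: "finite ?A" "p \<in> ?A" using assms by auto
  have "(\<Prod>q\<in>?A. (-1) ^ (e(p := y)) q) = (-1) ^ y * (\<Prod>q\<in>?A-{p}. (-1) ^ e q :: complex)"
    using A by (subst prod.remove[of _ p]) (auto intro!: prod.cong)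
  moreover have "(\<Prod>q\<in>?A. (-1) ^ e q) = (-1) ^ e p * (\<Prod>q\<in>?A-{p}. (-1) ^ e q :: complex)"
    using A by (subst prod.remove[of _ p]) auto
  moreover have "(-1) ^ y = (- ((-1) ^ e p) :: complex)"
    using assms(4) by (cases "even y") auto
  ultimately show ?thesis using assms by (simp add: fock_sign_def)
qed

lemma fock_sign_sq: "fock_sign Q c e * fock_sign Q c e = 1"
  by (simp add: fock_sign_def flip: prod.distrib power_mult_distrib)

lemma fock_sign_sq': "fock_sign Q c e * (fock_sign Q c e * z) = z"
  by (simp add: fock_sign_sq flip: mult.assoc)

lemma fock_sign_even: "\<not> Q c \<Longrightarrow> fock_sign Q c e = 1"
  by (simp add: fock_sign_def)

lemma fock_x_x: "fock_x Q c (fock_x Q c' f) e = (if Q c \<and> Q c' then -1 else 1) * fock_x Q c' (fock_x Q c f) e"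
proof (cases "c = c'")
  case True then show ?thesis by (auto simp: fock_x_def fock_sign_other)
next
  case False
  have tw: "e(c := y, c' := y') = e(c' := y', c := y)" for y y' using False by (rule fun_upd_twist)
  consider "c < c'" | "c' < c" using False by linarith
  then show ?thesis
    by cases (use False in \<open>auto simp: fock_x_def fock_sign_other fock_sign_flip tw\<close>)
qed

lemma fock_d_d: "fock_d Q c (fock_d Q c' f) e = (if Q c \<and> Q c' then -1 else 1) * fock_d Q c' (fock_d Q c f) e"
proof (cases "c = c'")
  case True then show ?thesis by (auto simp: fock_d_def fock_sign_other)
next
  case False
  have tw: "e(c := y, c' := y') = e(c' := y', c := y)" for y y' using False by (rule fun_upd_twist)
  consider "c < c'" | "c' < c" using False by linarith
  then show ?thesis
    by cases (use False in \<open>auto simp: fock_d_def fock_sign_other fock_sign_flip tw\<close>)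
qed

lemma fock_d_x_same: "fock_d Q c (fock_x Q c f) e = (if Q c then -1 else 1) * fock_x Q c (fock_d Q c f) e + f e"
proof -
  have "e(c := 0) = e" if "e c = 0" using that by (auto simp: fun_eq_iff)
  then show ?thesis
    by (cases "Q c"; cases "even (e c)"; cases "e c = 0")
      (simp_all add: fock_x_def fock_d_def fock_sign_other fock_sign_even fock_sign_sq' fock_sign_sq algebra_simps)
qed

lemma fock_d_x: 
  assumes "c \<noteq> c'"
  shows "fock_d Q c (fock_x Q c' f) e = (if Q c \<and> Q c' then -1 else 1) * fock_x Q c' (fock_d Q c f) e"
proof -
  have tw: "e(c := y, c' := y') = e(c' := y', c := y)" for y y' using assms by (rule fun_upd_twist)
  consider "c < c'" | "c' < c" using assms by linarith
  then show ?thesis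
    by cases (use assms in \<open>auto simp: fock_x_def fock_d_def fock_sign_other fock_sign_flip tw\<close>)
qed

fun fock_eval :: "nat \<Rightarrow> nat \<Rightarrow> nat \<Rightarrow> weyl_expr \<Rightarrow> ((nat \<Rightarrow> nat) \<Rightarrow> complex) \<Rightarrow> (nat \<Rightarrow> nat) \<Rightarrow> complex" where
  "fock_eval m n k (Weyl_x i a) f e = (if i \<in> {1..m+n} \<and> a \<in> {1..k}
     then fock_x (\<lambda>c. fst (prod_decode c) > m) (prod_encode (i, a)) f e else 0)"
| "fock_eval m n k (Weyl_d i a) f e = (if i \<in> {1..m+n} \<and> a \<in> {1..k}
     then fock_d (\<lambda>c. fst (prod_decode c) > m) (prod_encode (i, a)) f e else 0)"
| "fock_eval m n k (Weyl_scal c) f e = c * f e"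
| "fock_eval m n k (Weyl_add p q) f e = fock_eval m n k p f e + fock_eval m n k q f e"
| "fock_eval m n k (Weyl_mul p q) f e = fock_eval m n k p (fock_eval m n k q f) e"

lemma fock_eval_gen:
  assumes "i \<in> {1..m+n}" "a \<in> {1..k}"
  shows "fock_eval m n k (Weyl_x i a) = fock_x (\<lambda>c. fst (prod_decode c) > m) (prod_encode (i, a))"
    and "fock_eval m n k (Weyl_d i a) = fock_d (\<lambda>c. fst (prod_decode c) > m) (prod_encode (i, a))"
  using assms by (auto simp: fun_eq_iff)

lemma fock_eval_add: "fock_eval m n k p (\<lambda>e. f e + g e) = (\<lambda>e. fock_eval m n k p f e + fock_eval m n k p g e)"
proof (induction p arbitrary: f g)
  case (Weyl_mul p q)
  have *: "fock_eval m n k (Weyl_mul p q) h = fock_eval m n k p (fock_eval m n k q h)" for h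
    by (simp add: fun_eq_iff)
  show ?case unfolding * by (simp only: Weyl_mul)
qed (auto simp: fun_eq_iff fock_x_def fock_d_def algebra_simps)

lemma fock_eval_scale: "fock_eval m n k p (\<lambda>e. c * f e) = (\<lambda>e. c * fock_eval m n k p f e)"
proof (induction p arbitrary: f)
  case (Weyl_mul p q)
  have *: "fock_eval m n k (Weyl_mul p q) h = fock_eval m n k p (fock_eval m n k q h)" for h
    by (simp add: fun_eq_iff)
  show ?case unfolding * by (simp only: Weyl_mul)
qed (auto simp: fun_eq_iff fock_x_def fock_d_def algebra_simps)

lemma fock_eval_cong: "weyl_eq m n k p q \<Longrightarrow> fock_eval m n k p = fock_eval m n k q"
proof (induction rule: weyl_eq.induct)
  case (weyl_eq_distrib_left p q r)
  have *: "fock_eval m n k (Weyl_add q r) f = (\<lambda>e. fock_eval m n k q f e + fock_eval m n k r f e)" for f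
    by (simp add: fun_eq_iff)
  show ?case by (simp add: fun_eq_iff * fock_eval_add del: fock_eval.simps(4)) simp
next
  case (weyl_eq_scal_central p c)
  have *: "fock_eval m n k (Weyl_scal c) f = (\<lambda>e. c * f e)" for f by (simp add: fun_eq_iff)
  show ?case by (simp add: fun_eq_iff * fock_eval_scale)
next
  case (weyl_eq_mul_cong p p' q q')
  have *: "fock_eval m n k (Weyl_mul p q) f = fock_eval m n k p (fock_eval m n k q f)" for p q f
    by (simp add: fun_eq_iff)
  show ?case by (rule ext) (simp only: * weyl_eq_mul_cong.IH)
next
  case (weyl_eq_mul_assoc p q r)
  have *: "fock_eval m n k (Weyl_mul p q) f = fock_eval m n k p (fock_eval m n k q f)" for p q f
    by (simp add: fun_eq_iff)
  show ?case by (simp add: fun_eq_iff *)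
next
  case (weyl_eq_x_x i j a b)
  then show ?case
    by (simp add: fun_eq_iff supercomm_def par_def fock_eval_gen 
        fock_x_x[of _ "prod_encode (i,a)" "prod_encode (j,b)"])
next
  case (weyl_eq_d_d i j a b)
  then show ?case
    by (simp add: fun_eq_iff supercomm_def par_def fock_eval_gen 
        fock_d_d[of _ "prod_encode (i,a)" "prod_encode (j,b)"])
next
  case (weyl_eq_d_x i j a b)
  then show ?case
    by (cases "(i, a) = (j, b)")
      (auto simp: fun_eq_iff supercomm_def par_def fock_eval_gen fock_d_x fock_d_x_same)
qed (auto simp: fun_eq_iff algebra_simps)

lemma weyl_zero_neq_one: "\<not> weyl_eq m n k (Weyl_scal 0) (Weyl_scal 1)"
proof
  assume "weyl_eq m n k (Weyl_scal 0) (Weyl_scal 1)"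
  from fock_eval_cong[OF this] have "fock_eval m n k (Weyl_scal 0) (\<lambda>_. 1) (\<lambda>_. 0) = fock_eval m n k (Weyl_scal 1) (\<lambda>_. 1) (\<lambda>_. 0)" by simp
  then show False by simp
qed

(* The numbers m, n, k are the lengths of the type parameters; every natural number is the length of
   a type of class len0, 0 included. *)
quotient_type (overloaded) ('m, 'n, 'k) weyl =
  weyl_expr / "weyl_eq LENGTH('m::len0) LENGTH('n::len0) LENGTH('k::len0)"
  by (intro equivpI reflpI sympI transpI) (blast intro: weyl_eq.intros)+

instantiation weyl :: (len0, len0, len0) ring_1
begin

lift_definition zero_weyl :: "('a, 'b, 'c) weyl" is "Weyl_scal 0" .
lift_definition one_weyl :: "('a, 'b, 'c) weyl" is "Weyl_scal 1" .
lift_definition plus_weyl :: "('a, 'b, 'c) weyl \<Rightarrow> ('a, 'b, 'c) weyl \<Rightarrow> ('a, 'b, 'c) weyl"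
  is Weyl_add by (rule weyl_eq_add_cong)
lift_definition times_weyl :: "('a, 'b, 'c) weyl \<Rightarrow> ('a, 'b, 'c) weyl \<Rightarrow> ('a, 'b, 'c) weyl"
  is Weyl_mul by (rule weyl_eq_mul_cong)
lift_definition uminus_weyl :: "('a, 'b, 'c) weyl \<Rightarrow> ('a, 'b, 'c) weyl"
  is "Weyl_mul (Weyl_scal (-1))" by (blast intro: weyl_eq.intros)
definition minus_weyl :: "('a, 'b, 'c) weyl \<Rightarrow> ('a, 'b, 'c) weyl \<Rightarrow> ('a, 'b, 'c) weyl" where
  "minus_weyl a b = a + - b"

instance
proof
  fix a b c :: "('a, 'b, 'c) weyl"
  show "a + b + c = a + (b + c)" by transfer (rule weyl_eq_add_assoc)
  show "a + b = b + a" by transfer (rule weyl_eq_add_comm)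
  show "0 + a = a" by transfer (rule weyl_eq_add_zero)
  show "a * b * c = a * (b * c)" by transfer (rule weyl_eq_mul_assoc)
  show "1 * a = a" by transfer (rule weyl_eq_mul_one)
  show "a * 1 = a" by transfer (blast intro: weyl_eq.intros)
  show "a * (b + c) = a * b + a * c" by transfer (rule weyl_eq_distrib_left)
  show "(a + b) * c = a * c + b * c" by transfer (rule weyl_eq_distrib_right)
  show "a - b = a + - b" by (rule minus_weyl_def)
  show "(0 :: ('a, 'b, 'c) weyl) \<noteq> 1" by transfer (rule weyl_zero_neq_one)
  show "- a + a = 0"
  proof (transfer, goal_cases)
    case (1 a)
    let ?E = "weyl_eq LENGTH('a) LENGTH('b) LENGTH('c)"
    have "?E (Weyl_add (Weyl_mul (Weyl_scal (-1)) a) a) (Weyl_add (Weyl_mul (Weyl_scal (-1)) a) (Weyl_mul (Weyl_scal 1) a))"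
      by (blast intro: weyl_eq.intros)
    moreover have "?E \<dots> (Weyl_mul (Weyl_add (Weyl_scal (-1)) (Weyl_scal 1)) a)"
      by (blast intro: weyl_eq.intros)
    moreover have "?E \<dots> (Weyl_mul (Weyl_scal (-1 + 1)) a)"
      by (blast intro: weyl_eq.intros)
    moreover have "?E (Weyl_mul (Weyl_scal (-1 + 1)) a) (Weyl_scal 0)"
      by (simp add: weyl_eq_scal_zero)
    ultimately show ?case by (blast intro: weyl_eq_trans)
  qed
qed

end

lift_definition weyl_x :: "nat \<Rightarrow> nat \<Rightarrow> ('m::len0, 'n::len0, 'k::len0) weyl" is Weyl_x .
lift_definition weyl_d :: "nat \<Rightarrow> nat \<Rightarrow> ('m::len0, 'n::len0, 'k::len0) weyl" is Weyl_d .
lift_definition weyl_scal :: "complex \<Rightarrow> ('m::len0, 'n::len0, 'k::len0) weyl" is Weyl_scal .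

section \<open>Pseudodifferential operators\<close>

(* Laurent series in 1/v over D are Laurent series in fls_X = 1/v, so v = fls_X_inv and
   d/dv = - (1/v)^2 d/d(1/v). *)
definition v_deriv :: "'a::ring_1 fls \<Rightarrow> 'a fls" where
  "v_deriv f = - (fls_X\<^sup>2 * fls_deriv f)"

lemma v_deriv_v: "v_deriv fls_X_inv = 1"
proof -
  have "fls_X\<^sup>2 * fls_X_inv\<^sup>2 = (1 :: 'a fls)"
    by (simp add: fls_X_power_times_conv_shift fls_X_inv_power_conv_shift_1)
  then show ?thesis by (simp add: v_deriv_def)
qed

lemma v_deriv_nth: "fls_nth (v_deriv f) n = - of_int (n - 1) * fls_nth f (n - 1)"
  by (simp add: v_deriv_def fls_X_power_times_conv_shift algebra_simps)

lemma v_deriv_0 [simp]: "v_deriv 0 = 0"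
  by (simp add: v_deriv_def)

lemma v_deriv_1 [simp]: "v_deriv 1 = 0"
  by (simp add: v_deriv_def)

lemma v_deriv_add: "v_deriv (f + g) = v_deriv f + v_deriv g"
  by (simp add: v_deriv_def algebra_simps)

lemma v_deriv_mult: "v_deriv (f * g) = v_deriv f * g + f * v_deriv g"
proof -
  have "fls_X\<^sup>2 * (f * fls_deriv g) = f * (fls_X\<^sup>2 * fls_deriv g)"
    by (simp add: power2_eq_square fls_X_times_conv_shift fls_shifted_times_simps mult.assoc)
  then show ?thesis by (simp add: v_deriv_def algebra_simps)
qed

lemma v_deriv_of_int_mult: "v_deriv (of_int c * f) = of_int c * v_deriv f"
  by (simp add: v_deriv_mult) (simp add: v_deriv_def)

lemma v_deriv_pow_0 [simp]: "(v_deriv ^^ s) 0 = 0"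
  by (induction s) auto

lemma v_deriv_pow_1: "(v_deriv ^^ s) 1 = (if s = 0 then 1 else 0)"
  by (cases s) (auto simp: funpow_swap1)

lemma v_deriv_pow_add: "(v_deriv ^^ s) (f + g) = (v_deriv ^^ s) f + (v_deriv ^^ s) g"
  by (induction s) (auto simp: v_deriv_add)

lemma v_deriv_pow_sum: "(v_deriv ^^ s) (\<Sum>x\<in>A. f x) = (\<Sum>x\<in>A. (v_deriv ^^ s) (f x))"
  by (induction A rule: infinite_finite_induct) (auto simp: v_deriv_pow_add)

lemma v_deriv_pow_of_int_mult: "(v_deriv ^^ s) (of_int c * f) = of_int c * (v_deriv ^^ s) f"
  by (induction s) (auto simp: v_deriv_of_int_mult)

lemma v_deriv_sum: "v_deriv (\<Sum>x\<in>A. f x) = (\<Sum>x\<in>A. v_deriv (f x))"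
  using v_deriv_pow_sum[of 1] by simp

lemma v_deriv_pow_mult:
  "(v_deriv ^^ s) (f * g) = (\<Sum>i\<le>s. of_int (int (s choose i)) * ((v_deriv ^^ i) f * (v_deriv ^^ (s - i)) g))"
proof (induction s)
  case (Suc s)
  define a where "a i j = (v_deriv ^^ i) f * (v_deriv ^^ j) g" for i j
  have da: "v_deriv (a i j) = a (Suc i) j + a i (Suc j)" for i j
    by (simp add: a_def v_deriv_mult)
  have "(v_deriv ^^ Suc s) (f * g) = (\<Sum>i\<le>s. of_int (int (s choose i)) * (a (Suc i) (s - i) + a i (Suc (s - i))))"
    by (simp add: Suc v_deriv_sum v_deriv_of_int_mult flip: a_def del: of_int_of_nat_eq) (simp add: da)
  also have "\<dots> = (\<Sum>i\<le>s. of_int (int (s choose i)) * a (Suc i) (s - i)) + (\<Sum>i\<le>s. of_int (int (s choose i)) * a i (Suc s - i))"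
    by (simp add: distrib_left sum.distrib Suc_diff_le)
  also have "(\<Sum>i\<le>s. of_int (int (s choose i)) * a i (Suc s - i)) = (\<Sum>i\<le>Suc s. of_int (int (s choose i)) * a i (Suc s - i))"
    by (simp add: binomial_eq_0)
  also have "\<dots> = a 0 (Suc s) + (\<Sum>i\<le>s. of_int (int (s choose Suc i)) * a (Suc i) (s - i))"
    by (subst sum.atMost_Suc_shift) simp
  also have "(\<Sum>i\<le>s. of_int (int (s choose i)) * a (Suc i) (s - i)) + (a 0 (Suc s) + (\<Sum>i\<le>s. of_int (int (s choose Suc i)) * a (Suc i) (s - i)))
     = a 0 (Suc s) + (\<Sum>i\<le>s. of_int (int (Suc s choose Suc i)) * a (Suc i) (s - i))"
    by (simp add: sum.distrib distrib_right algebra_simps)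
  also have "\<dots> = (\<Sum>i\<le>Suc s. of_int (int (Suc s choose i)) * a i (Suc s - i))"
    by (subst sum.atMost_Suc_shift) simp
  finally show ?case by (simp add: a_def)
qed simp

(* The series F_N dv^N + F_(N-1) dv^(N-1) + ... is represented by its coefficient function F. *)
typedef (overloaded) 'a psdo = "{F :: int \<Rightarrow> 'a::zero fls. \<exists>N. \<forall>r>N. F r = 0}"
  morphisms psdo_coeff Abs_psdo
  by (rule exI[of _ "\<lambda>_. 0"]) simp

setup_lifting type_definition_psdo

(* Integer-valued generalized binomial coefficient; see of_int_binom. *)
definition binom :: "int \<Rightarrow> nat \<Rightarrow> int" where
  "binom r s = (\<Prod>i<s. r - int i) div fact s"

lemma of_int_binom: "of_int (binom r s) = (of_int r :: 'b::field_char_0) gchoose s"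
  using of_int_gbinomial[of r s, where 'a = 'b]
  unfolding binom_def gbinomial_prod_rev[where 'a = int] by (simp add: atLeast0LessThan)

(* Coefficient of dv^u in F * G: the term F_r dv^r G_t dv^t contributes
   binom r s F_r (d/dv)^s(G_t) for s = r + t - u. Only finitely many pairs (r, s) occur. *)
definition psdo_times :: "(int \<Rightarrow> 'a fls) \<Rightarrow> (int \<Rightarrow> 'a fls) \<Rightarrow> int \<Rightarrow> 'a::ring_1 fls" where
  "psdo_times F G u = (\<Sum>(r :: int, s :: nat) | F r \<noteq> 0 \<and> G (u - r + int s) \<noteq> 0.
     of_int (binom r s) * F r * (v_deriv ^^ s) (G (u - r + int s)))"

lemma psdo_times_box:
  assumes "\<And>r. r > N \<Longrightarrow> F r = 0" "\<And>t. t > M \<Longrightarrow> G t = 0" "A \<le> u - M" "N + M - u \<le> int K"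
  shows "psdo_times F G u = (\<Sum>r=A..N. \<Sum>s\<le>K. of_int (binom r s) * F r * (v_deriv ^^ s) (G (u - r + int s)))"
proof -
  have "r \<in> {A..N} \<and> s \<in> {..K}" if "F r \<noteq> 0" "G (u - r + int s) \<noteq> 0" for r s
  proof -
    have "r \<le> N" "u - r + int s \<le> M" using that assms(1,2) by force+
    then show ?thesis using assms(3,4) by auto
  qed
  then show ?thesis unfolding psdo_times_def sum.cartesian_product
    by (intro sum.mono_neutral_left) auto
qed

lemma psdo_times_0:
  assumes "\<And>r. r > N \<Longrightarrow> F r = 0" "\<And>t. t > M \<Longrightarrow> G t = 0" "u > N + M"
  shows "psdo_times F G u = 0"
  by (subst psdo_times_box[of N F M G "N + 1" u 0]) (use assms in auto)

lemma sum_shift_support: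
  fixes g :: "int \<Rightarrow> 'a::comm_monoid_add"
  assumes "finite A" "finite B" "\<And>t. g t \<noteq> 0 \<Longrightarrow> t \<in> B \<and> t + c \<in> A"
  shows "(\<Sum>p\<in>A. g (p - c)) = (\<Sum>t\<in>B. g t)"
proof -
  have "(\<Sum>p\<in>A. g (p - c)) = (\<Sum>t\<in>(\<lambda>p. p - c) ` A. g t)"
    by (subst sum.reindex) (auto simp: inj_on_def)
  also have "\<dots> = (\<Sum>t\<in>{t. g t \<noteq> 0}. g t)"
    by (rule sum.mono_neutral_right) (use assms in \<open>force simp: image_iff\<close>)+
  also have "\<dots> = (\<Sum>t\<in>B. g t)"
    by (rule sum.mono_neutral_left) (use assms in auto)
  finally show ?thesis .
qed

lemma binom_assoc:
  "(\<Sum>q\<le>j. binom r (i + q) * int (i + q choose i) * binom t (j - q)) =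
     binom r i * binom (r + t - int i) j"
proof -
  have 1: "binom r (i + q) * int (i + q choose i) = binom r i * binom (r - int i) q" for q
  proof -
    have "real_of_int (binom r (i + q) * int (i + q choose i)) = real_of_int (binom r i * binom (r - int i) q)"
      using gbinomial_trinomial_revision[of i "i + q" "real_of_int r"]
      by (simp add: of_int_binom binomial_gbinomial)
    then show ?thesis by (simp only: of_int_eq_iff)
  qed
  have "(\<Sum>q\<le>j. binom (r - int i) q * binom t (j - q)) = binom (r - int i + t) j"
  proof -
    have "real_of_int (\<Sum>q\<le>j. binom (r - int i) q * binom t (j - q)) = real_of_int (binom (r - int i + t) j)"
      using gbinomial_Vandermonde[of "real_of_int (r - int i)" "real_of_int t" j]
      by (simp add: of_int_binom atLeast0AtMost)
    then show ?thesis by (simp only: of_int_eq_iff)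
  qed
  moreover have "r - int i + t = r + t - int i" by simp
  ultimately show ?thesis by (simp only: 1 mult.assoc flip: sum_distrib_left)
qed

lemma psdo_times_assoc:
  assumes F: "\<And>r. r > N \<Longrightarrow> F r = 0" and G: "\<And>r. r > M \<Longrightarrow> G r = 0" and H: "\<And>r. r > P \<Longrightarrow> H r = 0"
  shows "psdo_times (psdo_times F G) H u = psdo_times F (psdo_times G H) u"
proof -
  define K where "K = nat (N + M + P - u)"
  define R where "R = {u - M - P..N}"
  define T where "T = {u - N - P..M}"
  define E where "E r t i j = F r * (v_deriv ^^ i) (G t) * (v_deriv ^^ j) (H (u - r - t + int i + int j))" for r t i j
  have E0: "r \<le> N \<and> t \<le> M \<and> u - r - t + int i + int j \<le> P" if "E r t i j \<noteq> 0" for r t i j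
    using that F[of r] G[of t] H[of "u - r - t + int i + int j"] by (force simp: E_def not_less)
  have FG: "psdo_times F G p = (\<Sum>r\<in>R. \<Sum>i\<le>K. of_int (binom r i) * F r * (v_deriv ^^ i) (G (p - r + int i)))"
    if "p \<ge> u - P" for p
    unfolding R_def by (rule psdo_times_box) (use F G that in \<open>auto simp: K_def\<close>)
  have GH: "psdo_times G H w = (\<Sum>t\<in>T. \<Sum>l\<le>K. of_int (binom t l) * G t * (v_deriv ^^ l) (H (w - t + int l)))"
    if "w \<ge> u - N" for w
    unfolding T_def by (rule psdo_times_box) (use G H that in \<open>auto simp: K_def\<close>)

  have "psdo_times (psdo_times F G) H u =
     (\<Sum>p=u-P..N+M. \<Sum>j\<le>K. of_int (binom p j) * psdo_times F G p * (v_deriv ^^ j) (H (u - p + int j)))"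
    by (rule psdo_times_box) (use F G H psdo_times_0[of N F M G] in \<open>auto simp: K_def\<close>)
  also have "\<dots> = (\<Sum>p=u-P..N+M. \<Sum>j\<le>K. \<Sum>r\<in>R. \<Sum>i\<le>K.
      of_int (binom r i * binom p j) * E r (p - (r - int i)) i j)"
  proof (intro sum.cong refl, goal_cases)
    case (1 p j)
    have "of_int (binom p j) * psdo_times F G p * (v_deriv ^^ j) (H (u - p + int j)) = 
      (\<Sum>r\<in>R. \<Sum>i\<le>K. of_int (binom p j) * (of_int (binom r i) * F r * (v_deriv ^^ i) (G (p - r + int i)))
         * (v_deriv ^^ j) (H (u - p + int j)))"
      using 1 by (simp add: FG sum_distrib_left sum_distrib_right)
    also have "\<dots> = (\<Sum>r\<in>R. \<Sum>i\<le>K. of_int (binom r i * binom p j) * E r (p - (r - int i)) i j)"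
    proof (intro sum.cong refl, goal_cases)
      case (1 r i)
      have "of_int (binom p j) * (of_int (binom r i) * x) = (of_int (binom r i * binom p j) * x :: 'a fls)" for x
        by (metis mult.assoc mult.commute of_int_mult)
      then show ?case by (simp add: E_def mult.assoc algebra_simps)
    qed
    finally show ?case .
  qed
  also have "\<dots> = (\<Sum>p=u-P..N+M. \<Sum>r\<in>R. \<Sum>j\<le>K. \<Sum>i\<le>K.
      of_int (binom r i * binom p j) * E r (p - (r - int i)) i j)"
    by (intro sum.cong refl sum.swap)
  also have "\<dots> = (\<Sum>r\<in>R. \<Sum>p=u-P..N+M. \<Sum>j\<le>K. \<Sum>i\<le>K.
      of_int (binom r i * binom p j) * E r (p - (r - int i)) i j)"
    by (rule sum.swap)
  also have "\<dots> = (\<Sum>r\<in>R. \<Sum>j\<le>K. \<Sum>p=u-P..N+M. \<Sum>i\<le>K.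
      of_int (binom r i * binom p j) * E r (p - (r - int i)) i j)"
    by (intro sum.cong refl sum.swap)
  also have "\<dots> = (\<Sum>r\<in>R. \<Sum>j\<le>K. \<Sum>i\<le>K. \<Sum>p=u-P..N+M.
      of_int (binom r i * binom p j) * E r (p - (r - int i)) i j)"
    by (intro sum.cong refl sum.swap)
  also have "\<dots> = (\<Sum>r\<in>R. \<Sum>j\<le>K. \<Sum>i\<le>K. \<Sum>t\<in>T.
      of_int (binom r i * binom (r + t - int i) j) * E r t i j)"
  proof (rule sum.cong[OF refl], rule sum.cong[OF refl], rule sum.cong[OF refl], goal_cases)
    case (1 r j i)
    have "(\<Sum>p=u-P..N+M. (\<lambda>t. of_int (binom r i * binom (r + t - int i) j) * E r t i j) (p - (r - int i))) =
      (\<Sum>t\<in>T. of_int (binom r i * binom (r + t - int i) j) * E r t i j)"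
    proof (rule sum_shift_support)
      fix t assume "of_int (binom r i * binom (r + t - int i) j) * E r t i j \<noteq> 0"
      then have "E r t i j \<noteq> 0" by auto
      from E0[OF this] show "t \<in> T \<and> t + (r - int i) \<in> {u-P..N+M}" by (auto simp: T_def)
    qed (auto simp: T_def)
    moreover have "r + (p - (r - int i)) - int i = p" for p by simp
    ultimately show ?case by (simp only:)
  qed
  also have "\<dots> = (\<Sum>r\<in>R. \<Sum>j\<le>K. \<Sum>t\<in>T. \<Sum>i\<le>K.
      of_int (binom r i * binom (r + t - int i) j) * E r t i j)"
    by (intro sum.cong refl sum.swap)
  also have "\<dots> = (\<Sum>r\<in>R. \<Sum>t\<in>T. \<Sum>j\<le>K. \<Sum>i\<le>K.
      of_int (binom r i * binom (r + t - int i) j) * E r t i j)"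
    by (intro sum.cong refl sum.swap)
  also have "\<dots> = (\<Sum>r\<in>R. \<Sum>t\<in>T. \<Sum>s\<le>K. \<Sum>l\<le>K. \<Sum>i\<le>s.
      of_int (binom r s * int (s choose i) * binom t l) * E r t i (s - i + l))"
  proof (rule sum.cong[OF refl], rule sum.cong[OF refl], goal_cases)
    case (1 r t)
    have small: "i + j \<le> K" if "E r t i j \<noteq> 0" for i j
      using E0[OF that] unfolding K_def by linarith
    have small': "E r t i (s - i + l) = 0" if "i \<le> s" "\<not> s + l \<le> K" for s l i
      using small[of i "s - i + l"] that by auto
    have "(\<Sum>j\<le>K. \<Sum>i\<le>K. of_int (binom r i * binom (r + t - int i) j) * E r t i j) =
       (\<Sum>j\<le>K. \<Sum>i\<le>K. \<Sum>q\<le>j. of_int (binom r (i + q) * int (i + q choose i) * binom t (j - q)) * E r t i j)"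
      by (simp only: sum_distrib_right[symmetric] of_int_sum[symmetric] binom_assoc)
    also have "\<dots> = (\<Sum>(j, i, q)\<in>Sigma {..K} (\<lambda>j. Sigma {..K} (\<lambda>i. {..j})).
        of_int (binom r (i + q) * int (i + q choose i) * binom t (j - q)) * E r t i j)"
      by (simp add: sum.Sigma)
    also have "\<dots> = (\<Sum>(j, i, q)\<in>{(j, i, q). i + j \<le> K \<and> q \<le> j}.
        of_int (binom r (i + q) * int (i + q choose i) * binom t (j - q)) * E r t i j)"
      by (rule sum.mono_neutral_right) (use small in force)+
    also have "\<dots> = (\<Sum>(s, l, i)\<in>{(s, l, i). s + l \<le> K \<and> i \<le> s}.
       of_int (binom r s * int (s choose i) * binom t l) * E r t i (s - i + l))"
      by (rule sum.reindex_bij_witness[of _ "\<lambda>(s, l, i). (s - i + l, i, s - i)" "\<lambda>(j, i, q). (i + q, j - q, i)"]) auto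
    also have "\<dots> = (\<Sum>(s, l, i)\<in>Sigma {..K} (\<lambda>s. Sigma {..K} (\<lambda>l. {..s})).
       of_int (binom r s * int (s choose i) * binom t l) * E r t i (s - i + l))"
      by (rule sum.mono_neutral_left) (use small' in \<open>auto simp del: add_diff_assoc2 diff_add_assoc2 intro: ccontr\<close>)
    also have "\<dots> = (\<Sum>s\<le>K. \<Sum>l\<le>K. \<Sum>i\<le>s.
      of_int (binom r s * int (s choose i) * binom t l) * E r t i (s - i + l))"
      by (simp add: sum.Sigma del: add_diff_assoc2 diff_add_assoc2)
    finally show ?case .
  qed
  also have "\<dots> = (\<Sum>r\<in>R. \<Sum>s\<le>K. \<Sum>t\<in>T. \<Sum>l\<le>K. \<Sum>i\<le>s.
      of_int (binom r s * int (s choose i) * binom t l) * E r t i (s - i + l))"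
    by (intro sum.cong refl sum.swap)
  also have "\<dots> = (\<Sum>r\<in>R. \<Sum>s\<le>K. of_int (binom r s) * F r * (v_deriv ^^ s) (psdo_times G H (u - r + int s)))"
  proof (intro sum.cong refl, goal_cases)
    case (1 r s)
    then have "u - r + int s \<ge> u - N" by (auto simp: R_def)
    from GH[OF this] have "of_int (binom r s) * F r * (v_deriv ^^ s) (psdo_times G H (u - r + int s)) =
       (\<Sum>t\<in>T. \<Sum>l\<le>K. of_int (binom r s) * F r *
          (v_deriv ^^ s) (of_int (binom t l) * (G t * (v_deriv ^^ l) (H (u - r + int s - t + int l)))))"
      by (simp add: v_deriv_pow_sum sum_distrib_left mult.assoc)
    also have "\<dots> = (\<Sum>t\<in>T. \<Sum>l\<le>K. \<Sum>i\<le>s.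
      of_int (binom r s * int (s choose i) * binom t l) * E r t i (s - i + l))"
    proof (intro sum.cong refl, goal_cases)
      case (1 t l)
      have comm: "of_int a * x * (of_int b * (of_int c * y)) = (of_int (a * c * b) * (x * y) :: 'a fls)" for a b c x y
      proof -
        have "of_int a * x * (of_int b * (of_int c * y)) = of_int a * (x * of_int (b * c)) * y"
          by (simp add: mult.assoc)
        also have "x * of_int (b * c) = of_int (b * c) * x"
          by (rule mult_of_int_commute[symmetric])
        also have "of_int a * (of_int (b * c) * x) * y = of_int (a * (b * c)) * (x * y)"
          by (simp add: mult.assoc)
        also have "a * (b * c) = a * c * b"
          by simp
        finally show ?thesis .
      qed
      let ?W = "(v_deriv ^^ l) (H (u - r + int s - t + int l))"
      have "of_int (binom r s) * F r * (v_deriv ^^ s) (of_int (binom t l) * (G t * ?W)) =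
         (\<Sum>i\<le>s. of_int (binom r s) * F r * (of_int (binom t l) *
            (of_int (int (s choose i)) * ((v_deriv ^^ i) (G t) * (v_deriv ^^ (s - i)) ?W))))"
        by (subst v_deriv_pow_of_int_mult, subst v_deriv_pow_mult) (simp only: sum_distrib_left)
      also have "\<dots> = (\<Sum>i\<le>s. of_int (binom r s * int (s choose i) * binom t l) *
            (F r * ((v_deriv ^^ i) (G t) * (v_deriv ^^ (s - i)) ?W)))"
        by (simp only: comm)
      also have "\<dots> = (\<Sum>i\<le>s. of_int (binom r s * int (s choose i) * binom t l) * E r t i (s - i + l))"
      proof (rule sum.cong[OF refl])
        fix i assume "i \<in> {..s}"
        then have "u - r - t + int i + int (s - i + l) = u - r + int s - t + int l"
          by (simp add: of_nat_diff)
        then show "of_int (binom r s * int (s choose i) * binom t l) *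
            (F r * ((v_deriv ^^ i) (G t) * (v_deriv ^^ (s - i)) ?W)) =
          of_int (binom r s * int (s choose i) * binom t l) * E r t i (s - i + l)"
          by (simp only: E_def mult.assoc funpow_add comp_def)
      qed
      finally show ?case .
    qed
    finally show ?case by simp
  qed
  also have "\<dots> = psdo_times F (psdo_times G H) u"
    unfolding R_def
    by (rule psdo_times_box[symmetric, where M = "M + P"])
      (use F G H psdo_times_0[of M G P H] in \<open>auto simp: K_def\<close>)
  finally show ?thesis .
qed


instantiation psdo :: (ring_1) ring_1
begin

lift_definition zero_psdo :: "'a psdo" is "\<lambda>_. 0" by simp

lift_definition one_psdo :: "'a psdo" is "\<lambda>r. if r = 0 then 1 else 0"
  by (rule exI[of _ 0]) simp

lift_definition plus_psdo :: "'a psdo \<Rightarrow> 'a psdo \<Rightarrow> 'a psdo" is "\<lambda>F G r. F r + G r"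
proof -
  fix F G :: "int \<Rightarrow> 'a fls"
  assume "\<exists>N. \<forall>r>N. F r = 0" "\<exists>N. \<forall>r>N. G r = 0"
  then obtain N M where "\<forall>r>N. F r = 0" "\<forall>r>M. G r = 0" by auto
  then show "\<exists>N. \<forall>r>N. F r + G r = 0" by (intro exI[of _ "max N M"]) auto
qed

lift_definition uminus_psdo :: "'a psdo \<Rightarrow> 'a psdo" is "\<lambda>F r. - F r" by simp

definition minus_psdo :: "'a psdo \<Rightarrow> 'a psdo \<Rightarrow> 'a psdo" where
  "minus_psdo F G = F + - G"

lift_definition times_psdo :: "'a psdo \<Rightarrow> 'a psdo \<Rightarrow> 'a psdo" is psdo_times
proof -
  fix F G :: "int \<Rightarrow> 'a fls"
  assume "\<exists>N. \<forall>r>N. F r = 0" "\<exists>N. \<forall>r>N. G r = 0"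
  then obtain N M where "\<forall>r>N. F r = 0" "\<forall>r>M. G r = 0" by auto
  then show "\<exists>N. \<forall>r>N. psdo_times F G r = 0"
    by (intro exI[of _ "N + M"]) (auto intro: psdo_times_0)
qed

instance
proof
  fix a b c :: "'a psdo"
  show "a + b + c = a + (b + c)" by transfer (simp add: add.assoc)
  show "a + b = b + a" by transfer (simp add: add.commute)
  show "0 + a = a" by transfer simp
  show "- a + a = 0" by transfer simp
  show "a - b = a + - b" by (rule minus_psdo_def)
  show "(0 :: 'a psdo) \<noteq> 1" by transfer (auto simp: fun_eq_iff)
  show "a * b * c = a * (b * c)"
  proof (transfer, goal_cases)
    case (1 F G H)
    then show ?case by (auto simp: fun_eq_iff intro!: psdo_times_assoc)
  qed
  show "1 * a = a"
  proof (transfer, goal_cases)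
    case (1 F)
    then obtain M where M: "\<forall>r>M. F r = 0" by auto
    show ?case
    proof
      fix u
      have *: "binom 0 s = (if s = 0 then 1 else 0)" for s
        by (cases s) (simp_all add: binom_def prod.lessThan_Suc_shift del: prod.lessThan_Suc)
      have "psdo_times (\<lambda>r. if r = 0 then 1 else 0) F u =
         (\<Sum>r=min 0 (u - M)..0. \<Sum>s\<le>nat (M - u). of_int (binom r s) * (if r = 0 then 1 else 0) * (v_deriv ^^ s) (F (u - r + int s)))"
        by (rule psdo_times_box) (use M in auto)
      also have "\<dots> = (\<Sum>r=min 0 (u - M)..0. if r = 0 then F u else 0)"
      proof (rule sum.cong[OF refl])
        fix r :: int
        have "(\<Sum>s\<le>nat (M - u). of_int (binom 0 s) * (v_deriv ^^ s) (F (u + int s))) =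
          (\<Sum>s\<le>nat (M - u). if s = 0 then F u else 0)"
          by (rule sum.cong) (auto simp: *)
        then show "(\<Sum>s\<le>nat (M - u). of_int (binom r s) * (if r = 0 then 1 else 0) * (v_deriv ^^ s) (F (u - r + int s))) = (if r = 0 then F u else 0)"
          by simp
      qed
      also have "\<dots> = F u" by simp
      finally show "psdo_times (\<lambda>r. if r = 0 then 1 else 0) F u = F u" .
    qed
  qed
  show "a * 1 = a"
  proof (transfer, goal_cases)
    case (1 F)
    then obtain N where N: "\<forall>r>N. F r = 0" by auto
    show ?case
    proof
      fix u
      have *: "(v_deriv ^^ s) (if u - r + int s = 0 then 1 else 0) = (if r = u \<and> s = 0 then 1 else 0 :: 'a fls)" for r s
        by (auto simp: v_deriv_pow_1)
      have "psdo_times F (\<lambda>r. if r = 0 then 1 else 0) u =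
         (\<Sum>r=u..N. \<Sum>s\<le>nat (N - u). of_int (binom r s) * F r * (v_deriv ^^ s) (if u - r + int s = 0 then 1 else 0))"
        by (rule psdo_times_box) (use N in auto)
      also have "\<dots> = (\<Sum>r=u..N. \<Sum>s\<le>nat (N - u). if s = 0 then if r = u then F u else 0 else 0)"
        unfolding * by (intro sum.cong refl) (auto simp: binom_def)
      also have "\<dots> = F u" using N by auto
      finally show "psdo_times F (\<lambda>r. if r = 0 then 1 else 0) u = F u" .
    qed
  qed
  show "a * (b + c) = a * b + a * c"
  proof (transfer, goal_cases)
    case (1 F G H)
    then obtain N M P where *: "\<forall>r>N. F r = 0" "\<forall>r>M. G r = 0" "\<forall>r>P. H r = 0" by auto
    show ?case
    proof
      fix u
      let ?Q = "max M P"
      have "psdo_times F (\<lambda>r. G r + H r) u = (\<Sum>r=u-?Q..N. \<Sum>s\<le>nat (N + ?Q - u). of_int (binom r s) * F r * (v_deriv ^^ s) (G (u - r + int s) + H (u - r + int s)))"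
        by (rule psdo_times_box[where M = ?Q]) (use * in auto)
      also have "\<dots> = (\<Sum>r=u-?Q..N. \<Sum>s\<le>nat (N + ?Q - u). of_int (binom r s) * F r * (v_deriv ^^ s) (G (u - r + int s)))
         + (\<Sum>r=u-?Q..N. \<Sum>s\<le>nat (N + ?Q - u). of_int (binom r s) * F r * (v_deriv ^^ s) (H (u - r + int s)))"
        by (simp add: v_deriv_pow_add distrib_left sum.distrib)
      also have "(\<Sum>r=u-?Q..N. \<Sum>s\<le>nat (N + ?Q - u). of_int (binom r s) * F r * (v_deriv ^^ s) (G (u - r + int s))) = psdo_times F G u"
        by (rule psdo_times_box[where M = ?Q, symmetric]) (use * in auto)
      also have "(\<Sum>r=u-?Q..N. \<Sum>s\<le>nat (N + ?Q - u). of_int (binom r s) * F r * (v_deriv ^^ s) (H (u - r + int s))) = psdo_times F H u"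
        by (rule psdo_times_box[where M = ?Q, symmetric]) (use * in auto)
      finally show "psdo_times F (\<lambda>r. G r + H r) u = psdo_times F G u + psdo_times F H u" .
    qed
  qed
  show "(a + b) * c = a * c + b * c"
  proof (transfer, goal_cases)
    case (1 F G H)
    then obtain N M P where *: "\<forall>r>N. F r = 0" "\<forall>r>M. G r = 0" "\<forall>r>P. H r = 0" by auto
    show ?case
    proof
      fix u
      let ?Q = "max N M"
      have "psdo_times (\<lambda>r. F r + G r) H u = (\<Sum>r=u-P..?Q. \<Sum>s\<le>nat (?Q + P - u). of_int (binom r s) * (F r + G r) * (v_deriv ^^ s) (H (u - r + int s)))"
        by (rule psdo_times_box[where N = ?Q and M = P]) (use * in auto)
      also have "\<dots> = (\<Sum>r=u-P..?Q. \<Sum>s\<le>nat (?Q + P - u). of_int (binom r s) * F r * (v_deriv ^^ s) (H (u - r + int s)))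
         + (\<Sum>r=u-P..?Q. \<Sum>s\<le>nat (?Q + P - u). of_int (binom r s) * G r * (v_deriv ^^ s) (H (u - r + int s)))"
        by (simp add: distrib_left distrib_right sum.distrib)
      also have "(\<Sum>r=u-P..?Q. \<Sum>s\<le>nat (?Q + P - u). of_int (binom r s) * F r * (v_deriv ^^ s) (H (u - r + int s))) = psdo_times F H u"
        by (rule psdo_times_box[where N = ?Q and M = P, symmetric]) (use * in auto)
      also have "(\<Sum>r=u-P..?Q. \<Sum>s\<le>nat (?Q + P - u). of_int (binom r s) * G r * (v_deriv ^^ s) (H (u - r + int s))) = psdo_times G H u"
        by (rule psdo_times_box[where N = ?Q and M = P, symmetric]) (use * in auto)
      finally show "psdo_times (\<lambda>r. F r + G r) H u = psdo_times F H u + psdo_times G H u" .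
    qed
  qed
qed

end

definition psdo_monom :: "'a::zero fls \<Rightarrow> int \<Rightarrow> 'a psdo" where
  "psdo_monom f t = Abs_psdo (\<lambda>r. if r = t then f else 0)"

lemma psdo_coeff_monom: "psdo_coeff (psdo_monom f t) = (\<lambda>r. if r = t then f else 0)"
  unfolding psdo_monom_def by (rule Abs_psdo_inverse) auto

(* The defining multiplication rule dv^r f = sum_s (binom r s) (d/dv)^s(f) dv^(r-s). *)
lemma psdo_coeff_monom_times:
  "psdo_coeff (psdo_monom 1 r * psdo_monom f 0) u =
     (if u \<le> r then of_int (binom r (nat (r - u))) * (v_deriv ^^ nat (r - u)) f else 0)"
proof -
  have "psdo_times (\<lambda>r'. if r' = r then 1 else 0) (\<lambda>t. if t = 0 then f else 0) u =
     (\<Sum>r'=min u r..r. \<Sum>s\<le>nat (r - u). of_int (binom r' s) * (if r' = r then 1 else 0) * (v_deriv ^^ s) (if u - r' + int s = 0 then f else 0))"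
    by (rule psdo_times_box[where M = 0]) auto
  also have "\<dots> = (\<Sum>r'=min u r..r. if r' = r then \<Sum>s\<le>nat (r - u). of_int (binom r s) * (v_deriv ^^ s) (if u - r + int s = 0 then f else 0) else 0)"
    by (intro sum.cong) auto
  also have "\<dots> = (\<Sum>s\<le>nat (r - u). of_int (binom r s) * (v_deriv ^^ s) (if u - r + int s = 0 then f else 0))"
    by simp
  also have "\<dots> = (\<Sum>s\<le>nat (r - u). if s = nat (r - u) then if u \<le> r then of_int (binom r s) * (v_deriv ^^ s) f else 0 else 0)"
    by (intro sum.cong) auto
  also have "\<dots> = (if u \<le> r then of_int (binom r (nat (r - u))) * (v_deriv ^^ nat (r - u)) f else 0)"
    by simp
  finally show ?thesis by (simp add: times_psdo.rep_eq psdo_coeff_monom)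
qed

definition psdo_of :: "'a::zero \<Rightarrow> 'a psdo" where
  "psdo_of a = psdo_monom (fls_const a) 0"

definition psdo_scal :: "complex \<Rightarrow> ('m::len0, 'n::len0, 'k::len0) weyl psdo" where
  "psdo_scal c = psdo_of (weyl_scal c)"

definition psdo_v :: "'a::{zero,one} psdo" where
  "psdo_v = psdo_monom fls_X_inv 0"

definition psdo_dv :: "'a::{zero,one} psdo" where
  "psdo_dv = psdo_monom 1 1"

section \<open>The Berezinian\<close>

(* Inverses are unique when they exist; nothing is assumed about the value otherwise. *)
definition two_sided_inv :: "'a::monoid_mult \<Rightarrow> 'a" where
  "two_sided_inv x = (THE y. x * y = 1 \<and> y * x = 1)"

definition int_pow :: "'a::monoid_mult \<Rightarrow> int \<Rightarrow> 'a" where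
  "int_pow x e = (if 0 \<le> e then x ^ nat e else two_sided_inv x ^ nat (- e))"

definition mat_inv :: "'a::ring_1 mat \<Rightarrow> 'a mat" where
  "mat_inv A = (THE B. B \<in> carrier_mat (dim_row A) (dim_row A) \<and> inverts_mat A B \<and> inverts_mat B A)"

definition top_left :: "nat \<Rightarrow> 'a mat \<Rightarrow> 'a mat" where
  "top_left i A = mat i i (\<lambda>(r, c). A $$ (r, c))"

(* The index i counts from 1, matrix entries count from 0. *)
definition quasi_minor :: "nat \<Rightarrow> 'a::ring_1 mat \<Rightarrow> 'a" where
  "quasi_minor i A = two_sided_inv (mat_inv (top_left i A) $$ (i - 1, i - 1))"

definition Ber :: "int list \<Rightarrow> 'a::ring_1 mat \<Rightarrow> 'a" where
  "Ber s A = (\<Prod>i\<leftarrow>[1..<Suc (dim_row A)]. int_pow (quasi_minor i A) (s ! (i - 1)))"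

definition s_hat :: "nat \<Rightarrow> nat \<Rightarrow> nat \<Rightarrow> int list" where
  "s_hat m n k = replicate (k + m) 1 @ replicate n (-1)"

definition B_hat :: "(nat \<Rightarrow> complex) \<Rightarrow> (nat \<Rightarrow> complex) \<Rightarrow> ('m::len0, 'n::len0, 'k::len0) weyl psdo mat" where
  "B_hat z \<Lambda> = (let m = LENGTH('m); n = LENGTH('n); k = LENGTH('k) in
     four_block_mat
       (mat k k (\<lambda>(a, b). if a = b then psdo_v - psdo_scal (z (Suc a)) else 0))
       (mat k (m + n) (\<lambda>(a, i). psdo_of (weyl_d (Suc i) (Suc a))))
       (mat (m + n) k (\<lambda>(i, a). (-1) ^ par m (Suc i) * psdo_of (weyl_x (Suc i) (Suc a))))
       (mat (m + n) (m + n) (\<lambda>(i, j). if i = j then psdo_dv - psdo_scal (\<Lambda> (Suc i)) else 0)))"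

section \<open>Combinatorial notation\<close>

definition fiber :: "nat \<Rightarrow> (nat \<Rightarrow> nat) \<Rightarrow> nat \<Rightarrow> nat set" where
  "fiber k j i = {a \<in> {1..k}. j a = i}"

(* Functions on {1..k} are extensional, so that each one is represented exactly once. *)
definition J_set :: "nat \<Rightarrow> nat \<Rightarrow> nat \<Rightarrow> nat set \<Rightarrow> (nat \<Rightarrow> nat) set" where
  "J_set m n k A = {j \<in> {1..k} \<rightarrow>\<^sub>E {0..m+n}.
     (\<forall>a\<in>{1..k}. j a = 0 \<longleftrightarrow> a \<notin> A) \<and> (\<forall>i\<in>{1..m}. card (fiber k j i) \<le> 1)}"

definition j_equiv :: "nat \<Rightarrow> nat \<Rightarrow> nat \<Rightarrow> (nat \<Rightarrow> nat) \<Rightarrow> (nat \<Rightarrow> nat) \<Rightarrow> bool" where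
  "j_equiv m n k j\<^sub>1 j\<^sub>2 \<longleftrightarrow> (\<forall>i\<in>{0..m+n}. card (fiber k j\<^sub>1 i) = card (fiber k j\<^sub>2 i))"

(* The s-th smallest element a_s of A, counting from s = 1. *)
definition elt :: "nat set \<Rightarrow> nat \<Rightarrow> nat" where
  "elt A s = sorted_list_of_set A ! (s - 1)"

(* The map a_s -> a_(sigma s) on A. *)
definition perm_act :: "nat set \<Rightarrow> (nat \<Rightarrow> nat) \<Rightarrow> nat \<Rightarrow> nat" where
  "perm_act A \<sigma> a = elt A (\<sigma> (inv_into {1..card A} (elt A) a))"

definition sigma :: "nat \<Rightarrow> nat \<Rightarrow> nat \<Rightarrow> nat set \<Rightarrow> (nat \<Rightarrow> nat) \<Rightarrow> (nat \<Rightarrow> nat) \<Rightarrow> nat \<Rightarrow> nat" where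
  "sigma m n k A j\<^sub>1 j\<^sub>2 = (THE \<sigma>. \<sigma> permutes {1..card A} \<and>
     (\<forall>i\<in>{1..m+n}. perm_act A \<sigma> ` fiber k j\<^sub>2 i = fiber k j\<^sub>1 i \<and>
        strict_mono_on (fiber k j\<^sub>2 i) (perm_act A \<sigma>)))"

definition sgn_j :: "nat \<Rightarrow> nat \<Rightarrow> nat \<Rightarrow> nat set \<Rightarrow> (nat \<Rightarrow> nat) \<Rightarrow> (nat \<Rightarrow> nat) \<Rightarrow> int" where
  "sgn_j m n k A j\<^sub>1 j\<^sub>2 = (let \<sigma> = sigma m n k A j\<^sub>1 j\<^sub>2 in
     (-1) ^ card {(s, s'). 1 \<le> s \<and> s < s' \<and> s' \<le> card A \<and> \<sigma> s < \<sigma> s' \<and>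
                    j\<^sub>2 (elt A s) > m \<and> j\<^sub>2 (elt A s') > m})"

definition c_coeff :: "nat \<Rightarrow> nat \<Rightarrow> nat \<Rightarrow> nat set \<Rightarrow> (nat \<Rightarrow> nat) \<Rightarrow> (nat \<Rightarrow> nat) \<Rightarrow> int" where
  "c_coeff m n k A j\<^sub>1 j\<^sub>2 = sgn_j m n k A j\<^sub>1 j\<^sub>2 * sign (sigma m n k A j\<^sub>1 j\<^sub>2) * (-1) ^ card A"

definition x_mono :: "nat set \<Rightarrow> (nat \<Rightarrow> nat) \<Rightarrow> ('m::len0, 'n::len0, 'k::len0) weyl" where
  "x_mono A j = (\<Prod>a\<leftarrow>sorted_list_of_set A. weyl_x (j a) a)"

definition d_mono :: "nat set \<Rightarrow> (nat \<Rightarrow> nat) \<Rightarrow> ('m::len0, 'n::len0, 'k::len0) weyl" where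
  "d_mono A j = (\<Prod>a\<leftarrow>sorted_list_of_set A. weyl_d (j a) a)"

end

theory Submission
  imports Defs
begin

text \<open>
  Expanding along the \<open>k \<times> k\<close> block shows that the right-hand side is, up to the factor
  \<open>\<beta> = (\<partial>\<^sub>v - \<Lambda>\<^sub>1) \<cdots> (\<partial>\<^sub>v - \<Lambda>\<^sub>m) / (\<partial>\<^sub>v - \<Lambda>\<^bsub>m+1\<^esub>) \<cdots> (\<partial>\<^sub>v - \<Lambda>\<^bsub>m+n\<^esub>)\<close> on the right, the normally ordered
  determinant of the matrix with entries
  \<open>(v - z\<^sub>a) \<delta>\<^bsub>ab\<^esub> - \<Sum>\<^sub>i x\<^bsub>i,b\<^esub> \<partial>\<^bsub>i,a\<^esub> (\<partial>\<^sub>v - \<Lambda>\<^sub>i)\<^sup>-\<^sup>1\<close>, where \<open>i\<close> runs through \<open>{1..m+n}\<close>: permutations that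
  differ inside a fiber of \<open>j\<close> contribute equally for odd indices, which gives the factorials, and
  cancel for even ones. Let \<open>F\<^sub>i\<close> be the same expression for the indices \<open>1, \<dots>, i\<close> only. Then
  \<open>F\<^sub>0 = \<Prod>(v - z\<^sub>a)\<close> is the product of the first \<open>k\<close> quasi-minors \<open>d\<^sub>1, \<dots>, d\<^sub>k\<close>, and it remains to see that
  \<open>F\<^bsub>i-1\<^esub> d\<^bsub>k+i\<^esub> = F\<^sub>i\<close> for even \<open>i\<close> and \<open>F\<^sub>i d\<^bsub>k+i\<^esub> = F\<^bsub>i-1\<^esub>\<close> for odd \<open>i\<close>. This follows from an explicit row
  vector \<open>y\<close> of normally ordered cofactors that the top-left block of size \<open>k + i\<close> maps to a multiple of the
  last unit vector.
\<close>

section \<open>The Weyl superalgebra\<close>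

text \<open>The entries of the matrix do not commute, so a cofactor row is annihilated by the
  columns only up to corrections. Moving v - z_b to the left past resolvents differentiates them,
  and moving x_{j,b} to the left contracts it with \<partial>_{j,b}. The factor \<beta> absorbs part
  of this: its logarithmic derivative is the sum of the resolvents (\<partial>_v - \<Lambda>_j)^(-1)
  with signs (-1)^(par j), and these match the contractions inside one position. Contractions
  between two positions cancel derivatives of the other resolvents.

  A Leibniz term in which i occurs r times can be opened at r places, so r enters the equations. For
  odd i all r occur, and the weight 1/r undoes the overcount; for even i the terms with r >= 2 add
  up to 0, and weights at r = 0, 1 suffice.

  The row gives y_last d_{k+i} = c, where c is the last entry of the product. The pair (y_last, c)
  is (F_{i-1}, F_i) for even i and (F_i, F_{i-1}) for odd i, so the exponent -1 in the Berezinian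
  only exchanges the two; no F_i is ever inverted. The quasi-minors themselves are invertible
  because off-diagonal entries have order at most 0 in \<partial>_v.\<close>

lemma par_cases: "par m i = 0 \<or> par m i = 1"
  by (simp add: par_def)

lemma weyl_scal_0: "weyl_scal 0 = 0"
  by transfer (rule weyl_eq_refl)

lemma weyl_scal_1: "weyl_scal 1 = 1"
  by transfer (rule weyl_eq_refl)

lemma weyl_scal_add: "weyl_scal (a + b) = weyl_scal a + weyl_scal b"
  by transfer (blast intro: weyl_eq.intros)

lemma weyl_scal_mult: "weyl_scal (a * b) = weyl_scal a * weyl_scal b"
  by transfer (blast intro: weyl_eq.intros)

lemma weyl_scal_commute: "weyl_scal a * x = x * weyl_scal a"
  by transfer (blast intro: weyl_eq.intros)

lemma weyl_scal_m1: "weyl_scal (-1) = -1"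
proof -
  have "weyl_scal (-1) + weyl_scal 1 = 0"
    by (simp flip: weyl_scal_add add: weyl_scal_0)
  then show ?thesis by (simp add: weyl_scal_1 eq_neg_iff_add_eq_0)
qed

lemma weyl_scal_uminus: "weyl_scal (- a) = - weyl_scal a"
  using weyl_scal_mult[of "-1" a] by (simp add: weyl_scal_m1)

lemma weyl_scal_sign: "weyl_scal ((-1) ^ e) = (-1) ^ e"
  by (induction e) (simp_all add: weyl_scal_1 weyl_scal_uminus)

lemma weyl_x_outside:
  "\<not> (i \<in> {1..LENGTH('m) + LENGTH('n)} \<and> a \<in> {1..LENGTH('k)}) \<Longrightarrow>
    (weyl_x i a :: ('m::len0, 'n::len0, 'k::len0) weyl) = 0"
  by transfer (rule weyl_eq_x_outside)

lemma weyl_d_outside: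
  "\<not> (i \<in> {1..LENGTH('m) + LENGTH('n)} \<and> a \<in> {1..LENGTH('k)}) \<Longrightarrow>
    (weyl_d i a :: ('m::len0, 'n::len0, 'k::len0) weyl) = 0"
  by transfer (rule weyl_eq_d_outside)

text \<open>Valid for all indices: a generator outside the index range is 0, and then both sides
  vanish.\<close>

lemma weyl_x_x:
  "weyl_x i a * weyl_x j b =
    (-1) ^ (par LENGTH('m) i * par LENGTH('m) j) * (weyl_x j b * weyl_x i a :: ('m::len0, 'n::len0, 'k::len0) weyl)"
proof (cases "i \<in> {1..LENGTH('m) + LENGTH('n)} \<and> a \<in> {1..LENGTH('k)} \<and>
    j \<in> {1..LENGTH('m) + LENGTH('n)} \<and> b \<in> {1..LENGTH('k)}")
  case True
  then have "weyl_x i a * weyl_x j b + weyl_scal (- ((-1) ^ (par LENGTH('m) i * par LENGTH('m) j))) *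
     (weyl_x j b * weyl_x i a) = (weyl_scal 0 :: ('m, 'n, 'k) weyl)"
    by transfer (use weyl_eq_x_x in \<open>auto simp: supercomm_def\<close>)
  then show ?thesis by (simp add: weyl_scal_uminus weyl_scal_sign weyl_scal_0)
next
  case False
  then have "(weyl_x i a :: ('m, 'n, 'k) weyl) = 0 \<or> (weyl_x j b :: ('m, 'n, 'k) weyl) = 0"
    using weyl_x_outside by blast
  then show ?thesis by auto
qed

lemma weyl_d_d:
  "weyl_d i a * weyl_d j b =
    (-1) ^ (par LENGTH('m) i * par LENGTH('m) j) * (weyl_d j b * weyl_d i a :: ('m::len0, 'n::len0, 'k::len0) weyl)"
proof (cases "i \<in> {1..LENGTH('m) + LENGTH('n)} \<and> a \<in> {1..LENGTH('k)} \<and>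
    j \<in> {1..LENGTH('m) + LENGTH('n)} \<and> b \<in> {1..LENGTH('k)}")
  case True
  then have "weyl_d i a * weyl_d j b + weyl_scal (- ((-1) ^ (par LENGTH('m) i * par LENGTH('m) j))) *
     (weyl_d j b * weyl_d i a) = (weyl_scal 0 :: ('m, 'n, 'k) weyl)"
    by transfer (use weyl_eq_d_d in \<open>auto simp: supercomm_def\<close>)
  then show ?thesis by (simp add: weyl_scal_uminus weyl_scal_sign weyl_scal_0)
next
  case False
  then have "(weyl_d i a :: ('m, 'n, 'k) weyl) = 0 \<or> (weyl_d j b :: ('m, 'n, 'k) weyl) = 0"
    using weyl_d_outside by blast
  then show ?thesis by auto
qed

text \<open>With \<open>i\<close> and \<open>b\<close> in range, \<open>i = j \<and> a = b\<close>
  would put \<open>j\<close> and \<open>a\<close> in range too. So when a generator is killed, the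
  inhomogeneous term is 0 as well.\<close>

lemma weyl_d_x:
  assumes "i \<in> {1..LENGTH('m) + LENGTH('n)}" "b \<in> {1..LENGTH('k)}"
  shows "weyl_d i a * weyl_x j b =
    (-1) ^ (par LENGTH('m) i * par LENGTH('m) j) * (weyl_x j b * weyl_d i a) +
    (if i = j \<and> a = b then 1 else 0 :: ('m::len0, 'n::len0, 'k::len0) weyl)"
proof (cases "a \<in> {1..LENGTH('k)} \<and> j \<in> {1..LENGTH('m) + LENGTH('n)}")
  case True
  with assms have "weyl_d i a * weyl_x j b + weyl_scal (- ((-1) ^ (par LENGTH('m) i * par LENGTH('m) j))) *
     (weyl_x j b * weyl_d i a) = (weyl_scal (if i = j \<and> a = b then 1 else 0) :: ('m, 'n, 'k) weyl)"
    by transfer (use weyl_eq_d_x in \<open>auto simp: supercomm_def\<close>)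
  then show ?thesis by (auto simp: weyl_scal_uminus weyl_scal_sign weyl_scal_0 weyl_scal_1 algebra_simps)
next
  case False
  then show ?thesis using weyl_d_outside[of i a, where 'm='m and 'n='n and 'k='k]
      weyl_x_outside[of j b, where 'm='m and 'n='n and 'k='k] assms by auto
qed

text \<open>
  \<open>nord A \<sigma> f\<close> is the normally ordered product of the even elements
  \<open>x\<^bsub>f p, \<sigma> p\<^esub> \<partial>\<^bsub>f p, p\<^esub>\<close> over the \<open>p \<in> A\<close> with \<open>f p \<noteq> 0\<close>. Wrapping \<open>x\<close> and \<open>\<partial>\<close> around
  what is already there produces no sign, and these wrappings commute with each other.
\<close>

definition nord :: "nat set \<Rightarrow> (nat \<Rightarrow> nat) \<Rightarrow> (nat \<Rightarrow> nat) \<Rightarrow> ('m::len0, 'n::len0, 'k::len0) weyl" where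
  "nord A \<sigma> f = Finite_Set.fold (\<lambda>p Y. if f p = 0 then Y else weyl_x (f p) (\<sigma> p) * Y * weyl_d (f p) p) 1 A"

text \<open>Exchanging the two x produces the same sign as exchanging the two derivatives, and the
  signs multiply to 1.\<close>

lemma sandwich_commute:
  fixes Y :: "('m::len0, 'n::len0, 'k::len0) weyl"
  shows "weyl_x i a * (weyl_x j b * Y * weyl_d j q) * weyl_d i p =
    weyl_x j b * (weyl_x i a * Y * weyl_d i p) * weyl_d j q"
proof -
  have "weyl_x i a * (weyl_x j b * Y * weyl_d j q) * weyl_d i p =
    (weyl_x i a * weyl_x j b) * Y * (weyl_d j q * weyl_d i p)"
    by (simp add: mult.assoc)
  also have "\<dots> = (weyl_x j b * weyl_x i a) * Y * (weyl_d i p * weyl_d j q)"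
    unfolding weyl_x_x[of i a] weyl_d_d[of j q]
    using par_cases[of "LENGTH('m)" i] par_cases[of "LENGTH('m)" j] by auto
  finally show ?thesis by (simp add: mult.assoc)
qed

text \<open>Makes the fold in \<open>nord\<close> independent of the order of the positions, so that
  any chosen position can be pulled out as the outermost wrapping.\<close>

interpretation nord: comp_fun_commute
  "\<lambda>p Y. if f p = 0 then Y else weyl_x (f p) (\<sigma> p) * (Y :: ('m::len0, 'n::len0, 'k::len0) weyl) * weyl_d (f p) p"
  by unfold_locales (auto simp: fun_eq_iff sandwich_commute)

lemma nord_empty [simp]: "nord {} \<sigma> f = 1"
  by (simp add: nord_def)

lemma nord_insert: "finite A \<Longrightarrow> c \<notin> A \<Longrightarrow>
  nord (insert c A) \<sigma> f = (if f c = 0 then nord A \<sigma> f else weyl_x (f c) (\<sigma> c) * nord A \<sigma> f * weyl_d (f c) c)"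
  by (simp add: nord_def)

lemma nord_remove: "finite A \<Longrightarrow> c \<in> A \<Longrightarrow> nord A \<sigma> f =
  (if f c = 0 then nord (A - {c}) \<sigma> f else weyl_x (f c) (\<sigma> c) * nord (A - {c}) \<sigma> f * weyl_d (f c) c)"
  using nord_insert[of "A - {c}" c \<sigma> f] by (simp add: insert_absorb)

lemma nord_cong:
  assumes "finite A" "\<And>p. p \<in> A \<Longrightarrow> f p = f' p" "\<And>p. p \<in> A \<Longrightarrow> f p \<noteq> 0 \<Longrightarrow> \<sigma> p = \<sigma>' p"
  shows "nord A \<sigma> f = nord A \<sigma>' f'"
  using assms by (induction A) (auto simp: nord_insert)

text \<open>With \<open>p\<close> and \<open>p'\<close> pulled out as the two outermost wrappings,
  the transposition exchanges two neighbouring x of the same index \<open>j\<close>.\<close>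

lemma nord_swap:
  assumes "finite A" "p \<in> A" "p' \<in> A" "p \<noteq> p'" "f p = j" "f p' = j" "j \<noteq> 0"
  shows "nord A (\<sigma> \<circ> transpose p p') f = (-1) ^ par LENGTH('m) j * (nord A \<sigma> f :: ('m::len0, 'n::len0, 'k::len0) weyl)"
proof -
  have N: "nord A \<tau> f = weyl_x j (\<tau> p) * weyl_x j (\<tau> p') * nord (A - {p} - {p'}) \<tau> f * weyl_d j p' * weyl_d j p" for \<tau>
    using assms by (simp add: nord_remove[of A p] nord_remove[of "A - {p}" p'] mult.assoc)
  have "nord (A - {p} - {p'}) (\<sigma> \<circ> transpose p p') f = (nord (A - {p} - {p'}) \<sigma> f :: ('m, 'n, 'k) weyl)"
    by (rule nord_cong) (use assms in \<open>auto simp: transpose_def\<close>)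
  then show ?thesis
    unfolding N by (simp add: weyl_x_x[of j "\<sigma> p'" j "\<sigma> p"])
      (use par_cases[of "LENGTH('m)" j] in \<open>auto simp: mult.assoc\<close>)
qed

text \<open>A Wick contraction. Every wrapped pair is even, so x_{j,b} passes it without a sign; the
  only derivative it does not supercommute with is \<partial>_{j,b}, which can sit at position
  \<open>b\<close> only.\<close>

lemma nord_mult_x:
  assumes "finite A" "b \<in> {1..LENGTH('k)}" "\<And>p. p \<in> A \<Longrightarrow> f p \<le> LENGTH('m) + LENGTH('n)" "j \<noteq> 0"
  shows "nord A \<sigma> f * weyl_x j b = weyl_x j b * nord A \<sigma> f +
    (if b \<in> A \<and> f b = j then weyl_x j (\<sigma> b) * nord (A - {b}) \<sigma> f else 0 :: ('m::len0, 'n::len0, 'k::len0) weyl)"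
  using assms(1,3)
proof (induction A)
  case (insert c A)
  define i where "i = f c"
  define X where "X = (weyl_x i (\<sigma> c) :: ('m, 'n, 'k) weyl)"
  define x where "x = (weyl_x j b :: ('m, 'n, 'k) weyl)"
  define D where "D = (weyl_d i c :: ('m, 'n, 'k) weyl)"
  define Y where "Y = (nord A \<sigma> f :: ('m, 'n, 'k) weyl)"
  define Z where "Z = (if b \<in> A \<and> f b = j then weyl_x j (\<sigma> b) * nord (A - {b}) \<sigma> f else 0 :: ('m, 'n, 'k) weyl)"
  have IH: "Y * x = x * Y + Z" unfolding Y_def x_def Z_def using insert by simp
  show ?case
  proof (cases "i = 0")
    case True
    then have "insert c A - {b} = insert c (A - {b})" if "f b = j" using that assms(4) by (auto simp: i_def)
    then have "nord (insert c A - {b}) \<sigma> f = (nord (A - {b}) \<sigma> f :: ('m, 'n, 'k) weyl)" if "f b = j"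
      using that True insert.hyps by (simp add: nord_insert i_def)
    moreover have "c \<noteq> b" if "f b = j" using that True assms(4) by (auto simp: i_def)
    ultimately show ?thesis using insert True IH by (auto simp: nord_insert i_def Y_def x_def Z_def)
  next
    case False
    let ?s = "(-1) ^ (par LENGTH('m) i * par LENGTH('m) j) :: ('m, 'n, 'k) weyl"
    let ?e = "if i = j \<and> c = b then 1 else 0 :: ('m, 'n, 'k) weyl"
    have Dx: "D * x = ?s * (x * D) + ?e"
      unfolding D_def x_def by (rule weyl_d_x) (use insert.prems False assms(2) in \<open>auto simp: i_def\<close>)
    \<comment> \<open>The sign \<open>?s\<close> from passing \<open>D\<close> comes up again when
      \<open>x\<close> passes the \<open>X\<close> of the same position. The contraction term
      \<open>Z\<close> also starts with an x of index \<open>j\<close>, so \<open>sZ\<close> works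
      alike.\<close>
    have s2: "X * (x * W) = ?s * (x * (X * W))" for W
      unfolding X_def x_def mult.assoc[symmetric] weyl_x_x[of i "\<sigma> c" j b] by (simp add: mult.assoc)
    have sZ: "?s * (X * Z) * D = (if b \<in> A \<and> f b = j then weyl_x j (\<sigma> b) * (X * nord (A - {b}) \<sigma> f * D) else 0)"
      unfolding Z_def X_def using weyl_x_x[of i "\<sigma> c" j "\<sigma> b", where 'm='m and 'n='n and 'k='k]
        par_cases[of "LENGTH('m)" i] par_cases[of "LENGTH('m)" j] by (auto simp flip: mult.assoc)
    have "nord (insert c A) \<sigma> f * weyl_x j b = X * Y * (D * x)"
      using insert.hyps False by (simp add: nord_insert X_def Y_def D_def i_def x_def mult.assoc)
    also have "\<dots> = ?s * (X * (Y * x)) * D + X * Y * ?e"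
      unfolding Dx using par_cases[of "LENGTH('m)" i] par_cases[of "LENGTH('m)" j]
      by (auto simp: algebra_simps)
    also have "\<dots> = x * X * Y * D + ?s * (X * Z) * D + X * Y * ?e"
      unfolding IH distrib_left s2 distrib_right
      using par_cases[of "LENGTH('m)" i] par_cases[of "LENGTH('m)" j]
      by (auto simp: algebra_simps)
    also have "\<dots> = x * (X * Y * D) + (if b \<in> insert c A \<and> f b = j then weyl_x j (\<sigma> b) * nord (insert c A - {b}) \<sigma> f else 0)"
    proof (cases "c = b")
      case True
      then have "b \<notin> A" "insert c A - {b} = A" using insert.hyps by auto
      then show ?thesis unfolding sZ using True by (auto simp: X_def Y_def i_def mult.assoc)
    next
      case cb: False
      then have *: "insert c A - {b} = insert c (A - {b})" by auto
      show ?thesis unfolding sZ * using cb insert.hyps False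
        by (auto simp: nord_insert mult.assoc X_def D_def i_def)
    qed
    also have "X * Y * D = nord (insert c A) \<sigma> f"
      using insert.hyps False by (simp add: nord_insert X_def Y_def D_def i_def mult.assoc)
    finally show ?thesis by (simp add: x_def)
  qed
qed simp

section \<open>Constant-coefficient series in v and in the derivation\<close>

lemma two_sided_inv_eq:
  assumes "x * y = 1" "y * x = 1"
  shows "two_sided_inv x = y"
  unfolding two_sided_inv_def
proof (rule the_equality)
  fix z assume "x * z = 1 \<and> z * x = 1"
  then have "z = z * (x * y)" "z * x = 1" using assms by auto
  then show "z = y" by (metis mult.assoc mult_1)
qed (use assms in auto)

text \<open>A common summation range allows products over the complex numbers and over the Weyl
  algebra to be compared term by term, without relating subdegrees.\<close>

lemma fls_times_nth_box:
  fixes f g :: "'a::semiring_0 fls"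
  assumes "A \<le> fls_subdegree f" "n - fls_subdegree g \<le> B"
  shows "fls_nth (f * g) n = (\<Sum>i=A..B. fls_nth f i * fls_nth g (n - i))"
  unfolding fls_times_nth(2)
proof (rule sum.mono_neutral_left)
  show "\<forall>i\<in>{A..B} - {fls_subdegree f..n - fls_subdegree g}. fls_nth f i * fls_nth g (n - i) = 0"
  proof
    fix i assume "i \<in> {A..B} - {fls_subdegree f..n - fls_subdegree g}"
    then have "i < fls_subdegree f \<or> n - i < fls_subdegree g" by auto
    then show "fls_nth f i * fls_nth g (n - i) = 0" by (auto simp: fls_eq0_below_subdegree)
  qed
qed (use assms in auto)

section \<open>Coefficients of operators, and products with functions of \<open>v\<close>\<close>

lemma psdo_eqI: "(\<And>u. psdo_coeff F u = psdo_coeff G u) \<Longrightarrow> F = G"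
  by (metis psdo_coeff_inject ext)

lemma psdo_coeff_0 [simp]: "psdo_coeff 0 u = 0"
  by transfer simp

lemma psdo_coeff_1: "psdo_coeff 1 u = (if u = 0 then 1 else 0)"
  by transfer simp

lemma psdo_coeff_add: "psdo_coeff (F + G) u = psdo_coeff F u + psdo_coeff G u"
  by transfer simp

lemma psdo_coeff_uminus: "psdo_coeff (- F :: 'a::ring_1 psdo) u = - psdo_coeff F u"
  by transfer simp

lemma psdo_coeff_diff: "psdo_coeff (F - G :: 'a::ring_1 psdo) u = psdo_coeff F u - psdo_coeff G u"
  by (simp only: minus_psdo_def psdo_coeff_add psdo_coeff_uminus) simp

lemma psdo_coeff_bound:
  obtains N where "\<And>r. r > N \<Longrightarrow> psdo_coeff F r = 0"
  using psdo_coeff[of F] by auto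

lemma psdo_coeff_monom_0_times: "psdo_coeff (psdo_monom a 0 * F) u = a * psdo_coeff F u"
proof -
  obtain M where M: "\<And>r. r > M \<Longrightarrow> psdo_coeff F r = 0" using psdo_coeff_bound[of F] by blast
  have b0: "binom 0 s = (if s = 0 then 1 else 0)" for s
    by (cases s) (simp_all add: binom_def prod.lessThan_Suc_shift del: prod.lessThan_Suc)
  have "psdo_coeff (psdo_monom a 0 * F) u = (\<Sum>r=min 0 (u - M)..0. \<Sum>s\<le>nat (M - u).
      of_int (binom r s) * (if r = 0 then a else 0) * (v_deriv ^^ s) (psdo_coeff F (u - r + int s)))"
    unfolding times_psdo.rep_eq psdo_coeff_monom
    by (rule psdo_times_box[where M = M]) (use M in auto)
  also have "\<dots> = (\<Sum>r=min 0 (u - M)..0. if r = 0 then a * psdo_coeff F u else 0)"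
  proof (rule sum.cong[OF refl])
    fix r :: int
    have "(\<Sum>s\<le>nat (M - u). of_int (binom 0 s) * a * (v_deriv ^^ s) (psdo_coeff F (u + int s))) =
      (\<Sum>s\<le>nat (M - u). if s = 0 then a * psdo_coeff F u else 0)"
      by (rule sum.cong) (auto simp: b0)
    then show "(\<Sum>s\<le>nat (M - u). of_int (binom r s) * (if r = 0 then a else 0) *
        (v_deriv ^^ s) (psdo_coeff F (u - r + int s))) = (if r = 0 then a * psdo_coeff F u else 0)"
      by simp
  qed
  also have "\<dots> = a * psdo_coeff F u" by simp
  finally show ?thesis .
qed

lemma psdo_monom_0_mult: "psdo_monom a 0 * psdo_monom b 0 = psdo_monom (a * b) 0"
  by (rule psdo_eqI) (simp add: psdo_coeff_monom_0_times psdo_coeff_monom)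

lemma psdo_monom_add: "psdo_monom (a + b) t = psdo_monom a t + psdo_monom b t"
  by (rule psdo_eqI) (simp add: psdo_coeff_add psdo_coeff_monom)

lemma psdo_monom_1_0: "psdo_monom 1 0 = 1"
  by (rule psdo_eqI) (simp add: psdo_coeff_1 psdo_coeff_monom)

lemma v_deriv_const [simp]: "v_deriv (fls_const c) = 0"
  by (simp add: v_deriv_def)

lemma v_deriv_pow_const: "(v_deriv ^^ s) (fls_const c) = (if s = 0 then fls_const c else 0)"
  by (cases s) (auto simp: funpow_swap1)

lemma v_deriv_pow_v: "(v_deriv ^^ s) fls_X_inv = (if s = 0 then fls_X_inv else if s = 1 then 1 else 0)"
proof (cases s)
  case (Suc t)
  then show ?thesis by (auto simp: funpow_swap1 v_deriv_v v_deriv_pow_1 split: if_splits)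
qed simp

lemma psdo_coeff_times_const:
  assumes "\<And>s. s > 0 \<Longrightarrow> (v_deriv ^^ s) b = 0"
  shows "psdo_coeff (F * psdo_monom b 0) u = psdo_coeff F u * b"
proof -
  obtain N where N: "\<And>r. r > N \<Longrightarrow> psdo_coeff F r = 0" using psdo_coeff_bound[of F] by blast
  have *: "of_int (binom r s) * psdo_coeff F r * (v_deriv ^^ s) (if u - r + int s = 0 then b else 0) =
    (if s = 0 then if r = u then psdo_coeff F u * b else 0 else 0)" for r s
    using assms[of s] by (auto simp: binom_def)
  have "psdo_coeff (F * psdo_monom b 0) u = (\<Sum>r=u..N. \<Sum>s\<le>nat (N - u).
      of_int (binom r s) * psdo_coeff F r * (v_deriv ^^ s) (if u - r + int s = 0 then b else 0))"
    unfolding times_psdo.rep_eq psdo_coeff_monom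
    by (rule psdo_times_box[where M = 0]) (use N in auto)
  also have "\<dots> = psdo_coeff F u * b" unfolding * using N by auto
  finally show ?thesis .
qed

text \<open>From \<partial>_v^r v = v \<partial>_v^r + r \<partial>_v^(r-1): the coefficient of
  \<partial>_v^u collects r = u and r = u + 1.\<close>

lemma psdo_coeff_times_v:
  "psdo_coeff (F * psdo_v) u = psdo_coeff F u * fls_X_inv + of_int (u + 1) * psdo_coeff F (u + 1)"
proof -
  obtain N where N: "\<And>r. r > N \<Longrightarrow> psdo_coeff F r = 0" using psdo_coeff_bound[of F] by blast
  have *: "of_int (binom r s) * psdo_coeff F r * (v_deriv ^^ s) (if u - r + int s = 0 then fls_X_inv else 0) =
    (if s = 0 then if r = u then psdo_coeff F u * fls_X_inv else 0 else 0) +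
    (if s = 1 then if r = u + 1 then of_int (u + 1) * psdo_coeff F (u + 1) else 0 else 0)" for r s
    by (auto simp: binom_def v_deriv_pow_v v_deriv_v)
  \<comment> \<open>The upper end \<open>max N (u + 1)\<close> keeps the index \<open>u + 1\<close>
    in the range even where it exceeds the order bound of \<open>F\<close> and its term is
    0.\<close>
  have "psdo_coeff (F * psdo_v) u = (\<Sum>r=u..max N (u + 1). \<Sum>s\<le>nat (max N (u + 1) - u).
      of_int (binom r s) * psdo_coeff F r * (v_deriv ^^ s) (if u - r + int s = 0 then fls_X_inv else 0))"
    unfolding times_psdo.rep_eq psdo_coeff_monom psdo_v_def
    by (rule psdo_times_box[where M = 0]) (use N in auto)
  also have "\<dots> = psdo_coeff F u * fls_X_inv + of_int (u + 1) * psdo_coeff F (u + 1)"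
  proof -
    have "Suc 0 \<le> nat (max N (u + 1) - u)" "u \<le> max N (u + 1)" by linarith+
    then show ?thesis unfolding * by (simp add: sum.distrib)
  qed
  finally show ?thesis .
qed

lemma psdo_of_add: "psdo_of (a + b) = psdo_of a + psdo_of b"
  by (simp add: psdo_of_def psdo_monom_add flip: fls_plus_const)

lemma psdo_of_mult: "psdo_of (a * b) = psdo_of a * psdo_of b"
  by (simp add: psdo_of_def psdo_monom_0_mult)

lemma psdo_of_0 [simp]: "psdo_of 0 = 0"
  by (rule psdo_eqI) (simp add: psdo_of_def psdo_coeff_monom)

lemma psdo_of_1 [simp]: "psdo_of 1 = 1"
  by (simp add: psdo_of_def psdo_monom_1_0)

lemma psdo_of_uminus: "psdo_of (- a) = - psdo_of (a :: 'a::ring_1)"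
  using psdo_of_add[of a "- a"] by (simp add: eq_neg_iff_add_eq_0 add.commute)

lemma psdo_of_sign: "psdo_of ((-1) ^ e) = (-1) ^ e"
  by (induction e) (simp_all add: psdo_of_uminus)

text \<open>A nonzero scalar is a unit, and 0 and 1 differ in the Weyl algebra.\<close>

lemma weyl_scal_eq_0_iff [simp]: "weyl_scal c = (0 :: ('a::len0, 'b::len0, 'c::len0) weyl) \<longleftrightarrow> c = 0"
proof
  assume *: "weyl_scal c = (0 :: ('a, 'b, 'c) weyl)"
  show "c = 0"
  proof (rule ccontr)
    assume "c \<noteq> 0"
    then have "weyl_scal c * weyl_scal (1 / c) = (1 :: ('a, 'b, 'c) weyl)"
      by (simp flip: weyl_scal_mult add: weyl_scal_1)
    then show False by (simp add: *)
  qed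
qed (simp add: weyl_scal_0)

lemma weyl_scal_sum: "weyl_scal (\<Sum>x\<in>A. f x) = (\<Sum>x\<in>A. weyl_scal (f x))"
  by (induction A rule: infinite_finite_induct) (auto simp: weyl_scal_add)

lemma weyl_scal_of_int: "weyl_scal (of_int c) = (of_int c :: ('a::len0, 'b::len0, 'c::len0) weyl)"
proof (induction c rule: int_induct[where k = 0])
  case (step2 i)
  have "weyl_scal (of_int (i - 1)) + 1 = (weyl_scal (of_int (i - 1) + 1) :: ('a, 'b, 'c) weyl)"
    by (simp only: weyl_scal_add weyl_scal_1)
  then show ?case using step2 by (simp add: eq_diff_eq)
qed (simp_all add: weyl_scal_0 weyl_scal_1 weyl_scal_add)

section \<open>Complex Laurent series as operators in \<open>v\<close> and in the derivation\<close>

definition fls_scal :: "complex fls \<Rightarrow> ('m::len0, 'n::len0, 'k::len0) weyl fls" where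
  "fls_scal f = Abs_fls (\<lambda>n. weyl_scal (fls_nth f n))"

lemma fls_scal_nth [simp]: "fls_nth (fls_scal f) n = weyl_scal (fls_nth f n)"
  unfolding fls_scal_def
  by (rule nth_Abs_fls_lower_bound[of "fls_subdegree f"]) (simp add: fls_eq0_below_subdegree)

lemma fls_scal_mult: "(fls_scal (f * g) :: ('m::len0, 'n::len0, 'k::len0) weyl fls) = fls_scal f * fls_scal g"
proof (rule fls_eqI)
  fix n
  define A where "A = min (fls_subdegree f) (fls_subdegree (fls_scal f :: ('m, 'n, 'k) weyl fls))"
  define B where "B = max (n - fls_subdegree g) (n - fls_subdegree (fls_scal g :: ('m, 'n, 'k) weyl fls))"
  have "fls_nth (f * g) n = (\<Sum>i=A..B. fls_nth f i * fls_nth g (n - i))"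
    by (rule fls_times_nth_box) (auto simp: A_def B_def)
  moreover have "fls_nth (fls_scal f * fls_scal g :: ('m, 'n, 'k) weyl fls) n =
      (\<Sum>i=A..B. fls_nth (fls_scal f) i * fls_nth (fls_scal g) (n - i))"
    by (rule fls_times_nth_box) (auto simp: A_def B_def)
  ultimately show "fls_nth (fls_scal (f * g)) n = fls_nth (fls_scal f * fls_scal g :: ('m, 'n, 'k) weyl fls) n"
    by (simp add: weyl_scal_sum weyl_scal_mult)
qed

lemma fls_scal_add: "fls_scal (f + g) = fls_scal f + fls_scal g"
  by (rule fls_eqI) (simp add: weyl_scal_add)

lemma fls_scal_const: "fls_scal (fls_const c) = fls_const (weyl_scal c)"
  by (rule fls_eqI) (simp add: weyl_scal_0)

lemma fls_scal_1: "fls_scal 1 = 1"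
  by (rule fls_eqI) (simp add: weyl_scal_0 weyl_scal_1)

definition v_series :: "complex fls \<Rightarrow> ('m::len0, 'n::len0, 'k::len0) weyl psdo" where
  "v_series f = psdo_monom (fls_scal f) 0"

lemma v_series_mult: "v_series (f * g) = v_series f * v_series g"
  by (simp add: v_series_def fls_scal_mult psdo_monom_0_mult)

lemma v_series_add: "v_series (f + g) = v_series f + v_series g"
  by (simp add: v_series_def fls_scal_add psdo_monom_add)

lemma v_series_const: "v_series (fls_const c) = psdo_scal c"
  by (simp add: v_series_def fls_scal_const psdo_scal_def psdo_of_def)

lemma v_series_1 [simp]: "v_series 1 = 1"
  by (simp add: v_series_def fls_scal_1 psdo_monom_1_0)

lemma v_series_uminus: "v_series (- f) = - v_series f"
proof -
  have "- f = fls_const (-1) * f" by (rule fls_eqI) simp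
  then show ?thesis
    by (simp only: v_series_mult v_series_const psdo_scal_def weyl_scal_m1 psdo_of_uminus psdo_of_1) simp
qed

lemma v_series_v: "v_series fls_X_inv = (psdo_v :: ('m::len0, 'n::len0, 'k::len0) weyl psdo)"
proof -
  have "fls_scal fls_X_inv = (fls_X_inv :: ('m, 'n, 'k) weyl fls)"
    by (rule fls_eqI) (simp add: weyl_scal_0 weyl_scal_1)
  then show ?thesis by (simp add: v_series_def psdo_v_def)
qed

lemma v_series_psdo_of: "v_series f * psdo_of a = psdo_of a * v_series f"
proof -
  have "fls_scal f * fls_const a = fls_const a * fls_scal f"
    by (rule fls_eqI) (simp add: weyl_scal_commute)
  then show ?thesis by (simp add: v_series_def psdo_of_def psdo_monom_0_mult)
qed

text \<open>The field \<open>complex fls\<close> is read in a second way: \<open>fls_X\<close> now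
  stands for the inverse of the derivation, hence the negated exponent. Working in a field provides
  all inverses of nonzero constant-coefficient operators, expanded in the required
  direction.\<close>

definition dv_series :: "complex fls \<Rightarrow> ('m::len0, 'n::len0, 'k::len0) weyl psdo" where
  "dv_series g = Abs_psdo (\<lambda>r. fls_const (weyl_scal (fls_nth g (- r))))"

lemma psdo_coeff_dv_series [simp]:
  "psdo_coeff (dv_series g :: ('m::len0, 'n::len0, 'k::len0) weyl psdo) r = fls_const (weyl_scal (fls_nth g (- r)))"
proof -
  have "\<forall>r>- fls_subdegree g. fls_const (weyl_scal (fls_nth g (- r))) = (0 :: ('m, 'n, 'k) weyl fls)"
    by (auto simp: fls_eq0_below_subdegree weyl_scal_0)
  then show ?thesis unfolding dv_series_def
    by (subst Abs_psdo_inverse) blast+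
qed

lemma dv_series_mult: "(dv_series (f * g) :: ('m::len0, 'n::len0, 'k::len0) weyl psdo) = dv_series f * dv_series g"
proof (rule psdo_eqI)
  fix u
  define N where "N = - fls_subdegree f"
  define M where "M = - fls_subdegree g"
  have N: "r > N \<Longrightarrow> psdo_coeff (dv_series f :: ('m, 'n, 'k) weyl psdo) r = 0" for r
    by (simp add: N_def fls_eq0_below_subdegree)
  have M: "r > M \<Longrightarrow> psdo_coeff (dv_series g :: ('m, 'n, 'k) weyl psdo) r = 0" for r
    by (simp add: M_def fls_eq0_below_subdegree)
  have "psdo_coeff (dv_series f * dv_series g :: ('m, 'n, 'k) weyl psdo) u = 
    (\<Sum>r=u-M..N. \<Sum>s\<le>nat (N + M - u). of_int (binom r s) * psdo_coeff (dv_series f) r *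
        (v_deriv ^^ s) (psdo_coeff (dv_series g) (u - r + int s)))"
    unfolding times_psdo.rep_eq by (rule psdo_times_box) (use N M in auto)
  also have "\<dots> = (\<Sum>r=u-M..N. \<Sum>s\<le>nat (N + M - u). if s = 0 then
      fls_const (weyl_scal (fls_nth f (- r) * fls_nth g (r - u))) else 0)"
    by (intro sum.cong refl) (auto simp: v_deriv_pow_const binom_def weyl_scal_mult)
  also have "\<dots> = (\<Sum>r=u-M..N. fls_const (weyl_scal (fls_nth f (- r) * fls_nth g (r - u))))"
    by simp
  also have "\<dots> = (\<Sum>i=-N..M-u. fls_const (weyl_scal (fls_nth f i * fls_nth g (- u - i))))"
    by (rule sum.reindex_bij_witness[of _ uminus uminus]) auto
  also have "\<dots> = fls_const (weyl_scal (\<Sum>i=-N..M-u. fls_nth f i * fls_nth g (- u - i)))"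
    by (rule fls_eqI) (simp add: fls_nth_sum weyl_scal_sum)
  also have "(\<Sum>i=-N..M-u. fls_nth f i * fls_nth g (- u - i)) = fls_nth (f * g) (- u)"
    by (rule fls_times_nth_box[symmetric]) (auto simp: N_def M_def)
  finally show "psdo_coeff (dv_series (f * g) :: ('m, 'n, 'k) weyl psdo) u =
    psdo_coeff (dv_series f * dv_series g) u" by simp
qed

lemma dv_series_add: "dv_series (f + g) = dv_series f + dv_series g"
  by (rule psdo_eqI) (simp add: psdo_coeff_add weyl_scal_add flip: fls_plus_const)

lemma dv_series_uminus: "dv_series (- f) = - dv_series f"
  by (rule psdo_eqI) (simp add: psdo_coeff_uminus weyl_scal_uminus flip: fls_const_uminus)

lemma dv_series_const: "dv_series (fls_const c) = psdo_scal c"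
  by (rule psdo_eqI) (simp add: psdo_scal_def psdo_of_def psdo_coeff_monom weyl_scal_0)

lemma dv_series_1 [simp]: "dv_series 1 = 1"
  by (rule psdo_eqI) (simp add: psdo_coeff_1 weyl_scal_1 weyl_scal_0)

lemma dv_series_dv: "dv_series fls_X_inv = psdo_dv"
  by (rule psdo_eqI) (simp add: psdo_dv_def psdo_coeff_monom weyl_scal_1 weyl_scal_0)

lemma dv_series_psdo_of: "dv_series g * psdo_of a = psdo_of a * dv_series g"
  by (rule psdo_eqI)
    (simp add: psdo_of_def psdo_coeff_times_const psdo_coeff_monom_0_times v_deriv_pow_const weyl_scal_commute)

text \<open>The commutator [g(\<partial>_v), v] = g'(\<partial>_v). As \<open>v_deriv\<close>
  differentiates with respect to \<open>fls_X_inv\<close>, it is the derivative in \<partial>_v once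
  the series is read through \<open>dv_series\<close>.\<close>

lemma dv_series_v: "dv_series g * psdo_v = (psdo_v * dv_series g + dv_series (v_deriv g) :: ('m::len0, 'n::len0, 'k::len0) weyl psdo)"
proof (rule psdo_eqI)
  fix u
  have "of_int (u + 1) * fls_const (weyl_scal (fls_nth g (- (u + 1)))) =
      fls_const (weyl_scal (fls_nth (v_deriv g) (- u)) :: ('m, 'n, 'k) weyl)"
  proof -
    define w where "w = fls_nth g (- (u + 1))"
    have e: "- u - 1 = - (u + 1)" by simp
    have "fls_nth (v_deriv g) (- u) = of_int (u + 1) * w"
      unfolding w_def v_deriv_nth e by (simp add: algebra_simps)
    then have "weyl_scal (fls_nth (v_deriv g) (- u)) = (of_int (u + 1) * weyl_scal w :: ('m, 'n, 'k) weyl)"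
      by (simp add: weyl_scal_mult weyl_scal_of_int del: of_int_add)
    moreover have "of_int (u + 1) = (fls_const (of_int (u + 1)) :: ('m, 'n, 'k) weyl fls)"
      by (simp add: fls_of_int)
    ultimately show ?thesis unfolding w_def[symmetric] by (simp del: of_int_add)
  qed
  moreover have "fls_const (weyl_scal c) * fls_X_inv = fls_X_inv * (fls_const (weyl_scal c) :: ('m, 'n, 'k) weyl fls)" for c
    by (rule fls_eqI) (simp add: fls_X_inv_times_conv_shift)
  ultimately show "psdo_coeff (dv_series g * psdo_v :: ('m, 'n, 'k) weyl psdo) u =
     psdo_coeff (psdo_v * dv_series g + dv_series (v_deriv g)) u"
    by (simp add: psdo_coeff_times_v psdo_coeff_add)
      (simp add: psdo_v_def psdo_coeff_monom_0_times)
qed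

section \<open>Normally ordered symbols\<close>

lemma psdo_scal_commute: "psdo_scal c * F = F * psdo_scal c"
proof (rule psdo_eqI)
  fix u
  have "fls_const (weyl_scal c) * f = f * fls_const (weyl_scal c)" for f :: "('a, 'b, 'c) weyl fls"
    by (rule fls_eqI) (simp add: weyl_scal_commute)
  then show "psdo_coeff (psdo_scal c * F) u = psdo_coeff (F * psdo_scal c) u"
    unfolding psdo_scal_def psdo_of_def
    by (simp add: psdo_coeff_monom_0_times psdo_coeff_times_const v_deriv_pow_const)
qed

lemma psdo_scal_add: "psdo_scal (a + b) = psdo_scal a + psdo_scal b"
  by (simp add: psdo_scal_def weyl_scal_add psdo_of_add)

lemma psdo_scal_mult: "psdo_scal (a * b) = psdo_scal a * psdo_scal b"
  by (simp add: psdo_scal_def weyl_scal_mult psdo_of_mult)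

lemma psdo_scal_0 [simp]: "psdo_scal 0 = 0"
  by (simp add: psdo_scal_def weyl_scal_0)

lemma psdo_scal_1 [simp]: "psdo_scal 1 = 1"
  by (simp add: psdo_scal_def weyl_scal_1)

lemma psdo_scal_uminus: "psdo_scal (- a) = - psdo_scal a"
  by (simp add: psdo_scal_def weyl_scal_uminus psdo_of_uminus)

lemma psdo_of_of_int: "psdo_of (of_int c) = (of_int c :: 'a::ring_1 psdo)"
proof (induction c rule: int_induct[where k = 0])
  case (step2 i)
  have "psdo_of (of_int (i - 1)) + psdo_of 1 = (psdo_of (of_int (i - 1) + 1) :: 'a psdo)"
    by (simp only: psdo_of_add)
  then show ?case using step2 by (simp add: eq_diff_eq)
qed (simp_all add: psdo_of_add)

lemma psdo_scal_of_int: "psdo_scal (of_int c) = of_int c"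
  by (simp add: psdo_scal_def weyl_scal_of_int psdo_of_of_int)

text \<open>The number 2 is invertible through the complex scalars.\<close>

lemma psdo_eq_uminus_self:
  fixes x :: "('m::len0, 'n::len0, 'k::len0) weyl psdo"
  assumes "x = - x"
  shows "x = 0"
proof -
  have "psdo_scal 2 * x = 0" using assms psdo_scal_add[of 1 1]
    by (metis add.right_inverse mult_2 one_add_one psdo_scal_1)
  then have "psdo_scal (1/2 * 2) * x = 0" by (simp only: psdo_scal_mult mult.assoc) simp
  then show ?thesis by simp
qed

text \<open>Normal order: functions of \<open>v\<close> on the left, functions of the derivation on
  the right, the Weyl algebra between them, where it commutes with both sides. All identities below
  are reduced to manipulations of these three slots.\<close>

definition nsym :: "complex fls \<Rightarrow> ('m::len0, 'n::len0, 'k::len0) weyl \<Rightarrow> complex fls \<Rightarrow> ('m, 'n, 'k) weyl psdo" where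
  "nsym h a g = v_series h * psdo_of a * dv_series g"

lemma nsym_add1: "nsym (h + h') a g = nsym h a g + nsym h' a g"
  by (simp add: nsym_def v_series_add distrib_right)

lemma nsym_add2: "nsym h (a + a') g = nsym h a g + nsym h a' g"
  by (simp add: nsym_def psdo_of_add distrib_left distrib_right)

lemma nsym_add3: "nsym h a (g + g') = nsym h a g + nsym h a g'"
  by (simp add: nsym_def dv_series_add distrib_left)

lemma nsym_zero [simp]: "nsym 0 a g = 0" "nsym h 0 g = 0" "nsym h a 0 = 0"
  using nsym_add1[of 0 0 a g] nsym_add2[of h 0 0 g] nsym_add3[of h a 0 0] by auto

lemma nsym_sum3: "nsym h a (\<Sum>x\<in>A. F x) = (\<Sum>x\<in>A. nsym h a (F x))"
  by (induction A rule: infinite_finite_induct) (auto simp: nsym_add3)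

lemma nsym_uminus1: "nsym (- h) a g = - nsym h a g"
  by (simp add: nsym_def v_series_uminus)

lemma nsym_uminus2: "nsym h (- a) g = - nsym h a g"
  by (simp add: nsym_def psdo_of_uminus)

lemma nsym_uminus3: "nsym h a (- g) = - nsym h a g"
  by (simp add: nsym_def dv_series_uminus)

lemma nsym_scal: "psdo_scal c * nsym h a g = nsym (fls_const c * h) a g"
  by (simp add: nsym_def v_series_mult v_series_const mult.assoc)

lemma nsym_scal3: "nsym h a (fls_const c * g) = nsym (fls_const c * h) a g"
  unfolding nsym_scal[symmetric]
  by (simp add: nsym_def dv_series_mult dv_series_const)
    (metis (no_types) mult.assoc psdo_scal_commute)

lemma nsym_sign2: "nsym h ((-1) ^ e * a) g = nsym ((-1) ^ e * h) a g"
  by (cases "even e") (simp_all add: nsym_uminus1 nsym_uminus2)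

lemma nsym_of_mult: "psdo_of b * nsym h a g = nsym h (b * a) g"
proof -
  have "psdo_of b * nsym h a g = psdo_of b * v_series h * psdo_of a * dv_series g"
    by (simp only: nsym_def mult.assoc)
  then show ?thesis by (simp only: nsym_def psdo_of_mult mult.assoc v_series_psdo_of[symmetric])
qed

lemma nsym_mult_of: "nsym h a g * psdo_of b = nsym h (a * b) g"
proof -
  have "nsym h a g * psdo_of b = v_series h * psdo_of a * (dv_series g * psdo_of b)"
    by (simp only: nsym_def mult.assoc)
  then show ?thesis by (simp only: nsym_def psdo_of_mult mult.assoc dv_series_psdo_of)
qed

lemma nsym_mult_dv: "nsym h a g * dv_series g' = nsym h a (g * g')"
  by (simp add: nsym_def dv_series_mult mult.assoc)

text \<open>A right factor v has to cross \<open>g\<close>, and the crossing costs the derivative of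
  \<open>g\<close>; this is where all derivatives of resolvents come from.\<close>

lemma nsym_mult_v: "nsym h a g * psdo_v = nsym (h * fls_X_inv) a g + nsym h a (v_deriv g)"
proof -
  have "nsym h a g * psdo_v = v_series h * (psdo_of a * psdo_v) * dv_series g + nsym h a (v_deriv g)"
    by (simp add: nsym_def mult.assoc dv_series_v distrib_left)
  also have "psdo_of a * psdo_v = psdo_v * psdo_of a"
    by (simp add: v_series_psdo_of flip: v_series_v)
  also have "v_series h * (psdo_v * psdo_of a) * dv_series g = nsym (h * fls_X_inv) a g"
    by (simp add: nsym_def v_series_mult v_series_v mult.assoc)
  finally show ?thesis .
qed

lemma nsym_mult_v_diff:
  "nsym h a g * (psdo_v - psdo_scal c) = nsym (h * (fls_X_inv - fls_const c)) a g + nsym h a (v_deriv g)"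
proof -
  have "nsym h a g * psdo_scal c = nsym (fls_const c * h) a g"
    by (simp add: psdo_scal_commute[symmetric] nsym_scal)
  moreover have "nsym (h * (fls_X_inv - fls_const c)) a g = nsym (h * fls_X_inv) a g - nsym (fls_const c * h) a g"
    using nsym_add1[of "h * fls_X_inv" "- (fls_const c * h)" a g]
    by (simp add: nsym_uminus1 right_diff_distrib mult.commute)
  ultimately show ?thesis by (simp add: nsym_mult_v right_diff_distrib)
qed

section \<open>Resolvents and the Leibniz expansion\<close>

text \<open>The resolvent (\<partial>_v - \<Lambda>_j)^(-1) under the reading of
  \<open>dv_series\<close>; the field inverse is its expansion in powers of
  \<partial>_v^(-1).\<close>

definition dv_res :: "(nat \<Rightarrow> complex) \<Rightarrow> nat \<Rightarrow> complex fls" where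
  "dv_res \<Lambda> j = inverse (fls_X_inv - fls_const (\<Lambda> j))"

lemma dv_minus_const_nz: "fls_X_inv - fls_const c \<noteq> (0 :: complex fls)"
proof
  assume "fls_X_inv - fls_const c = 0"
  then have "fls_nth (fls_X_inv - fls_const c) (-1) = fls_nth 0 (-1)" by simp
  then show False by simp
qed

lemma dv_res_nz [simp]: "dv_res \<Lambda> j \<noteq> 0"
  by (metis dv_res_def dv_minus_const_nz inverse_nonzero_iff_nonzero)

lemma v_deriv_inverse:
  fixes g :: "complex fls"
  assumes "g \<noteq> 0"
  shows "v_deriv (inverse g) = - (inverse g * inverse g * v_deriv g)"
proof -
  have "v_deriv (inverse g) * g + inverse g * v_deriv g = 0"
    using v_deriv_mult[of "inverse g" g] assms by simp
  then have "v_deriv (inverse g) * g = - (inverse g * v_deriv g)"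
    by (simp add: eq_neg_iff_add_eq_0)
  then have "v_deriv (inverse g) * g * inverse g = - (inverse g * v_deriv g) * inverse g"
    by simp
  then show ?thesis using assms by (simp add: mult.assoc)
qed

lemma v_deriv_dv: "v_deriv (fls_X_inv - fls_const c) = (1 :: complex fls)"
proof -
  have "fls_X_inv - fls_const c = fls_X_inv + fls_const (- c)" by (rule fls_eqI) simp
  then show ?thesis by (simp only: v_deriv_add v_deriv_v v_deriv_const add_0_right)
qed

lemma v_deriv_dv_res: "v_deriv (dv_res \<Lambda> j) = - (dv_res \<Lambda> j * dv_res \<Lambda> j)"
  unfolding dv_res_def by (subst v_deriv_inverse[OF dv_minus_const_nz]) (simp only: v_deriv_dv mult_1_right)

text \<open>A position with \<open>f p = 0\<close> uses the summand v - z_p of its matrix entry, any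
  other position the summand -x \<partial> (\<partial>_v - \<Lambda>)^(-1) of index
  \<open>f p\<close>. Of the latter only the sign is recorded here; the resolvent goes to
  \<open>gpart\<close> and the pair x, \<partial> to \<open>nord\<close>.\<close>

definition hpart :: "(nat \<Rightarrow> complex) \<Rightarrow> nat set \<Rightarrow> (nat \<Rightarrow> nat) \<Rightarrow> complex fls" where
  "hpart z A f = (\<Prod>p\<in>A. if f p = 0 then fls_X_inv - fls_const (z p) else -1)"

definition gpart :: "(nat \<Rightarrow> complex) \<Rightarrow> nat set \<Rightarrow> (nat \<Rightarrow> nat) \<Rightarrow> complex fls" where
  "gpart \<Lambda> A f = (\<Prod>p\<in>A. if f p = 0 then 1 else dv_res \<Lambda> (f p))"

lemma hpart_remove: "finite A \<Longrightarrow> c \<in> A \<Longrightarrow>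
  hpart z A f = (if f c = 0 then fls_X_inv - fls_const (z c) else -1) * hpart z (A - {c}) f"
  unfolding hpart_def by (simp add: prod.remove[of A c])

lemma gpart_remove: "finite A \<Longrightarrow> c \<in> A \<Longrightarrow>
  gpart \<Lambda> A f = (if f c = 0 then 1 else dv_res \<Lambda> (f c)) * gpart \<Lambda> (A - {c}) f"
  unfolding gpart_def by (simp add: prod.remove[of A c])

lemma hpart_cong: "(\<And>p. p \<in> A \<Longrightarrow> f p = f' p) \<Longrightarrow> hpart z A f = hpart z A f'"
  unfolding hpart_def by (intro prod.cong) auto

lemma gpart_cong: "(\<And>p. p \<in> A \<Longrightarrow> f p = f' p) \<Longrightarrow> gpart \<Lambda> A f = gpart \<Lambda> A f'"
  unfolding gpart_def by (intro prod.cong) auto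

lemma v_deriv_gpart:
  "finite A \<Longrightarrow> v_deriv (gpart \<Lambda> A f) = - (\<Sum>p\<in>{p\<in>A. f p \<noteq> 0}. gpart \<Lambda> A f * dv_res \<Lambda> (f p))"
proof (induction A rule: finite_induct)
  case (insert c A)
  have g: "gpart \<Lambda> (insert c A) f = (if f c = 0 then 1 else dv_res \<Lambda> (f c)) * gpart \<Lambda> A f"
    using insert by (simp add: gpart_def)
  have s: "{p \<in> insert c A. f p \<noteq> 0} = (if f c = 0 then {p\<in>A. f p \<noteq> 0} else insert c {p\<in>A. f p \<noteq> 0})"
    by auto
  show ?case
  proof (cases "f c = 0")
    case True
    then show ?thesis unfolding s using insert.IH by (simp add: g)
  next
    case False
    then have "v_deriv (gpart \<Lambda> (insert c A) f) =
        - (dv_res \<Lambda> (f c) * gpart \<Lambda> A f * dv_res \<Lambda> (f c)) +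
        dv_res \<Lambda> (f c) * v_deriv (gpart \<Lambda> A f)"
      by (simp add: g v_deriv_mult v_deriv_dv_res algebra_simps)
    also have "\<dots> = - (\<Sum>p\<in>insert c {p\<in>A. f p \<noteq> 0}. dv_res \<Lambda> (f c) * gpart \<Lambda> A f * dv_res \<Lambda> (f p))"
      using insert.hyps unfolding insert.IH by (simp add: sum_distrib_left mult.assoc)
    finally show ?thesis unfolding s using False by (simp add: g)
  qed
qed (simp add: gpart_def)

text \<open>Index set of the fully expanded determinant: a permutation together with a choice of
  summand in every entry. The summand 0 exists on the diagonal only, hence
  \<open>\<sigma> p = p\<close> there.\<close>

definition leibniz :: "nat \<Rightarrow> nat \<Rightarrow> ((nat \<Rightarrow> nat) \<times> (nat \<Rightarrow> nat)) set" where
  "leibniz k N = {(\<sigma>, f). \<sigma> permutes {1..k} \<and> f \<in> {1..k} \<rightarrow>\<^sub>E {0..N} \<and> (\<forall>p\<in>{1..k}. f p = 0 \<longrightarrow> \<sigma> p = p)}"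

lemma finite_leibniz: "finite (leibniz k N)"
proof (rule finite_subset)
  show "leibniz k N \<subseteq> {\<sigma>. \<sigma> permutes {1..k}} \<times> ({1..k} \<rightarrow>\<^sub>E {0..N})"
    by (auto simp: leibniz_def)
qed (auto simp: finite_permutations intro: finite_PiE)

lemma fiber_transpose:
  assumes "b \<in> {1..k}" "c \<in> {1..k}"
  shows "card (fiber k (f \<circ> transpose b c) i) = card (fiber k f i)"
proof (rule bij_betw_same_card)
  show "bij_betw (transpose b c) (fiber k (f \<circ> transpose b c) i) (fiber k f i)"
    by (rule bij_betw_byWitness[where f' = "transpose b c"])
      (use assms in \<open>auto simp: fiber_def transpose_def\<close>)
qed

section \<open>Cofactor rows\<close>

lemma nsym_diff1: "nsym (h - h') a g = nsym h a g - nsym h' a g"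
  using nsym_add1[of h "- h'" a g] by (simp add: nsym_uminus1)

text \<open>Fixed points of \<open>t\<close> are allowed: the sum equals its own negative, and 2 is
  invertible.\<close>

lemma sum_cancel_involution:
  fixes F :: "'b \<Rightarrow> ('m::len0, 'n::len0, 'k::len0) weyl psdo"
  assumes "\<And>x. x \<in> A \<Longrightarrow> t x \<in> A \<and> t (t x) = x \<and> F (t x) = - F x"
  shows "sum F A = 0"
proof -
  have "sum F A = (\<Sum>x\<in>A. - F x)"
    by (rule sum.reindex_bij_witness[of _ t t]) (use assms in \<open>auto simp: minus_equation_iff\<close>)
  then show ?thesis by (intro psdo_eq_uminus_self) (simp add: sum_negf)
qed

lemma sign_transpose_comp:
  assumes "\<sigma> permutes K" "finite K" "b \<noteq> c"
  shows "sign (\<sigma> \<circ> transpose b c) = - sign \<sigma>"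
proof -
  have "permutation \<sigma>" using assms permutation_permutes by blast
  then show ?thesis using assms by (simp add: sign_compose sign_swap_id permutation_swap_id)
qed

lemma psdo_dv_minus_scal: "psdo_dv - psdo_scal c = dv_series (fls_X_inv - fls_const c)"
proof -
  have "fls_X_inv - fls_const c = fls_X_inv + - fls_const c" by simp
  then show ?thesis by (simp only: dv_series_add dv_series_uminus dv_series_dv dv_series_const) simp
qed

text \<open>
  The last row of the inverse of the top-left block of size \<open>k + i\<close>, up to a left factor. The weights
  \<open>\<omega>\<close> and \<open>u\<close> depend on how often \<open>f\<close> takes the value \<open>i\<close>: an odd \<open>i\<close> needs \<open>\<omega> r = 1 / r\<close> and
  \<open>u r = 1\<close>, an even \<open>i\<close> needs \<open>\<omega>\<close> and \<open>u\<close> concentrated in \<open>r = 1\<close> and \<open>r = 0\<close>. The assumptions on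
  the weights are what the cancellations in the columns of \<open>x\<close> require; \<open>e\<close> records the logarithmic
  derivative of \<open>\<gamma>\<close>.
\<close>

locale row_cofactors =
  fixes z \<Lambda> :: "nat \<Rightarrow> complex" and \<omega> u :: "nat \<Rightarrow> complex" and \<gamma> :: "complex fls"
    and i m n k :: nat and e :: "nat \<Rightarrow> complex" and ty :: "('m::len0, 'n::len0, 'k::len0) weyl itself"
  assumes m: "m = LENGTH('m)" and n: "n = LENGTH('n)" and k: "k = LENGTH('k)"
    and i: "i \<in> {1..m + n}"
    and v_deriv_\<gamma>: "v_deriv \<gamma> = (\<Sum>j\<in>{1..i}. fls_const (e j) * (\<gamma> * dv_res \<Lambda> j))"
    and e: "\<And>j. j \<in> {1..<i} \<Longrightarrow> e j = (-1) ^ par m j"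
    and weight_v: "\<And>r. r \<ge> 1 \<Longrightarrow> \<omega> r * (e i - (of_nat r - 1)) = (-1) ^ par m i * u r"
    and weight_x: "\<And>r. \<omega> (r + 1) * (1 - (-1) ^ par m i * of_nat r) + (-1) ^ par m i * u r = 0"
    and weight_even: "\<And>r. r \<ge> 1 \<Longrightarrow> par m i = 0 \<Longrightarrow> u r = 0"
begin

abbreviation "K \<equiv> {1..k}"
abbreviation X :: "nat \<Rightarrow> nat \<Rightarrow> ('m, 'n, 'k) weyl" where "X \<equiv> weyl_x"
abbreviation D :: "nat \<Rightarrow> nat \<Rightarrow> ('m, 'n, 'k) weyl" where "D \<equiv> weyl_d"
abbreviation nrd :: "nat set \<Rightarrow> (nat \<Rightarrow> nat) \<Rightarrow> (nat \<Rightarrow> nat) \<Rightarrow> ('m, 'n, 'k) weyl" where "nrd \<equiv> nord"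
abbreviation "S \<equiv> leibniz k i"
abbreviation r :: "(nat \<Rightarrow> nat) \<Rightarrow> nat" where "r f \<equiv> card (fiber k f i)"

definition signed :: "(nat \<Rightarrow> nat) \<Rightarrow> complex \<Rightarrow> complex fls \<Rightarrow> complex fls" where
  "signed \<sigma> c h = fls_const (of_int (sign \<sigma>) * c) * h"

text \<open>A Leibniz term opened at position \<open>b\<close>, where \<open>f b = i\<close>: the
  derivative \<partial>_{i,b}, the resolvent and the sign of that position are removed, while its x
  stays. Multiplication by \<partial>_{i,b} from the right closes it again.\<close>

definition y_entry :: "nat \<Rightarrow> (nat \<Rightarrow> nat) \<times> (nat \<Rightarrow> nat) \<Rightarrow> ('m, 'n, 'k) weyl psdo" where
  "y_entry b = (\<lambda>(\<sigma>, f). nsym (signed \<sigma> (\<omega> (r f)) (hpart z (K - {b}) f))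
     (X i (\<sigma> b) * nrd (K - {b}) \<sigma> f) (gpart \<Lambda> (K - {b}) f * \<gamma>))"

definition y_left :: "nat \<Rightarrow> ('m, 'n, 'k) weyl psdo" where
  "y_left b = (\<Sum>s\<in>{s\<in>S. snd s b = i}. y_entry b s)"

text \<open>Forced by the column of the earlier index \<open>j\<close>, whose entries are the
  \<partial>_{j,c} and, in the lower block, \<partial>_v - \<Lambda>_j alone.\<close>

definition y_mid :: "nat \<Rightarrow> ('m, 'n, 'k) weyl psdo" where
  "y_mid j = - (\<Sum>c\<in>K. y_left c * psdo_of (D j c) * dv_series (dv_res \<Lambda> j))"

definition y_last :: "('m, 'n, 'k) weyl psdo" where
  "y_last = (\<Sum>(\<sigma>, f)\<in>S. nsym (signed \<sigma> (u (r f)) (hpart z K f)) (nrd K \<sigma> f) (gpart \<Lambda> K f * \<gamma>))"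

definition y_rhs :: "('m, 'n, 'k) weyl psdo" where
  "y_rhs = (\<Sum>(\<sigma>, f)\<in>S. nsym (signed \<sigma> (u (r f) - of_nat (r f) * \<omega> (r f)) (hpart z K f))
     (nrd K \<sigma> f) (gpart \<Lambda> K f * (\<gamma> * (fls_X_inv - fls_const (\<Lambda> i)))))"

lemma SD:
  assumes "(\<sigma>, f) \<in> S"
  shows "\<sigma> permutes K" "f \<in> K \<rightarrow>\<^sub>E {0..i}" "p \<in> K \<Longrightarrow> f p = 0 \<Longrightarrow> \<sigma> p = p"
    "p \<in> K \<Longrightarrow> f p \<le> i" "p \<in> K \<Longrightarrow> f p \<le> m + n"
    "p \<in> K \<Longrightarrow> \<sigma> p \<in> K"
proof -
  show \<sigma>: "\<sigma> permutes K" and f: "f \<in> K \<rightarrow>\<^sub>E {0..i}" and "p \<in> K \<Longrightarrow> f p = 0 \<Longrightarrow> \<sigma> p = p"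
    using assms by (simp_all add: leibniz_def)
  show "f p \<le> i" if "p \<in> K" using PiE_mem[OF f that] by simp
  then show "p \<in> K \<Longrightarrow> f p \<le> m + n" using i by fastforce
  show "p \<in> K \<Longrightarrow> \<sigma> p \<in> K" using permutes_in_image[OF \<sigma>] by blast
qed

lemma finS [simp]: "finite S" "finite {s \<in> S. P s}"
  by (simp_all add: finite_leibniz)

lemma signed_uminus: "signed \<sigma> c (- h) = - signed \<sigma> c h"
  by (simp add: signed_def)

lemma signed_mult: "signed \<sigma> c h * h' = signed \<sigma> c (h * h')"
  by (simp add: signed_def mult.assoc)

lemma fls_const_signed: "fls_const a * signed \<sigma> c h = signed \<sigma> (a * c) h"
  by (simp add: signed_def mult.left_commute flip: mult.assoc)

lemma signed_swap: "\<sigma> permutes K \<Longrightarrow> b \<noteq> c \<Longrightarrow> signed (\<sigma> \<circ> transpose b c) a h = - signed \<sigma> a h"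
  by (simp add: signed_def sign_transpose_comp fls_const_uminus)

text \<open>Closing an open position gives back a Leibniz term with the opposite sign, and the
  factor \<partial>_v - \<Lambda>_i in \<open>y_rhs\<close> cancels the resolvent regained at that
  position. A term arises once for each position in its fiber over \<open>i\<close>, whence the
  coefficient \<open>u r - r * \<omega> r\<close>.\<close>

lemma last_column:
  "(\<Sum>b\<in>K. y_left b * psdo_of (D i b)) + y_last * (psdo_dv - psdo_scal (\<Lambda> i)) = y_rhs"
proof -
  define q where "q = fls_X_inv - fls_const (\<Lambda> i)"
  define G where "G = (\<lambda>c (\<sigma>, f). nsym (signed \<sigma> (c (r f)) (hpart z K f)) (nrd K \<sigma> f) (gpart \<Lambda> K f * (\<gamma> * q)))"
  have q: "dv_res \<Lambda> i * q = 1"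
    by (simp add: dv_res_def q_def dv_minus_const_nz[simplified])
  have qs: "psdo_dv - psdo_scal (\<Lambda> i) = dv_series q" by (simp add: q_def psdo_dv_minus_scal)
  have entry: "y_entry b s * psdo_of (D i b) = - G \<omega> s" if "b \<in> K" "s \<in> S" "snd s b = i" for b s
  proof -
    obtain \<sigma> f where s: "s = (\<sigma>, f)" by (cases s)
    have i0: "f b = i" "f b \<noteq> 0" using that i by (auto simp: s)
    have "gpart \<Lambda> K f * (\<gamma> * q) = dv_res \<Lambda> i * gpart \<Lambda> (K - {b}) f * (\<gamma> * q)"
      using gpart_remove[of K b \<Lambda> f] that i0 by simp
    also have "\<dots> = gpart \<Lambda> (K - {b}) f * \<gamma> * (dv_res \<Lambda> i * q)"
      by (simp only: mult_ac)
    finally have g: "gpart \<Lambda> K f * (\<gamma> * q) = gpart \<Lambda> (K - {b}) f * \<gamma>"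
      by (simp only: q mult_1_right)
    have h: "hpart z K f = - hpart z (K - {b}) f"
      using hpart_remove[of K b z f] that i0 by simp
    have n: "nrd K \<sigma> f = X i (\<sigma> b) * nrd (K - {b}) \<sigma> f * D i b"
      using nord_remove[of K b \<sigma> f, where 'a='m and 'b='n and 'c='k] that i0 by simp
    show ?thesis
      unfolding s y_entry_def G_def prod.case g h n nsym_mult_of signed_uminus nsym_uminus1 by simp
  qed
  have "(\<Sum>b\<in>K. y_left b * psdo_of (D i b)) = (\<Sum>b\<in>K. \<Sum>s\<in>{s\<in>S. snd s b = i}. - G \<omega> s)"
    unfolding y_left_def sum_distrib_right by (intro sum.cong refl entry) auto
  also have "\<dots> = (\<Sum>b\<in>K. \<Sum>s\<in>S. if snd s b = i then - G \<omega> s else 0)"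
    by (intro sum.cong refl sum.inter_filter) simp
  also have "\<dots> = (\<Sum>s\<in>S. \<Sum>b\<in>K. if snd s b = i then - G \<omega> s else 0)"
    by (rule sum.swap)
  also have "\<dots> = (\<Sum>s\<in>S. - G (\<lambda>r. of_nat r * \<omega> r) s)"
  proof (rule sum.cong[OF refl])
    fix s assume "s \<in> S"
    obtain \<sigma> f where s: "s = (\<sigma>, f)" by (cases s)
    have "(\<Sum>b\<in>K. if snd s b = i then - G \<omega> s else 0) = (\<Sum>b\<in>fiber k f i. - G \<omega> s)"
      unfolding fiber_def s snd_conv by (rule sum.inter_filter[symmetric]) simp
    also have "\<dots> = psdo_scal (of_nat (r f)) * (- G \<omega> s)"
      using psdo_scal_of_int[of "int (r f)", where 'a='m and 'b='n and 'c='k] by simp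
    also have "\<dots> = - G (\<lambda>r. of_nat r * \<omega> r) s"
      by (simp add: G_def s nsym_scal fls_const_signed)
    finally show "(\<Sum>b\<in>K. if snd s b = i then - G \<omega> s else 0) = - G (\<lambda>r. of_nat r * \<omega> r) s" .
  qed
  finally have 1: "(\<Sum>b\<in>K. y_left b * psdo_of (D i b)) = (\<Sum>s\<in>S. - G (\<lambda>r. of_nat r * \<omega> r) s)" .
  have 2: "y_last * (psdo_dv - psdo_scal (\<Lambda> i)) = (\<Sum>s\<in>S. G u s)"
    unfolding y_last_def qs sum_distrib_right G_def
    by (intro sum.cong refl) (auto simp: nsym_mult_dv mult.assoc)
  have "- G (\<lambda>r. of_nat r * \<omega> r) s + G u s = G (\<lambda>r. u r - of_nat r * \<omega> r) s" for s
  proof -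
    have "signed \<sigma> (a - b) h = signed \<sigma> a h + - signed \<sigma> b h" for \<sigma> a b h
      by (simp add: signed_def right_diff_distrib left_diff_distrib flip: fls_minus_const)
    then show ?thesis by (cases s) (simp add: G_def nsym_diff1)
  qed
  then show ?thesis unfolding 1 2 sum.distrib[symmetric] y_rhs_def
    by (simp add: G_def q_def)
qed

lemma middle_column:
  "(\<Sum>b\<in>K. y_left b * psdo_of (D j b)) + y_mid j * (psdo_dv - psdo_scal (\<Lambda> j)) = 0"
proof -
  define q where "q = fls_X_inv - fls_const (\<Lambda> j)"
  have q: "dv_res \<Lambda> j * q = 1"
    by (simp add: dv_res_def q_def dv_minus_const_nz[simplified])
  have qs: "psdo_dv - psdo_scal (\<Lambda> j) = (dv_series q :: ('m, 'n, 'k) weyl psdo)" by (simp add: q_def psdo_dv_minus_scal)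
  have "a * dv_series (dv_res \<Lambda> j) * dv_series q = (a :: ('m, 'n, 'k) weyl psdo)" for a
    unfolding mult.assoc dv_series_mult[symmetric] q by simp
  then show ?thesis by (simp add: y_mid_def qs sum_distrib_right)
qed

section \<open>The columns of x: main terms, derivatives and contractions\<close>

text \<open>An opened term with a free weight and an extra right factor in the derivation, which
  will be a resolvent left over from differentiation or contraction.\<close>

definition term_y :: "(nat \<Rightarrow> complex) \<Rightarrow> nat \<Rightarrow> (nat \<Rightarrow> nat) \<times> (nat \<Rightarrow> nat) \<Rightarrow> complex fls \<Rightarrow> ('m, 'n, 'k) weyl psdo" where
  "term_y w b = (\<lambda>(\<sigma>, f) q. nsym (signed \<sigma> (w (r f)) (hpart z (K - {b}) f))
     (X i (\<sigma> b) * nrd (K - {b}) \<sigma> f) (gpart \<Lambda> (K - {b}) f * (\<gamma> * q)))"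

text \<open>Here \<open>f\<close> is taken after the open position \<open>c\<close> has been
  refilled with a smaller index, so the weight of the original term is found at
  \<open>r f + 1\<close>. The x at \<open>c\<close> is now x_{f c, b}, and the former one stands in
  front.\<close>

definition replaced :: "nat \<Rightarrow> (nat \<Rightarrow> nat) \<times> (nat \<Rightarrow> nat) \<times> nat \<Rightarrow> ('m, 'n, 'k) weyl psdo" where
  "replaced b = (\<lambda>(\<sigma>, f, c). nsym (signed \<sigma> (\<omega> (r f + 1)) (hpart z K f))
     (X i (\<sigma> c) * nrd K (\<sigma>(c := b)) f) (gpart \<Lambda> K f * \<gamma>))"

text \<open>The residue of x_{j,b} meeting the \<partial>_{j,b} of another position: position
  \<open>b\<close> keeps its x only, position \<open>c\<close> its derivative \<partial>_{j,c}
  besides the x in front, and two resolvents of index \<open>j\<close> remain.\<close>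

definition contraction :: "nat \<Rightarrow> nat \<Rightarrow> nat \<Rightarrow> (nat \<Rightarrow> nat) \<times> (nat \<Rightarrow> nat) \<Rightarrow> ('m, 'n, 'k) weyl psdo" where
  "contraction b c j = (\<lambda>(\<sigma>, f). nsym (signed \<sigma> (\<omega> (r f)) (hpart z (K - {c} - {b}) f))
     (X i (\<sigma> c) * X j (\<sigma> b) * nrd (K - {c} - {b}) \<sigma> f * D j c)
     (gpart \<Lambda> (K - {c} - {b}) f * dv_res \<Lambda> j * (\<gamma> * dv_res \<Lambda> j)))"

text \<open>A complete Leibniz term with x_{i,b} in front, the common form to which everything
  uncontracted is brought.\<close>

definition bordered :: "(nat \<Rightarrow> complex) \<Rightarrow> nat \<Rightarrow> (nat \<Rightarrow> nat) \<times> (nat \<Rightarrow> nat) \<Rightarrow> ('m, 'n, 'k) weyl psdo" where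
  "bordered w b = (\<lambda>(\<sigma>, f). nsym (signed \<sigma> (w (r f)) (hpart z K f)) (X i b * nrd K \<sigma> f) (gpart \<Lambda> K f * \<gamma>))"

lemma r_update:
  assumes "c \<in> K" "f c = i" "j \<noteq> i"
  shows "r (f(c := j)) + 1 = r f"
proof -
  have "fiber k (f(c := j)) i = fiber k f i - {c}" using assms by (auto simp: fiber_def)
  moreover have "c \<in> fiber k f i" "finite (fiber k f i)" using assms by (auto simp: fiber_def)
  ultimately show ?thesis using card.remove[of "fiber k f i" c] by simp
qed

lemma r_ge_1: "b \<in> K \<Longrightarrow> f b = i \<Longrightarrow> r f \<ge> 1"
proof -
  assume "b \<in> K" "f b = i"
  then have "b \<in> fiber k f i" "finite (fiber k f i)" by (simp_all add: fiber_def)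
  then show ?thesis by (metis One_nat_def Suc_le_eq card_gt_0_iff empty_iff)
qed

text \<open>The uncrossed product turns the open position \<open>b\<close> into a diagonal one.
  Crossing the derivation differentiates \<open>gpart\<close> and \<gamma>: each remaining position
  with index below \<open>i\<close> gives a term of the second sum, \<gamma> gives the third sum.
  Index \<open>i\<close> is collected at the end, with \<open>e i\<close> from \<gamma> and one -1
  for each of the \<open>r - 1\<close> other positions of that fiber.\<close>

lemma x_column_left:
  assumes "b \<in> K"
  shows "y_left b * (psdo_v - psdo_scal (z b)) =
    (\<Sum>s\<in>{s\<in>S. snd s b = i}. replaced b (fst s, (snd s)(b := 0), b))
    - (\<Sum>c\<in>K - {b}. \<Sum>j\<in>{1..<i}. \<Sum>s\<in>{s\<in>S. snd s b = i \<and> snd s c = j}. term_y \<omega> b s (dv_res \<Lambda> j))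
    + (\<Sum>j\<in>{1..<i}. \<Sum>s\<in>{s\<in>S. snd s b = i}. psdo_scal ((-1) ^ par m j) * term_y \<omega> b s (dv_res \<Lambda> j))
    + (\<Sum>s\<in>{s\<in>S. snd s b = i}. term_y (\<lambda>r. \<omega> r * (e i - (of_nat r - 1))) b s (dv_res \<Lambda> i))"
proof -
  let ?Sb = "{s\<in>S. snd s b = i}"
  let ?w = "dv_res \<Lambda>"
  have entry: "y_entry b s * (psdo_v - psdo_scal (z b)) =
      replaced b (fst s, (snd s)(b := 0), b)
      - (\<Sum>c\<in>K - {b}. \<Sum>j\<in>{1..<i}. if snd s c = j then term_y \<omega> b s (?w j) else 0)
      + (\<Sum>j\<in>{1..<i}. psdo_scal ((-1) ^ par m j) * term_y \<omega> b s (?w j))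
      + term_y (\<lambda>r. \<omega> r * (e i - (of_nat r - 1))) b s (?w i)" if "s \<in> ?Sb" for s
  proof -
    obtain \<sigma> f where s: "s = (\<sigma>, f)" by (cases s)
    have S: "(\<sigma>, f) \<in> S" "f b = i" using that by (auto simp: s)
    define h where "h = hpart z (K - {b}) f"
    define a where "a = X i (\<sigma> b) * nrd (K - {b}) \<sigma> f"
    define g where "g = gpart \<Lambda> (K - {b}) f"
    define C where "C = signed \<sigma> (\<omega> (r f)) h"
    have t: "term_y \<omega> b s q = nsym C a (g * \<gamma> * q)" for q
      by (simp add: term_y_def s C_def a_def g_def h_def mult.assoc)
    let ?f = "f(b := 0)"
    have "hpart z K ?f = h * (fls_X_inv - fls_const (z b))" "gpart \<Lambda> K ?f = g"
      "nrd K (\<sigma>(b := b)) ?f = nrd (K - {b}) \<sigma> f"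
      using assms hpart_remove[of K b z ?f] gpart_remove[of K b \<Lambda> ?f]
        nord_remove[of K b "\<sigma>(b := b)" ?f, where 'a='m and 'b='n and 'c='k]
        hpart_cong[of "K - {b}" ?f f z] gpart_cong[of "K - {b}" ?f f \<Lambda>]
        nord_cong[of "K - {b}" ?f f "\<sigma>(b := b)" \<sigma>, where 'a='m and 'b='n and 'c='k]
      by (auto simp: h_def g_def)
    moreover have "r ?f + 1 = r f" using r_update[of b f 0] assms S i by auto
    ultimately have rp: "replaced b (fst s, (snd s)(b := 0), b) = nsym (C * (fls_X_inv - fls_const (z b))) a (g * \<gamma>)"
      by (simp add: replaced_def s C_def a_def signed_mult)
    have split: "{p\<in>K - {b}. f p \<noteq> 0} = {p\<in>K - {b}. f p \<in> {1..<i}} \<union> (fiber k f i - {b})"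
      using SD(4)[OF S(1)] i by (auto simp: fiber_def) (metis atLeastAtMost_iff le_neq_implies_less)
    have "(\<Sum>p\<in>{p\<in>K - {b}. f p \<noteq> 0}. nsym C a (g * \<gamma> * ?w (f p))) =
       (\<Sum>p\<in>{p\<in>K - {b}. f p \<in> {1..<i}}. nsym C a (g * \<gamma> * ?w (f p))) +
       (\<Sum>p\<in>fiber k f i - {b}. nsym C a (g * \<gamma> * ?w (f p)))"
      unfolding split by (rule sum.union_disjoint) (auto simp: fiber_def)
    also have "(\<Sum>p\<in>{p\<in>K - {b}. f p \<in> {1..<i}}. nsym C a (g * \<gamma> * ?w (f p))) =
       (\<Sum>c\<in>K - {b}. if f c \<in> {1..<i} then nsym C a (g * \<gamma> * ?w (f c)) else 0)"
      by (rule sum.inter_filter) simp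
    also have "\<dots> = (\<Sum>c\<in>K - {b}. \<Sum>j\<in>{1..<i}. if snd s c = j then term_y \<omega> b s (?w j) else 0)"
      by (intro sum.cong refl) (simp add: t[unfolded s] s)
    also have "(\<Sum>p\<in>fiber k f i - {b}. nsym C a (g * \<gamma> * ?w (f p))) =
       (\<Sum>p\<in>fiber k f i - {b}. nsym C a (g * \<gamma> * ?w i))"
      by (rule sum.cong) (auto simp: fiber_def)
    also have "\<dots> = psdo_scal (of_nat (r f) - 1) * nsym C a (g * \<gamma> * ?w i)"
    proof -
      have "card (fiber k f i - {b}) = r f - 1"
        using assms S by (simp add: fiber_def)
      \<comment> \<open>The subtraction in \<open>r f - 1\<close> is not truncated, because
        \<open>b\<close> itself lies in the fiber.\<close>
      then have "of_nat (card (fiber k f i - {b})) = (of_nat (r f) - 1 :: complex)"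
        using r_ge_1[of b f] assms S by simp
      moreover have "psdo_scal (of_nat l) = (of_nat l :: ('m, 'n, 'k) weyl psdo)" for l
        using psdo_scal_of_int[of "int l", where 'a='m and 'b='n and 'c='k] by simp
      ultimately show ?thesis by (metis sum_constant)
    qed
    finally have split_sum: "(\<Sum>p\<in>{p\<in>K - {b}. f p \<noteq> 0}. nsym C a (g * \<gamma> * ?w (f p))) =
       (\<Sum>c\<in>K - {b}. \<Sum>j\<in>{1..<i}. if snd s c = j then term_y \<omega> b s (?w j) else 0) +
       psdo_scal (of_nat (r f) - 1) * nsym C a (g * \<gamma> * ?w i)" .
    have "v_deriv g * \<gamma> = - (\<Sum>p\<in>{p\<in>K - {b}. f p \<noteq> 0}. g * \<gamma> * ?w (f p))"
      unfolding g_def v_deriv_gpart[OF finite_Diff[OF finite_atLeastAtMost]] minus_mult_left[symmetric] sum_distrib_right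
      by (simp only: mult_ac)
    then have 1: "nsym C a (v_deriv g * \<gamma>) =
       - (\<Sum>c\<in>K - {b}. \<Sum>j\<in>{1..<i}. if snd s c = j then term_y \<omega> b s (?w j) else 0)
       - psdo_scal (of_nat (r f) - 1) * nsym C a (g * \<gamma> * ?w i)"
      by (simp only: nsym_uminus3 nsym_sum3 split_sum) simp
    have "g * v_deriv \<gamma> = (\<Sum>j\<in>{1..i}. fls_const (e j) * (g * \<gamma> * ?w j))"
      unfolding v_deriv_\<gamma> sum_distrib_left by (simp only: mult_ac)
    then have "nsym C a (g * v_deriv \<gamma>) = (\<Sum>j\<in>{1..i}. psdo_scal (e j) * nsym C a (g * \<gamma> * ?w j))"
      by (simp only: nsym_sum3 nsym_scal3 nsym_scal)
    also have "{1..i} = insert i {1..<i}" using i by auto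
    also have "(\<Sum>j\<in>insert i {1..<i}. psdo_scal (e j) * nsym C a (g * \<gamma> * ?w j)) =
       (\<Sum>j\<in>{1..<i}. psdo_scal (e j) * nsym C a (g * \<gamma> * ?w j)) + psdo_scal (e i) * nsym C a (g * \<gamma> * ?w i)"
      by (simp add: add.commute)
    also have "(\<Sum>j\<in>{1..<i}. psdo_scal (e j) * nsym C a (g * \<gamma> * ?w j)) =
       (\<Sum>j\<in>{1..<i}. psdo_scal ((-1) ^ par m j) * term_y \<omega> b s (?w j))"
      by (intro sum.cong refl) (simp add: t e)
    finally have 2: "nsym C a (g * v_deriv \<gamma>) = (\<Sum>j\<in>{1..<i}. psdo_scal ((-1) ^ par m j) * term_y \<omega> b s (?w j))
       + psdo_scal (e i) * nsym C a (g * \<gamma> * ?w i)" .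
    have 3: "term_y (\<lambda>r. \<omega> r * (e i - (of_nat r - 1))) b s (?w i) =
      psdo_scal (e i) * nsym C a (g * \<gamma> * ?w i) - psdo_scal (of_nat (r f) - 1) * nsym C a (g * \<gamma> * ?w i)"
    proof -
      have "term_y (\<lambda>r. \<omega> r * (e i - (of_nat r - 1))) b s (?w i) =
          psdo_scal (e i - (of_nat (r f) - 1)) * nsym C a (g * \<gamma> * ?w i)"
        by (simp add: term_y_def s C_def a_def g_def h_def mult.assoc nsym_scal fls_const_signed mult.commute)
      also have "psdo_scal (e i - (of_nat (r f) - 1)) = (psdo_scal (e i) + - psdo_scal (of_nat (r f) - 1) :: ('m, 'n, 'k) weyl psdo)"
        by (simp only: psdo_scal_add[symmetric] psdo_scal_uminus[symmetric]) (simp add: algebra_simps)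
      finally show ?thesis by (simp add: left_diff_distrib)
    qed
    have "y_entry b s * (psdo_v - psdo_scal (z b)) =
      nsym (C * (fls_X_inv - fls_const (z b))) a (g * \<gamma>) + nsym C a (v_deriv (g * \<gamma>))"
      by (simp add: y_entry_def s nsym_mult_v_diff C_def a_def g_def h_def)
    also have "nsym C a (v_deriv (g * \<gamma>)) = nsym C a (v_deriv g * \<gamma>) + nsym C a (g * v_deriv \<gamma>)"
      by (simp add: v_deriv_mult nsym_add3)
    finally show ?thesis unfolding 1 2 3 rp by (simp add: algebra_simps)
  qed
  have "(\<Sum>s\<in>?Sb. \<Sum>c\<in>K - {b}. \<Sum>j\<in>{1..<i}. if snd s c = j then term_y \<omega> b s (?w j) else 0) =
    (\<Sum>c\<in>K - {b}. \<Sum>j\<in>{1..<i}. \<Sum>s\<in>?Sb. if snd s c = j then term_y \<omega> b s (?w j) else 0)"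
    by (subst sum.swap, rule sum.cong[OF refl], rule sum.swap)
  also have "\<dots> = (\<Sum>c\<in>K - {b}. \<Sum>j\<in>{1..<i}. \<Sum>s\<in>{s\<in>S. snd s b = i \<and> snd s c = j}. term_y \<omega> b s (dv_res \<Lambda> j))"
  proof (rule sum.cong[OF refl], rule sum.cong[OF refl])
    fix c j
    have "{s\<in>S. snd s b = i \<and> snd s c = j} = {s\<in>?Sb. snd s c = j}" by auto
    then show "(\<Sum>s\<in>?Sb. if snd s c = j then term_y \<omega> b s (?w j) else 0) =
        (\<Sum>s\<in>{s\<in>S. snd s b = i \<and> snd s c = j}. term_y \<omega> b s (?w j))"
      by (simp only: sum.inter_filter finS)
  qed
  finally have 4: "(\<Sum>s\<in>?Sb. \<Sum>c\<in>K - {b}. \<Sum>j\<in>{1..<i}. if snd s c = j then term_y \<omega> b s (?w j) else 0) =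
    (\<Sum>c\<in>K - {b}. \<Sum>j\<in>{1..<i}. \<Sum>s\<in>{s\<in>S. snd s b = i \<and> snd s c = j}. term_y \<omega> b s (dv_res \<Lambda> j))" .
  have "y_left b * (psdo_v - psdo_scal (z b)) = (\<Sum>s\<in>?Sb. y_entry b s * (psdo_v - psdo_scal (z b)))"
    by (simp add: y_left_def sum_distrib_right)
  also have "\<dots> = (\<Sum>s\<in>?Sb. replaced b (fst s, (snd s)(b := 0), b)
      - (\<Sum>c\<in>K - {b}. \<Sum>j\<in>{1..<i}. if snd s c = j then term_y \<omega> b s (?w j) else 0)
      + (\<Sum>j\<in>{1..<i}. psdo_scal ((-1) ^ par m j) * term_y \<omega> b s (?w j))
      + term_y (\<lambda>r. \<omega> r * (e i - (of_nat r - 1))) b s (?w i))"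
    by (rule sum.cong[OF refl]) (rule entry)
  also have "(\<Sum>s\<in>?Sb. \<Sum>j\<in>{1..<i}. psdo_scal ((-1) ^ par m j) * term_y \<omega> b s (?w j)) =
    (\<Sum>j\<in>{1..<i}. \<Sum>s\<in>?Sb. psdo_scal ((-1) ^ par m j) * term_y \<omega> b s (?w j))"
    by (rule sum.swap)
  then have "(\<Sum>s\<in>?Sb. replaced b (fst s, (snd s)(b := 0), b)
      - (\<Sum>c\<in>K - {b}. \<Sum>j\<in>{1..<i}. if snd s c = j then term_y \<omega> b s (?w j) else 0)
      + (\<Sum>j\<in>{1..<i}. psdo_scal ((-1) ^ par m j) * term_y \<omega> b s (?w j))
      + term_y (\<lambda>r. \<omega> r * (e i - (of_nat r - 1))) b s (?w i)) =
    (\<Sum>s\<in>?Sb. replaced b (fst s, (snd s)(b := 0), b))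
    - (\<Sum>c\<in>K - {b}. \<Sum>j\<in>{1..<i}. \<Sum>s\<in>{s\<in>S. snd s b = i \<and> snd s c = j}. term_y \<omega> b s (dv_res \<Lambda> j))
    + (\<Sum>j\<in>{1..<i}. \<Sum>s\<in>?Sb. psdo_scal ((-1) ^ par m j) * term_y \<omega> b s (dv_res \<Lambda> j))
    + (\<Sum>s\<in>?Sb. term_y (\<lambda>r. \<omega> r * (e i - (of_nat r - 1))) b s (dv_res \<Lambda> i))"
    by (simp only: sum.distrib sum_subtractf 4)
  finally show ?thesis .
qed

text \<open>The sign of the matrix entry (-1)^(par j) x_{j,b} is used up when x_{j,b} passes
  \<partial>_{j,c}; what follows is the signless passage of \<open>nord_mult_x\<close>. The two
  extra terms are the contractions with a derivative inside \<open>nord\<close> and with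
  \<partial>_{j,c} itself.\<close>

lemma nord_contract:
  assumes "j \<in> {1..m + n}" "b \<in> K" "finite A" "\<And>p. p \<in> A \<Longrightarrow> f p \<le> m + n"
  shows "nrd A \<sigma> f * D j c * ((-1) ^ par m j * X j b) = X j b * nrd A \<sigma> f * D j c +
    (if b \<in> A \<and> f b = j then X j (\<sigma> b) * nrd (A - {b}) \<sigma> f * D j c else 0) +
    (if c = b then (-1) ^ par m j * nrd A \<sigma> f else 0)"
proof -
  have Dx: "D j c * ((-1) ^ par m j * X j b) = X j b * D j c + (if c = b then (-1) ^ par m j else 0)"
    using weyl_d_x[of j b c j, where 'm='m and 'n='n and 'k='k] assms par_cases[of m j]
    by (auto simp: m n k)
  have sg: "nrd A \<sigma> f * (-1) ^ par m j = (-1) ^ par m j * nrd A \<sigma> f"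
    using par_cases[of m j] by auto
  have "nrd A \<sigma> f * D j c * ((-1) ^ par m j * X j b) =
      (nrd A \<sigma> f * X j b) * D j c + (if c = b then (-1) ^ par m j * nrd A \<sigma> f else 0)"
    unfolding mult.assoc[of "nrd A \<sigma> f" "D j c"] Dx distrib_left using sg by (auto simp: mult.assoc)
  also have "nrd A \<sigma> f * X j b = X j b * nrd A \<sigma> f +
    (if b \<in> A \<and> f b = j then X j (\<sigma> b) * nrd (A - {b}) \<sigma> f else 0)"
    by (rule nord_mult_x) (use assms in \<open>auto simp: m n k\<close>)
  finally show ?thesis by (auto simp: distrib_right)
qed

text \<open>\<open>y_mid\<close> brings \<partial>_{j,c} and a resolvent into the open position
  \<open>c\<close>. Then x_{j,b} either completes this pair, so that \<open>c\<close> carries the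
  index \<open>j\<close>, or contracts with the \<partial>_{j,b} at position \<open>b\<close>, or,
  when \<open>c = b\<close>, contracts with the new derivative. The last case is the one that the
  derivative of \<gamma> in \<open>x_column_left\<close> compensates.\<close>

lemma x_column_mid:
  assumes "b \<in> K" "j \<in> {1..<i}"
  shows "y_mid j * ((-1) ^ par m j * psdo_of (X j b)) =
    (\<Sum>c\<in>K. \<Sum>s\<in>{s\<in>S. snd s c = i}. replaced b (fst s, (snd s)(c := j), c))
    + (\<Sum>c\<in>K - {b}. \<Sum>s\<in>{s\<in>S. snd s c = i \<and> snd s b = j}. contraction b c j s)
    - (\<Sum>s\<in>{s\<in>S. snd s b = i}. psdo_scal ((-1) ^ par m j) * term_y \<omega> b s (dv_res \<Lambda> j))"
proof -
  let ?x = "(-1) ^ par m j * psdo_of (X j b)"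
  let ?T = "\<lambda>s. psdo_scal ((-1) ^ par m j) * term_y \<omega> b s (dv_res \<Lambda> j)"
  have entry: "- (y_entry c s * psdo_of (D j c) * dv_series (dv_res \<Lambda> j) * ?x) =
      replaced b (fst s, (snd s)(c := j), c) + (if c \<noteq> b \<and> snd s b = j then contraction b c j s else 0)
      - (if c = b then ?T s else 0)"
    if "c \<in> K" "s \<in> S" "snd s c = i" for c s
  proof -
    obtain \<sigma> f where s: "s = (\<sigma>, f)" by (cases s)
    have S: "(\<sigma>, f) \<in> S" "f c = i" using that by (auto simp: s)
    define h where "h = hpart z (K - {c}) f"
    define N where "N = nrd (K - {c}) \<sigma> f"
    define g where "g = gpart \<Lambda> (K - {c}) f * (\<gamma> * dv_res \<Lambda> j)"
    define C where "C = signed \<sigma> (\<omega> (r f)) h"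
    let ?N2 = "if b \<in> K - {c} \<and> f b = j then X j (\<sigma> b) * nrd (K - {c} - {b}) \<sigma> f * D j c else 0"
    let ?N3 = "if c = b then (-1) ^ par m j * N else 0"
    have x: "?x = psdo_of ((-1) ^ par m j * X j b)" by (simp add: psdo_of_mult psdo_of_sign)
    have "y_entry c s * psdo_of (D j c) * dv_series (dv_res \<Lambda> j) * ?x =
      nsym C (X i (\<sigma> c) * (N * D j c * ((-1) ^ par m j * X j b))) g"
      unfolding x by (simp add: y_entry_def s nsym_mult_of nsym_mult_dv C_def h_def N_def g_def mult.assoc)
    also have "N * D j c * ((-1) ^ par m j * X j b) = X j b * N * D j c + ?N2 + ?N3"
      unfolding N_def by (rule nord_contract) (use assms i SD(5)[OF S(1)] in auto)
    finally have e: "y_entry c s * psdo_of (D j c) * dv_series (dv_res \<Lambda> j) * ?x =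
      nsym C (X i (\<sigma> c) * (X j b * N * D j c)) g + nsym C (X i (\<sigma> c) * ?N2) g + nsym C (X i (\<sigma> c) * ?N3) g"
      by (simp only: distrib_left nsym_add2)
    have "replaced b (fst s, (snd s)(c := j), c) = - nsym C (X i (\<sigma> c) * (X j b * N * D j c)) g"
    proof -
      let ?f = "f(c := j)"
      have "hpart z K ?f = - h"
        using hpart_remove[of K c z ?f] hpart_cong[of "K - {c}" ?f f z] that assms by (simp add: h_def)
      moreover have "gpart \<Lambda> K ?f * \<gamma> = g"
        using gpart_remove[of K c \<Lambda> ?f] gpart_cong[of "K - {c}" ?f f \<Lambda>] that assms by (simp add: g_def mult_ac)
      moreover have "nrd K (\<sigma>(c := b)) ?f = X j b * N * D j c"
        using nord_remove[of K c "\<sigma>(c := b)" ?f, where 'a='m and 'b='n and 'c='k]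
          nord_cong[of "K - {c}" ?f f "\<sigma>(c := b)" \<sigma>, where 'a='m and 'b='n and 'c='k] that assms
        by (simp add: N_def)
      moreover have "r ?f + 1 = r f" using r_update[of c f j] that assms S by auto
      ultimately show ?thesis by (simp add: replaced_def s C_def signed_uminus nsym_uminus1)
    qed
    moreover have "(if c \<noteq> b \<and> snd s b = j then contraction b c j s else 0) = - nsym C (X i (\<sigma> c) * ?N2) g"
    proof (cases "c \<noteq> b \<and> f b = j")
      case True
      then have "b \<in> K - {c}" using assms by auto
      then have "h = - hpart z (K - {c} - {b}) f"
        "gpart \<Lambda> (K - {c}) f = dv_res \<Lambda> j * gpart \<Lambda> (K - {c} - {b}) f"
        unfolding h_def using True assms
        by (subst hpart_remove[of _ b] gpart_remove[of _ b]; simp)+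
      then show ?thesis using True \<open>b \<in> K - {c}\<close>
        by (simp add: contraction_def s C_def g_def signed_uminus nsym_uminus1 mult_ac)
    qed (auto simp: s)
    moreover have "(if c = b then ?T s else 0) = nsym C (X i (\<sigma> c) * ?N3) g"
    proof (cases "c = b")
      case True
      have "X i (\<sigma> b) * ((-1) ^ par m j * N) = (-1) ^ par m j * (X i (\<sigma> b) * N)"
        using par_cases[of m j] by auto
      then show ?thesis using True par_cases[of m j]
        by (auto simp: term_y_def s C_def g_def h_def N_def nsym_sign2 nsym_uminus1 psdo_scal_uminus)
    qed simp
    ultimately show ?thesis unfolding e by simp
  qed
  have "y_mid j * ?x = (\<Sum>c\<in>K. - (y_left c * psdo_of (D j c) * dv_series (dv_res \<Lambda> j) * ?x))"
    by (simp add: y_mid_def sum_distrib_right sum_negf)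
  also have "\<dots> = (\<Sum>c\<in>K. \<Sum>s\<in>{s\<in>S. snd s c = i}. - (y_entry c s * psdo_of (D j c) * dv_series (dv_res \<Lambda> j) * ?x))"
    by (simp add: y_left_def sum_distrib_right sum_negf)
  also have "\<dots> = (\<Sum>c\<in>K. \<Sum>s\<in>{s\<in>S. snd s c = i}. replaced b (fst s, (snd s)(c := j), c)
      + (if c \<noteq> b \<and> snd s b = j then contraction b c j s else 0) - (if c = b then ?T s else 0))"
    by (intro sum.cong refl entry) auto
  also have "\<dots> = (\<Sum>c\<in>K. \<Sum>s\<in>{s\<in>S. snd s c = i}. replaced b (fst s, (snd s)(c := j), c))
     + (\<Sum>c\<in>K. \<Sum>s\<in>{s\<in>S. snd s c = i}. if c \<noteq> b \<and> snd s b = j then contraction b c j s else 0)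
     - (\<Sum>c\<in>K. \<Sum>s\<in>{s\<in>S. snd s c = i}. if c = b then ?T s else 0)"
    by (simp only: sum.distrib sum_subtractf)
  also have "(\<Sum>c\<in>K. \<Sum>s\<in>{s\<in>S. snd s c = i}. if c = b then ?T s else 0) =
     (\<Sum>c\<in>K. if c = b then \<Sum>s\<in>{s\<in>S. snd s c = i}. ?T s else 0)"
    by (intro sum.cong refl) auto
  also have "\<dots> = (\<Sum>s\<in>{s\<in>S. snd s b = i}. ?T s)"
    using assms by (subst sum.delta) auto
  also have "(\<Sum>c\<in>K. \<Sum>s\<in>{s\<in>S. snd s c = i}. if c \<noteq> b \<and> snd s b = j then contraction b c j s else 0) =
     (\<Sum>c\<in>K. if c \<noteq> b then \<Sum>s\<in>{s\<in>S. snd s c = i}. if snd s b = j then contraction b c j s else 0 else 0)"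
    by (intro sum.cong refl) auto
  also have "\<dots> = (\<Sum>c\<in>{c\<in>K. c \<noteq> b}. \<Sum>s\<in>{s\<in>S. snd s c = i}. if snd s b = j then contraction b c j s else 0)"
    by (rule sum.inter_filter[symmetric]) simp
  also have "\<dots> = (\<Sum>c\<in>K - {b}. \<Sum>s\<in>{s\<in>S. snd s c = i \<and> snd s b = j}. contraction b c j s)"
  proof (rule sum.cong)
    fix c
    have "{s\<in>S. snd s c = i \<and> snd s b = j} = {s\<in>{s\<in>S. snd s c = i}. snd s b = j}" by auto
    then show "(\<Sum>s\<in>{s\<in>S. snd s c = i}. if snd s b = j then contraction b c j s else 0) =
        (\<Sum>s\<in>{s\<in>S. snd s c = i \<and> snd s b = j}. contraction b c j s)"
      by (simp only: sum.inter_filter finS)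
  qed auto
  finally show ?thesis .
qed

text \<open>A contraction reopens position \<open>b\<close> but leaves its resolvent behind. Through
  \<open>weight_v\<close> these terms match the index-\<open>i\<close> part of
  \<open>x_column_left\<close>.\<close>

lemma x_column_last:
  assumes "b \<in> K"
  shows "y_last * ((-1) ^ par m i * psdo_of (X i b)) =
    (\<Sum>s\<in>S. bordered (\<lambda>r. (-1) ^ par m i * u r) b s)
    - (\<Sum>s\<in>{s\<in>S. snd s b = i}. term_y (\<lambda>r. (-1) ^ par m i * u r) b s (dv_res \<Lambda> i))"
proof -
  let ?u = "\<lambda>r. (-1) ^ par m i * u r"
  have entry: "(case s of (\<sigma>, f) \<Rightarrow> nsym (signed \<sigma> (u (r f)) (hpart z K f)) (nrd K \<sigma> f) (gpart \<Lambda> K f * \<gamma>)) *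
      ((-1) ^ par m i * psdo_of (X i b)) =
      bordered ?u b s + (if snd s b = i then - term_y ?u b s (dv_res \<Lambda> i) else 0)" if "s \<in> S" for s
  proof -
    obtain \<sigma> f where s: "s = (\<sigma>, f)" by (cases s)
    have S: "(\<sigma>, f) \<in> S" using that by (auto simp: s)
    have sc: "(-1) ^ par m i = (psdo_scal ((-1) ^ par m i) :: ('m, 'n, 'k) weyl psdo)"
      using par_cases[of m i] by (auto simp: psdo_scal_uminus)
    have "nrd K \<sigma> f * X i b = X i b * nrd K \<sigma> f + (if b \<in> K \<and> f b = i then X i (\<sigma> b) * nrd (K - {b}) \<sigma> f else 0)"
      by (rule nord_mult_x) (use assms i SD(5)[OF S] in \<open>auto simp: m n k\<close>)
    then have nx: "nrd K \<sigma> f * X i b = X i b * nrd K \<sigma> f + (if f b = i then X i (\<sigma> b) * nrd (K - {b}) \<sigma> f else 0)"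
      using assms by simp
    have "nsym (signed \<sigma> (u (r f)) (hpart z K f)) (nrd K \<sigma> f) (gpart \<Lambda> K f * \<gamma>) * ((-1) ^ par m i * psdo_of (X i b)) =
      nsym (signed \<sigma> (?u (r f)) (hpart z K f)) (nrd K \<sigma> f * X i b) (gpart \<Lambda> K f * \<gamma>)"
      unfolding sc mult.assoc[symmetric] psdo_scal_commute[symmetric] nsym_scal fls_const_signed nsym_mult_of ..
    also have "\<dots> = bordered ?u b s + (if f b = i then
        nsym (signed \<sigma> (?u (r f)) (hpart z K f)) (X i (\<sigma> b) * nrd (K - {b}) \<sigma> f) (gpart \<Lambda> K f * \<gamma>) else 0)"
      unfolding nx nsym_add2 by (simp add: bordered_def s)
    also have "nsym (signed \<sigma> (?u (r f)) (hpart z K f)) (X i (\<sigma> b) * nrd (K - {b}) \<sigma> f) (gpart \<Lambda> K f * \<gamma>) =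
      - term_y ?u b s (dv_res \<Lambda> i)" if "f b = i"
    proof -
      have h: "hpart z K f = - hpart z (K - {b}) f"
        using that assms i hpart_remove[of K b z f] by simp
      have "gpart \<Lambda> K f = dv_res \<Lambda> i * gpart \<Lambda> (K - {b}) f"
        using that assms i gpart_remove[of K b \<Lambda> f] by simp
      then have g: "gpart \<Lambda> K f * \<gamma> = gpart \<Lambda> (K - {b}) f * (\<gamma> * dv_res \<Lambda> i)"
        by (simp only: mult_ac)
      show ?thesis unfolding g h signed_uminus nsym_uminus1 by (simp add: term_y_def s)
    qed
    then have "(if f b = i then
        nsym (signed \<sigma> (?u (r f)) (hpart z K f)) (X i (\<sigma> b) * nrd (K - {b}) \<sigma> f) (gpart \<Lambda> K f * \<gamma>) else 0) =
      (if snd s b = i then - term_y ?u b s (dv_res \<Lambda> i) else 0)" by (simp add: s)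
    finally show ?thesis by (simp add: s)
  qed
  have "y_last * ((-1) ^ par m i * psdo_of (X i b)) =
    (\<Sum>s\<in>S. bordered ?u b s + (if snd s b = i then - term_y ?u b s (dv_res \<Lambda> i) else 0))"
    unfolding y_last_def sum_distrib_right by (rule sum.cong[OF refl]) (rule entry)
  also have "\<dots> = (\<Sum>s\<in>S. bordered ?u b s) + (\<Sum>s\<in>{s\<in>S. snd s b = i}. - term_y ?u b s (dv_res \<Lambda> i))"
    by (simp only: sum.distrib sum.inter_filter finS)
  finally show ?thesis by (simp add: sum_negf)
qed

text \<open>
  The derivative of the resolvents of an earlier index cancels against the contraction of
  \<open>x\<^bsub>j, b\<^esub>\<close> with the \<open>\<partial>\<^bsub>j, b\<^esub>\<close> inside \<open>nord\<close>: exchanging the two columns flips the sign.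
\<close>

lemma contraction_cancel:
  assumes "b \<in> K" "c \<in> K" "b \<noteq> c" "j \<in> {1..<i}"
  shows "(\<Sum>s\<in>{s\<in>S. snd s b = i \<and> snd s c = j}. term_y \<omega> b s (dv_res \<Lambda> j)) =
    (\<Sum>s\<in>{s\<in>S. snd s c = i \<and> snd s b = j}. contraction b c j s)"
proof -
  define t where "t = transpose b c"
  define T where "T = (\<lambda>(\<sigma>, f). (\<sigma> \<circ> t, f \<circ> t) :: (nat \<Rightarrow> nat) \<times> (nat \<Rightarrow> nat))"
  have TT: "T (T s) = s" for s
    by (cases s) (simp add: t_def T_def comp_assoc)
  have tK: "t p \<in> K \<longleftrightarrow> p \<in> K" for p using assms by (auto simp: t_def transpose_def)
  have TS: "T s \<in> S" if nz: "s \<in> S" "snd s b \<noteq> 0" "snd s c \<noteq> 0" for s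
  proof -
    obtain \<sigma> f where s: "s = (\<sigma>, f)" by (cases s)
    have S: "(\<sigma>, f) \<in> S" using nz s by simp
    have "(\<sigma> \<circ> t) permutes K"
      using SD(1)[OF S] assms unfolding t_def by (intro permutes_compose permutes_swap_id) auto
    moreover have "f \<circ> t \<in> K \<rightarrow>\<^sub>E {0..i}"
      using SD(2)[OF S] tK by (auto simp: PiE_def Pi_def extensional_def)
    moreover have "\<sigma> (t p) = p" if "p \<in> K" "f (t p) = 0" for p
    proof -
      have "p \<noteq> b" "p \<noteq> c" using that nz by (auto simp: s t_def)
      then show ?thesis using that SD(3)[OF S] by (simp add: t_def transpose_def)
    qed
    ultimately show ?thesis by (simp add: s T_def leibniz_def)
  qed
  have val: "term_y \<omega> b (T s) (dv_res \<Lambda> j) = contraction b c j s"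
    if "s \<in> S" "snd s c = i" "snd s b = j" for s
  proof -
    obtain \<sigma> f where s: "s = (\<sigma>, f)" by (cases s)
    have S: "(\<sigma>, f) \<in> S" "f c = i" "f b = j" using that s by simp_all
    let ?\<sigma> = "\<sigma> \<circ> t" and ?f = "f \<circ> t"
    have f: "?f c = j" "?\<sigma> b = \<sigma> c" "?\<sigma> c = \<sigma> b" "j \<noteq> 0" "c \<in> K - {b}"
      using S assms by (auto simp: t_def)
    have c: "?\<sigma> p = \<sigma> p" "?f p = f p" if "p \<in> K - {b} - {c}" for p
      using that by (auto simp: t_def transpose_def)
    have sets: "K - {b} - {c} = K - {c} - {b}" by auto
    \<comment> \<open>Position \<open>c\<close> still carries an index and contributes -1 here; this
      offsets the sign of the transposition recorded in \<open>cs\<close>.\<close>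
    have h: "hpart z (K - {b}) ?f = - hpart z (K - {c} - {b}) f"
      using hpart_remove[of "K - {b}" c z ?f] f hpart_cong[of "K - {b} - {c}" ?f f z, OF c(2)] sets by simp
    have g: "gpart \<Lambda> (K - {b}) ?f = gpart \<Lambda> (K - {c} - {b}) f * dv_res \<Lambda> j"
      using gpart_remove[of "K - {b}" c \<Lambda> ?f] f gpart_cong[of "K - {b} - {c}" ?f f \<Lambda>, OF c(2)] sets by (simp add: mult.commute)
    have n: "nrd (K - {b}) ?\<sigma> ?f = X j (\<sigma> b) * nrd (K - {c} - {b}) \<sigma> f * D j c"
      using nord_remove[of "K - {b}" c ?\<sigma> ?f, where 'a='m and 'b='n and 'c='k] f sets
        nord_cong[of "K - {b} - {c}" ?f f ?\<sigma> \<sigma>, where 'a='m and 'b='n and 'c='k] c by simp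
    have r: "r ?f = r f" unfolding t_def by (rule fiber_transpose) (use assms in auto)
    have cs: "signed ?\<sigma> a x = - signed \<sigma> a x" for a x
      unfolding t_def by (rule signed_swap) (use SD(1)[OF S(1)] assms in auto)
    show ?thesis unfolding s T_def prod.case term_y_def contraction_def h g n r cs f(2) signed_uminus
      by (simp add: mult.assoc)
  qed
  show ?thesis
  proof (rule sum.reindex_bij_witness[where i = T and j = T])
    fix a assume a: "a \<in> {s\<in>S. snd s b = i \<and> snd s c = j}"
    show "T (T a) = a" by (rule TT)
    show Ta: "T a \<in> {s\<in>S. snd s c = i \<and> snd s b = j}"
      using a TS[of a] i assms by (cases a) (auto simp: T_def t_def)
    show "contraction b c j (T a) = term_y \<omega> b a (dv_res \<Lambda> j)"
      using val[of "T a"] Ta by (simp add: TT)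
  next
    fix a assume a: "a \<in> {s\<in>S. snd s c = i \<and> snd s b = j}"
    show "T (T a) = a" by (rule TT)
    show "T a \<in> {s\<in>S. snd s b = i \<and> snd s c = j}"
      using a TS[of a] i assms by (cases a) (auto simp: T_def t_def)
  qed
qed

text \<open>
  A triple \<open>(\<sigma>, f, c)\<close> stands for the Leibniz term in which \<open>\<sigma> c\<close> has been replaced by \<open>b\<close>. So \<open>b\<close> is hit
  twice unless \<open>\<sigma> c = b\<close>, and the double hits cancel as in the expansion of a determinant with two
  equal columns, except when the other preimage of \<open>b\<close> carries the index \<open>i\<close> itself.
\<close>

definition triples :: "nat \<Rightarrow> ((nat \<Rightarrow> nat) \<times> (nat \<Rightarrow> nat) \<times> nat) set" where
  "triples b = {(\<sigma>, f, c). \<sigma> permutes K \<and> f \<in> K \<rightarrow>\<^sub>E {0..i} \<and> c \<in> K \<and> f c < i \<and> (f c = 0 \<longrightarrow> c = b) \<and>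
     (\<forall>p\<in>K - {c}. f p = 0 \<longrightarrow> \<sigma> p = p)}"

lemma finite_triples: "finite (triples b)"
proof (rule finite_subset)
  show "triples b \<subseteq> {\<sigma>. \<sigma> permutes K} \<times> (K \<rightarrow>\<^sub>E {0..i}) \<times> K"
    by (auto simp: triples_def)
qed (intro finite_cartesian_product finite_permutations finite_PiE; simp)

text \<open>A triple with \<open>f c = 0\<close> comes from the entry v - z_b, which forces
  \<open>c = b\<close>; one with \<open>f c = j > 0\<close> comes from the row of index
  \<open>j\<close>. Resetting \<open>f c\<close> to \<open>i\<close> recovers the opened Leibniz
  pair.\<close>

lemma replaced_sum:
  assumes b: "b \<in> K"
  shows "(\<Sum>s\<in>{s\<in>S. snd s b = i}. replaced b (fst s, (snd s)(b := 0), b))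
    + (\<Sum>j\<in>{1..<i}. \<Sum>c\<in>K. \<Sum>s\<in>{s\<in>S. snd s c = i}. replaced b (fst s, (snd s)(c := j), c))
    = (\<Sum>x\<in>triples b. replaced b x)"
proof -
  define R0 where "R0 = {0::nat} \<times> {b} \<times> {s\<in>S. snd s b = i}"
  define R1 where "R1 = Sigma {1..<i} (\<lambda>j. Sigma K (\<lambda>c. {s\<in>S. snd s c = i}))"
  define fw where "fw = (\<lambda>(j::nat, c::nat, s::(nat \<Rightarrow> nat) \<times> (nat \<Rightarrow> nat)). (fst s, (snd s)(c := j), c))"
  define bw where "bw = (\<lambda>(\<sigma>::nat \<Rightarrow> nat, f::nat \<Rightarrow> nat, c::nat). (f c, c, (\<sigma>, f(c := i))))"
  have fin: "finite R0" "finite R1" by (auto simp: R0_def R1_def)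
  have "(\<Sum>x\<in>triples b. replaced b x) = (\<Sum>y\<in>R0 \<union> R1. replaced b (fw y))"
  proof (rule sum.reindex_bij_witness[where i = fw and j = bw])
    fix x assume x: "x \<in> triples b"
    obtain \<sigma> f c where xe: "x = (\<sigma>, f, c)" by (cases x)
    have f: "\<sigma> permutes K" "f \<in> K \<rightarrow>\<^sub>E {0..i}" "c \<in> K" "f c < i" "f c = 0 \<longrightarrow> c = b"
      "\<And>p. p \<in> K - {c} \<Longrightarrow> f p = 0 \<Longrightarrow> \<sigma> p = p"
      using x by (auto simp: xe triples_def)
    show tb: "fw (bw x) = x" by (simp add: xe fw_def bw_def)
    have "f(c := i) \<in> K \<rightarrow>\<^sub>E {0..i}" using f(2,3) by (auto simp: PiE_def Pi_def extensional_def)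
    moreover have "\<sigma> p = p" if "p \<in> K" "(f(c := i)) p = 0" for p
      using that f(6)[of p] i by (cases "p = c") auto
    ultimately have "(\<sigma>, f(c := i)) \<in> S" using f(1) by (simp add: leibniz_def)
    then show "bw x \<in> R0 \<union> R1" using f(3-5) by (auto simp: xe bw_def R0_def R1_def)
    show "replaced b (fw (bw x)) = replaced b x" by (simp only: tb)
  next
    fix y assume "y \<in> R0 \<union> R1"
    then obtain j c \<sigma> f where y: "y = (j, c, (\<sigma>, f))" and c: "c \<in> K" and j: "j < i" "j = 0 \<longrightarrow> c = b"
      and S: "(\<sigma>, f) \<in> S" and fc: "f c = i"
      using b i by (fastforce simp: R0_def R1_def)
    show "bw (fw y) = y" using fc by (auto simp: y fw_def bw_def)
    have "f(c := j) \<in> K \<rightarrow>\<^sub>E {0..i}" using SD(2)[OF S] c j by (auto simp: PiE_def Pi_def extensional_def)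
    then show "fw y \<in> triples b"
      using SD(1,3)[OF S] c j by (simp add: y fw_def triples_def)
  qed
  also have "\<dots> = (\<Sum>y\<in>R0. replaced b (fw y)) + (\<Sum>y\<in>R1. replaced b (fw y))"
    by (rule sum.union_disjoint) (use fin in \<open>auto simp: R0_def R1_def\<close>)
  also have "(\<Sum>y\<in>R1. replaced b (fw y)) =
      (\<Sum>j\<in>{1..<i}. \<Sum>c\<in>K. \<Sum>s\<in>{s\<in>S. snd s c = i}. replaced b (fst s, (snd s)(c := j), c))"
  proof -
    have "(\<Sum>j\<in>{1..<i}. \<Sum>c\<in>K. \<Sum>s\<in>{s\<in>S. snd s c = i}. replaced b (fst s, (snd s)(c := j), c)) =
      (\<Sum>j\<in>{1..<i}. \<Sum>(c, s)\<in>Sigma K (\<lambda>c. {s\<in>S. snd s c = i}). replaced b (fw (j, c, s)))"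
      by (rule sum.cong[OF refl], subst sum.Sigma) (auto simp: fw_def finite_leibniz)
    also have "\<dots> = (\<Sum>(j, c, s)\<in>R1. replaced b (fw (j, c, s)))"
      unfolding R1_def by (subst sum.Sigma) (auto simp: finite_leibniz intro!: finite_SigmaI)
    finally show ?thesis by (simp add: case_prod_beta')
  qed
  also have "(\<Sum>y\<in>R0. replaced b (fw y)) = (\<Sum>s\<in>{s\<in>S. snd s b = i}. replaced b (fst s, (snd s)(b := 0), b))"
    by (rule sum.reindex_bij_witness[where i = "\<lambda>s. (0, b, s)" and j = "\<lambda>(j, c, s). s"])
      (auto simp: R0_def fw_def)
  finally show ?thesis by (rule sym)
qed

lemma inv_perm:
  assumes "\<sigma> permutes K" "b \<in> K"
  shows "inv_into UNIV \<sigma> b \<in> K" "\<sigma> (inv_into UNIV \<sigma> b) = b" "\<And>c. \<sigma> c = b \<longleftrightarrow> c = inv_into UNIV \<sigma> b"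
proof -
  show "inv_into UNIV \<sigma> b \<in> K" using permutes_in_image[OF permutes_inv[OF assms(1)]] assms(2) by blast
  show "\<sigma> (inv_into UNIV \<sigma> b) = b" by (rule permutes_inverses(1)[OF assms(1)])
  then show "\<sigma> c = b \<longleftrightarrow> c = inv_into UNIV \<sigma> b" for c
    using permutes_inverses(2)[OF assms(1), of c] by auto
qed

text \<open>Let d be the preimage of \<open>b\<close> under \<sigma>. After the replacement both c
  and d are sent to \<open>b\<close>, and the triples for \<sigma>, c and for \<sigma> composed with
  the transposition of c and d, with d in place of c, describe the same product with opposite signs.
  The partner is again a triple since \<open>f\<close> is less than \<open>i\<close> at d.\<close>

lemma replaced_cancel:
  assumes b: "b \<in> K"
  shows "(\<Sum>x\<in>{(\<sigma>, f, c)\<in>triples b. \<sigma> c \<noteq> b \<and> f (inv_into UNIV \<sigma> b) \<noteq> i}. replaced b x) = 0"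
proof -
  define T where "T = (\<lambda>(\<sigma>::nat \<Rightarrow> nat, f::nat \<Rightarrow> nat, c::nat). (\<sigma> \<circ> transpose c (inv_into UNIV \<sigma> b), f, inv_into UNIV \<sigma> b))"
  show ?thesis
  proof (rule sum_cancel_involution[where t = T])
    fix x assume x: "x \<in> {(\<sigma>, f, c)\<in>triples b. \<sigma> c \<noteq> b \<and> f (inv_into UNIV \<sigma> b) \<noteq> i}"
    obtain \<sigma> f c where xe: "x = (\<sigma>, f, c)" by (cases x)
    define d where "d = inv_into UNIV \<sigma> b"
    define \<tau> where "\<tau> = \<sigma> \<circ> transpose c d"
    have f: "\<sigma> permutes K" "f \<in> K \<rightarrow>\<^sub>E {0..i}" "c \<in> K" "f c < i" "f c = 0 \<longrightarrow> c = b"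
      "\<And>p. p \<in> K - {c} \<Longrightarrow> f p = 0 \<Longrightarrow> \<sigma> p = p" "\<sigma> c \<noteq> b" "f d \<noteq> i"
      using x by (auto simp: xe triples_def d_def)
    have d: "d \<in> K" "\<sigma> d = b" "d \<noteq> c" using inv_perm[OF f(1) b] f(7) by (auto simp: d_def)
    have \<tau>: "\<tau> permutes K"
      unfolding \<tau>_def using f(1,3) d(1) by (intro permutes_compose permutes_swap_id) auto
    have \<tau>v: "\<tau> c = b" "\<tau> d = \<sigma> c" "\<And>p. p \<noteq> c \<Longrightarrow> p \<noteq> d \<Longrightarrow> \<tau> p = \<sigma> p"
      using d by (simp_all add: \<tau>_def transpose_def)
    have c: "inv_into UNIV \<tau> b = c" using inv_perm(3)[OF \<tau> b, of c] \<tau>v(1) by simp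
    have fd: "f d < i" using PiE_mem[OF f(2) d(1)] f(8) by auto
    have d0: "d = b" if "f d = 0" using f(6)[of d] d that by auto
    have T: "T x = (\<tau>, f, d)" by (simp add: T_def xe \<tau>_def d_def)
    have "\<tau> p = p" if p: "p \<in> K - {d}" "f p = 0" for p
    proof (cases "p = c")
      case True
      then show ?thesis using f(5) p(2) \<tau>v(1) by simp
    next
      case False
      then show ?thesis using f(6)[of p] p \<tau>v(3)[of p] by simp
    qed
    then have "(\<tau>, f, d) \<in> triples b"
      unfolding triples_def using \<tau> f(2) d(1) fd d0 by simp
    then have "T x \<in> {(\<sigma>, f, c)\<in>triples b. \<sigma> c \<noteq> b \<and> f (inv_into UNIV \<sigma> b) \<noteq> i}"
      using f(4,7) by (simp add: T c \<tau>v)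
    moreover have "T (T x) = x"
    proof -
      have "T (T x) = (\<tau> \<circ> transpose d c, f, c)" unfolding T by (simp add: T_def c)
      also have "\<tau> \<circ> transpose d c = \<sigma>"
        by (simp add: \<tau>_def comp_assoc transpose_commute[of d c])
      finally show ?thesis by (simp add: xe)
    qed
    moreover have "replaced b (T x) = - replaced b x"
    proof -
      have "\<tau>(d := b) = \<sigma>(c := b)" using \<tau>v d by (auto simp: fun_eq_iff)
      moreover have "signed \<tau> a h = - signed \<sigma> a h" for a h
        unfolding \<tau>_def by (rule signed_swap) (use f(1) d in auto)
      ultimately show ?thesis by (simp add: T[unfolded xe] xe replaced_def \<tau>v nsym_uminus1)
    qed
    ultimately show "T x \<in> {(\<sigma>, f, c)\<in>triples b. \<sigma> c \<noteq> b \<and> f (inv_into UNIV \<sigma> b) \<noteq> i} \<and> T (T x) = x \<and>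
      replaced b (T x) = - replaced b x" by blast
  qed
qed

text \<open>If \<sigma> already sends \<open>c\<close> to \<open>b\<close>, nothing is replaced: the
  term is a complete Leibniz term behind x_{i,b}, and \<open>c\<close> is recovered from
  \<sigma>.\<close>

lemma replaced_diagonal:
  assumes b: "b \<in> K"
  shows "(\<Sum>x\<in>{(\<sigma>, f, c)\<in>triples b. \<sigma> c = b}. replaced b x) =
    (\<Sum>s\<in>{(\<sigma>, f)\<in>S. f (inv_into UNIV \<sigma> b) \<noteq> i}. bordered (\<lambda>r. \<omega> (r + 1)) b s)"
proof (rule sum.reindex_bij_witness[where i = "\<lambda>(\<sigma>, f). (\<sigma>, f, inv_into UNIV \<sigma> b)" and j = "\<lambda>(\<sigma>, f, c). (\<sigma>, f)"])
  fix x assume x: "x \<in> {(\<sigma>, f, c)\<in>triples b. \<sigma> c = b}"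
  obtain \<sigma> f c where xe: "x = (\<sigma>, f, c)" by (cases x)
  have f: "\<sigma> permutes K" "f \<in> K \<rightarrow>\<^sub>E {0..i}" "c \<in> K" "f c < i" "f c = 0 \<longrightarrow> c = b"
    "\<And>p. p \<in> K - {c} \<Longrightarrow> f p = 0 \<Longrightarrow> \<sigma> p = p" "\<sigma> c = b"
    using x by (auto simp: xe triples_def)
  have c: "inv_into UNIV \<sigma> b = c" using inv_perm(3)[OF f(1) b, of c] f(7) by simp
  show "(case case x of (\<sigma>, f, c) \<Rightarrow> (\<sigma>, f) of (\<sigma>, f) \<Rightarrow> (\<sigma>, f, inv_into UNIV \<sigma> b)) = x"
    by (simp add: xe c)
  have "\<sigma> p = p" if "p \<in> K" "f p = 0" for p using f(5,6,7) that by (cases "p = c") auto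
  then show "(case x of (\<sigma>, f, c) \<Rightarrow> (\<sigma>, f)) \<in> {(\<sigma>, f)\<in>S. f (inv_into UNIV \<sigma> b) \<noteq> i}"
    using f(1,2,4) by (simp add: xe c leibniz_def)
  have "\<sigma>(c := b) = \<sigma>" using f(7) by auto
  then show "bordered (\<lambda>r. \<omega> (r + 1)) b (case x of (\<sigma>, f, c) \<Rightarrow> (\<sigma>, f)) = replaced b x"
    by (simp add: xe bordered_def replaced_def f(7))
next
  fix s assume s: "s \<in> {(\<sigma>, f)\<in>S. f (inv_into UNIV \<sigma> b) \<noteq> i}"
  obtain \<sigma> f where se: "s = (\<sigma>, f)" by (cases s)
  have S: "(\<sigma>, f) \<in> S" "f (inv_into UNIV \<sigma> b) \<noteq> i" using s by (auto simp: se)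
  note p = inv_perm[OF SD(1)[OF S(1)] b]
  show "(case case s of (\<sigma>, f) \<Rightarrow> (\<sigma>, f, inv_into UNIV \<sigma> b) of (\<sigma>, f, c) \<Rightarrow> (\<sigma>, f)) = s" by (simp add: se)
  have "f (inv_into UNIV \<sigma> b) < i" using SD(4)[OF S(1) p(1)] S(2) by simp
  moreover have "inv_into UNIV \<sigma> b = b" if "f (inv_into UNIV \<sigma> b) = 0" using SD(3)[OF S(1) p(1) that] p(2) by simp
  ultimately show "(case s of (\<sigma>, f) \<Rightarrow> (\<sigma>, f, inv_into UNIV \<sigma> b)) \<in> {(\<sigma>, f, c)\<in>triples b. \<sigma> c = b}"
    using p(1,2) SD(1-3)[OF S(1)] by (simp add: se triples_def)
qed

text \<open>The position d sent to \<open>b\<close> by \<sigma> carries the index \<open>i\<close>,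
  so x_{i,b} at d and x_{i, \<sigma> c} in front can change places, at the cost of (-1)^(par i).
  Undoing the exchange in \<sigma> costs another -1. A bordered term is reached once from each d in
  its fiber over \<open>i\<close>, hence the factor r.\<close>

lemma replaced_exchange:
  assumes b: "b \<in> K"
  shows "(\<Sum>x\<in>{(\<sigma>, f, c)\<in>triples b. f (inv_into UNIV \<sigma> b) = i}. replaced b x) =
    (\<Sum>s\<in>{(\<sigma>, f)\<in>S. f (inv_into UNIV \<sigma> b) \<noteq> i}. bordered (\<lambda>r. - (((-1) ^ par m i * of_nat r) * \<omega> (r + 1))) b s)"
proof -
  let ?E = "(-1) ^ par m i :: complex"
  let ?S0 = "{(\<sigma>, f)\<in>S. f (inv_into UNIV \<sigma> b) \<noteq> i}"
  define P where "P = Sigma ?S0 (\<lambda>(\<sigma>, f). fiber k f i)"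
  define fw where "fw = (\<lambda>(\<sigma>::nat \<Rightarrow> nat, f::nat \<Rightarrow> nat, c::nat). ((\<sigma> \<circ> transpose c (inv_into UNIV \<sigma> b), f), inv_into UNIV \<sigma> b))"
  define bw where "bw = (\<lambda>((\<sigma>::nat \<Rightarrow> nat, f::nat \<Rightarrow> nat), d::nat). (\<sigma> \<circ> transpose (inv_into UNIV \<sigma> b) d, f, inv_into UNIV \<sigma> b))"
  have finS0: "finite ?S0" by (rule finite_subset[OF _ finite_leibniz]) auto
  have finf: "finite (fiber k f i)" for f by (simp add: fiber_def)
  have "(\<Sum>x\<in>{(\<sigma>, f, c)\<in>triples b. f (inv_into UNIV \<sigma> b) = i}. replaced b x) =
      (\<Sum>y\<in>P. bordered (\<lambda>r. - (?E * \<omega> (r + 1))) b (fst y))"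
  proof (rule sum.reindex_bij_witness[where i = bw and j = fw])
    fix x assume x: "x \<in> {(\<sigma>, f, c)\<in>triples b. f (inv_into UNIV \<sigma> b) = i}"
    obtain \<sigma> f c where xe: "x = (\<sigma>, f, c)" by (cases x)
    define d where "d = inv_into UNIV \<sigma> b"
    define \<tau> where "\<tau> = \<sigma> \<circ> transpose c d"
    have f: "\<sigma> permutes K" "f \<in> K \<rightarrow>\<^sub>E {0..i}" "c \<in> K" "f c < i" "f c = 0 \<longrightarrow> c = b"
      "\<And>p. p \<in> K - {c} \<Longrightarrow> f p = 0 \<Longrightarrow> \<sigma> p = p" "f d = i"
      using x by (auto simp: xe triples_def d_def)
    have d: "d \<in> K" "\<sigma> d = b" "d \<noteq> c" using inv_perm[OF f(1) b] f(4,7) by (auto simp: d_def)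
    have \<tau>: "\<tau> permutes K"
      unfolding \<tau>_def using f(1,3) d(1) by (intro permutes_compose permutes_swap_id) auto
    have \<tau>v: "\<tau> c = b" "\<tau> d = \<sigma> c" "\<And>p. p \<noteq> c \<Longrightarrow> p \<noteq> d \<Longrightarrow> \<tau> p = \<sigma> p"
      using d by (simp_all add: \<tau>_def transpose_def)
    have c: "inv_into UNIV \<tau> b = c" using inv_perm(3)[OF \<tau> b, of c] \<tau>v(1) by simp
    have t: "fw x = ((\<tau>, f), d)" by (simp add: fw_def xe \<tau>_def d_def)
    show "bw (fw x) = x"
      unfolding t by (simp add: bw_def c xe) (simp add: \<tau>_def comp_assoc)
    have "\<tau> p = p" if "p \<in> K" "f p = 0" for p
      using that f(5,6,7) \<tau>v i by (cases "p = c"; cases "p = d") auto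
    then show "fw x \<in> P" unfolding t P_def using \<tau> f(2,4,7) d(1) by (simp add: leibniz_def c fiber_def)
    have "bordered (\<lambda>r. - (?E * \<omega> (r + 1))) b (\<tau>, f) =
        - nsym (signed \<tau> (?E * \<omega> (r f + 1)) (hpart z K f)) (X i b * nrd K \<tau> f) (gpart \<Lambda> K f * \<gamma>)"
      by (simp add: bordered_def signed_def nsym_uminus1 fls_const_uminus)
    also have "\<dots> = nsym (signed \<sigma> (?E * \<omega> (r f + 1)) (hpart z K f)) (X i b * nrd K \<tau> f) (gpart \<Lambda> K f * \<gamma>)"
      unfolding \<tau>_def using f(1) d by (subst signed_swap) (auto simp: nsym_uminus1)
    also have "signed \<sigma> (?E * \<omega> (r f + 1)) (hpart z K f) = (-1) ^ par m i * signed \<sigma> (\<omega> (r f + 1)) (hpart z K f)"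
      using par_cases[of m i] by (auto simp: signed_def simp flip: fls_const_uminus)
    also have "nsym ((-1) ^ par m i * signed \<sigma> (\<omega> (r f + 1)) (hpart z K f)) (X i b * nrd K \<tau> f) (gpart \<Lambda> K f * \<gamma>) =
       nsym (signed \<sigma> (\<omega> (r f + 1)) (hpart z K f)) ((-1) ^ par m i * (X i b * nrd K \<tau> f)) (gpart \<Lambda> K f * \<gamma>)"
      by (simp add: nsym_sign2)
    also have "(-1) ^ par m i * (X i b * nrd K \<tau> f) = X i (\<sigma> c) * nrd K (\<sigma>(c := b)) f"
    proof -
      have 1: "nrd K \<tau> f = X i (\<sigma> c) * nrd (K - {d}) \<tau> f * D i d"
        using nord_remove[of K d \<tau> f, where 'a='m and 'b='n and 'c='k] d(1) f(7) i \<tau>v(2) by simp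
      have 2: "nrd K (\<sigma>(c := b)) f = X i b * nrd (K - {d}) (\<sigma>(c := b)) f * D i d"
        using nord_remove[of K d "\<sigma>(c := b)" f, where 'a='m and 'b='n and 'c='k] d f(7) i by simp
      have 3: "nrd (K - {d}) (\<sigma>(c := b)) f = nrd (K - {d}) \<tau> f"
        by (rule nord_cong) (use \<tau>v in auto)
      have "X i (\<sigma> c) * X i b = (-1) ^ par m i * (X i b * X i (\<sigma> c))"
        using weyl_x_x[of i "\<sigma> c" i b, where 'm='m and 'n='n and 'k='k] par_cases[of m i] by (auto simp: m)
      then show ?thesis unfolding 1 2 3 by (simp only: mult.assoc[symmetric])
    qed
    finally show "bordered (\<lambda>r. - (?E * \<omega> (r + 1))) b (fst (fw x)) = replaced b x"
      by (simp add: t[unfolded xe] xe replaced_def)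
  next
    fix y assume y: "y \<in> P"
    obtain \<sigma> f d where ye: "y = ((\<sigma>, f), d)" by (cases y) auto
    have S: "(\<sigma>, f) \<in> S" "f (inv_into UNIV \<sigma> b) \<noteq> i" and d: "d \<in> K" "f d = i"
      using y by (auto simp: ye P_def fiber_def)
    define c where "c = inv_into UNIV \<sigma> b"
    define \<tau> where "\<tau> = \<sigma> \<circ> transpose c d"
    have c: "c \<in> K" "\<sigma> c = b" using inv_perm[OF SD(1)[OF S(1)] b] by (simp_all add: c_def)
    have cd: "c \<noteq> d" using S(2) d by (auto simp: c_def)
    have \<tau>: "\<tau> permutes K"
      unfolding \<tau>_def using SD(1)[OF S(1)] c d by (intro permutes_compose permutes_swap_id) auto
    have \<tau>v: "\<tau> d = b" "\<tau> c = \<sigma> d" "\<And>p. p \<noteq> c \<Longrightarrow> p \<noteq> d \<Longrightarrow> \<tau> p = \<sigma> p"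
      using c cd by (simp_all add: \<tau>_def transpose_def)
    have ivd: "inv_into UNIV \<tau> b = d" using inv_perm(3)[OF \<tau> b, of d] \<tau>v(1) by simp
    have bk: "bw y = (\<tau>, f, c)" by (simp add: bw_def ye \<tau>_def c_def)
    show "fw (bw y) = y" unfolding bk by (simp add: fw_def ivd ye) (simp add: \<tau>_def comp_assoc)
    have "f c < i" using SD(4)[OF S(1) c(1)] S(2) by (simp add: c_def)
    moreover have "c = b" if "f c = 0" using SD(3)[OF S(1) c(1) that] c(2) by simp
    moreover have "\<tau> p = p" if "p \<in> K - {c}" "f p = 0" for p
      using that SD(3)[OF S(1), of p] \<tau>v d i by (cases "p = d") auto
    ultimately show "bw y \<in> {(\<sigma>, f, c)\<in>triples b. f (inv_into UNIV \<sigma> b) = i}"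
      unfolding bk using \<tau> SD(2)[OF S(1)] c(1) d(2) by (simp add: triples_def ivd)
  qed
  also have "\<dots> = (\<Sum>s\<in>?S0. \<Sum>d\<in>(case s of (\<sigma>, f) \<Rightarrow> fiber k f i). bordered (\<lambda>r. - (?E * \<omega> (r + 1))) b s)"
    unfolding P_def using finS0 finf by (subst sum.Sigma) (auto simp: case_prod_beta)
  also have "\<dots> = (\<Sum>s\<in>?S0. bordered (\<lambda>r. - ((?E * of_nat r) * \<omega> (r + 1))) b s)"
  proof (rule sum.cong[OF refl])
    fix s :: "(nat \<Rightarrow> nat) \<times> (nat \<Rightarrow> nat)"
    obtain \<sigma> f where s: "s = (\<sigma>, f)" by (cases s)
    have "(\<Sum>d\<in>(case s of (\<sigma>, f) \<Rightarrow> fiber k f i). bordered (\<lambda>r. - (?E * \<omega> (r + 1))) b s) =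
      psdo_scal (of_nat (r f)) * bordered (\<lambda>r. - (?E * \<omega> (r + 1))) b s"
      using psdo_scal_of_int[of "int (r f)", where 'a='m and 'b='n and 'c='k] by (simp add: s)
    also have "\<dots> = bordered (\<lambda>r. of_nat r * - (?E * \<omega> (r + 1))) b s"
      by (simp only: s bordered_def prod.case nsym_scal fls_const_signed)
    also have "(\<lambda>r. of_nat r * - (?E * \<omega> (r + 1))) = (\<lambda>r. - ((?E * of_nat r) * \<omega> (r + 1)))"
      by (simp add: fun_eq_iff)
    finally show "(\<Sum>d\<in>(case s of (\<sigma>, f) \<Rightarrow> fiber k f i). bordered (\<lambda>r. - (?E * \<omega> (r + 1))) b s) =
       bordered (\<lambda>r. - ((?E * of_nat r) * \<omega> (r + 1))) b s" .
  qed
  finally show ?thesis .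
qed

text \<open>For odd \<open>i\<close> the product contains the square of x_{i,b}, which is 0. For
  even \<open>i\<close> the weight \<open>u\<close> vanishes, since the fiber over \<open>i\<close>
  is nonempty.\<close>

lemma bordered_zero:
  assumes b: "b \<in> K" and S: "(\<sigma>, f) \<in> S" "f (inv_into UNIV \<sigma> b) = i"
  shows "bordered (\<lambda>r. (-1) ^ par m i * u r) b (\<sigma>, f) = 0"
proof -
  define d where "d = inv_into UNIV \<sigma> b"
  have d: "d \<in> K" "\<sigma> d = b" "f d = i" using inv_perm[OF SD(1)[OF S(1)] b] S(2) by (simp_all add: d_def)
  show ?thesis
  proof (cases "par m i = 0")
    case True
    then have "u (r f) = 0" using weight_even[OF _ True] r_ge_1[of d f] d by auto
    then show ?thesis by (simp add: bordered_def signed_def)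
  next
    case False
    then have p: "par m i = 1" using par_cases[of m i] by simp
    have "X i b * X i b = - (X i b * X i b)"
      using weyl_x_x[of i b i b, where 'm='m and 'n='n and 'k='k] p by (simp add: m)
    then have "psdo_of (X i b * X i b) = - psdo_of (X i b * X i b)"
      by (metis psdo_of_uminus)
    then have 0: "psdo_of (X i b * X i b) = 0" by (rule psdo_eq_uminus_self)
    have "nrd K \<sigma> f = X i b * nrd (K - {d}) \<sigma> f * D i d"
      using nord_remove[of K d \<sigma> f, where 'a='m and 'b='n and 'c='k] d i by simp
    then have "psdo_of (X i b * nrd K \<sigma> f) = psdo_of (X i b * X i b) * psdo_of (nrd (K - {d}) \<sigma> f * D i d)"
      by (simp add: mult.assoc flip: psdo_of_mult)
    then show ?thesis by (simp add: bordered_def nsym_def 0)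
  qed
qed

text \<open>Diagonal triples contribute the weight \<open>\<omega> (r + 1)\<close>, exchanged ones
  the same weight times -(-1)^(par i) r. By \<open>weight_x\<close> their sum is opposite to the
  weight of \<open>y_last\<close>; the bordered terms not reached are zero.\<close>

lemma replaced_bordered:
  assumes b: "b \<in> K"
  shows "(\<Sum>x\<in>triples b. replaced b x) + (\<Sum>s\<in>S. bordered (\<lambda>r. (-1) ^ par m i * u r) b s) = 0"
proof -
  let ?E = "(-1) ^ par m i :: complex"
  let ?S0 = "{(\<sigma>, f)\<in>S. f (inv_into UNIV \<sigma> b) \<noteq> i}"
  let ?T1 = "{(\<sigma>, f, c)\<in>triples b. \<sigma> c = b}"
  let ?T2 = "{(\<sigma>, f, c)\<in>triples b. \<sigma> c \<noteq> b \<and> f (inv_into UNIV \<sigma> b) \<noteq> i}"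
  let ?T3 = "{(\<sigma>, f, c)\<in>triples b. f (inv_into UNIV \<sigma> b) = i}"
  have fin: "finite ?T1" "finite ?T2" "finite ?T3"
    by (rule finite_subset[OF _ finite_triples[of b]]; auto)+
  have T13: "?T1 \<inter> ?T3 = {}"
  proof -
    have "f (inv_into UNIV \<sigma> b) \<noteq> i" if "(\<sigma>, f, c) \<in> triples b" "\<sigma> c = b" for \<sigma> f c
    proof -
      have "\<sigma> permutes K" "f c < i" using that by (auto simp: triples_def)
      then show ?thesis using inv_perm(3)[of \<sigma> b c] b that by auto
    qed
    then show ?thesis by fast
  qed
  have "triples b = (?T1 \<union> ?T3) \<union> ?T2" by auto
  then have "(\<Sum>x\<in>triples b. replaced b x) = (\<Sum>x\<in>(?T1 \<union> ?T3) \<union> ?T2. replaced b x)" by simp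
  also have "\<dots> = (\<Sum>x\<in>?T1. replaced b x) + (\<Sum>x\<in>?T3. replaced b x) + (\<Sum>x\<in>?T2. replaced b x)"
    using fin T13 by (subst sum.union_disjoint; (subst sum.union_disjoint)?) auto
  also have "\<dots> = (\<Sum>s\<in>?S0. bordered (\<lambda>r. \<omega> (r + 1)) b s + bordered (\<lambda>r. - ((?E * of_nat r) * \<omega> (r + 1))) b s)"
    by (simp only: replaced_cancel[OF b] replaced_diagonal[OF b] replaced_exchange[OF b] sum.distrib add_0_right)
  also have "\<dots> = (\<Sum>s\<in>?S0. - bordered (\<lambda>r. ?E * u r) b s)"
  proof (rule sum.cong[OF refl])
    fix s :: "(nat \<Rightarrow> nat) \<times> (nat \<Rightarrow> nat)"
    obtain \<sigma> f where s: "s = (\<sigma>, f)" by (cases s)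
    have "\<omega> (r f + 1) + - ((?E * of_nat (r f)) * \<omega> (r f + 1)) = - (?E * u (r f))"
      using weight_x[of "r f"] by (simp add: algebra_simps eq_neg_iff_add_eq_0)
    moreover have "signed \<sigma> x h + signed \<sigma> y h = signed \<sigma> (x + y) h" for x y h
      by (simp add: signed_def distrib_left distrib_right flip: fls_plus_const)
    moreover have "signed \<sigma> (- x) h = - signed \<sigma> x h" for x h
      by (simp add: signed_def fls_const_uminus)
    ultimately show "bordered (\<lambda>r. \<omega> (r + 1)) b s + bordered (\<lambda>r. - ((?E * of_nat r) * \<omega> (r + 1))) b s =
        - bordered (\<lambda>r. ?E * u r) b s"
      unfolding s bordered_def prod.case nsym_add1[symmetric] nsym_uminus1[symmetric] by metis
  qed
  also have "\<dots> = - (\<Sum>s\<in>S. bordered (\<lambda>r. ?E * u r) b s)"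
    unfolding sum_negf
    by (rule arg_cong[where f = uminus], rule sum.mono_neutral_left)
      (use bordered_zero[OF b] finite_leibniz in auto)
  finally show ?thesis by simp
qed

text \<open>Contractions between two positions (\<open>C\<close>), those within one position
  (\<open>B\<close>) and the index-\<open>i\<close> derivatives (\<open>L\<close>) each occur twice
  with opposite signs. The uncontracted rest \<open>R0 + R1 + G\<close> is 0 by the cancellation of
  double hits.\<close>

lemma x_column:
  assumes b: "b \<in> K"
  shows "y_left b * (psdo_v - psdo_scal (z b))
    + (\<Sum>j\<in>{1..<i}. y_mid j * ((-1) ^ par m j * psdo_of (X j b)))
    + y_last * ((-1) ^ par m i * psdo_of (X i b)) = 0"
proof -
  let ?Sb = "{s\<in>S. snd s b = i}"
  define R0 where "R0 = (\<Sum>s\<in>?Sb. replaced b (fst s, (snd s)(b := 0), b))"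
  define R1 where "R1 = (\<Sum>j\<in>{1..<i}. \<Sum>c\<in>K. \<Sum>s\<in>{s\<in>S. snd s c = i}. replaced b (fst s, (snd s)(c := j), c))"
  define C where "C = (\<Sum>c\<in>K - {b}. \<Sum>j\<in>{1..<i}. \<Sum>s\<in>{s\<in>S. snd s b = i \<and> snd s c = j}. term_y \<omega> b s (dv_res \<Lambda> j))"
  define B where "B = (\<Sum>j\<in>{1..<i}. \<Sum>s\<in>?Sb. psdo_scal ((-1) ^ par m j) * term_y \<omega> b s (dv_res \<Lambda> j))"
  define L where "L = (\<Sum>s\<in>?Sb. term_y (\<lambda>r. \<omega> r * (e i - (of_nat r - 1))) b s (dv_res \<Lambda> i))"
  define G where "G = (\<Sum>s\<in>S. bordered (\<lambda>r. (-1) ^ par m i * u r) b s)"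
  have 1: "y_left b * (psdo_v - psdo_scal (z b)) = R0 - C + B + L"
    unfolding R0_def C_def B_def L_def by (rule x_column_left[OF b])
  have "(\<Sum>j\<in>{1..<i}. \<Sum>c\<in>K - {b}. \<Sum>s\<in>{s\<in>S. snd s c = i \<and> snd s b = j}. contraction b c j s) =
    (\<Sum>j\<in>{1..<i}. \<Sum>c\<in>K - {b}. \<Sum>s\<in>{s\<in>S. snd s b = i \<and> snd s c = j}. term_y \<omega> b s (dv_res \<Lambda> j))"
    by (intro sum.cong refl contraction_cancel[symmetric]) (use b in auto)
  also have "\<dots> = C" unfolding C_def by (rule sum.swap)
  finally have "(\<Sum>j\<in>{1..<i}. \<Sum>c\<in>K - {b}. \<Sum>s\<in>{s\<in>S. snd s c = i \<and> snd s b = j}. contraction b c j s) = C" .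
  then have 2: "(\<Sum>j\<in>{1..<i}. y_mid j * ((-1) ^ par m j * psdo_of (X j b))) = R1 + C - B"
    by (simp only: x_column_mid[OF b] sum.distrib sum_subtractf R1_def B_def cong: sum.cong)
  have "term_y (\<lambda>r. (-1) ^ par m i * u r) b s (dv_res \<Lambda> i) =
      term_y (\<lambda>r. \<omega> r * (e i - (of_nat r - 1))) b s (dv_res \<Lambda> i)" if "s \<in> ?Sb" for s
    using that weight_v[OF r_ge_1[OF b, of "snd s"]] by (cases s) (simp add: term_y_def)
  then have "(\<Sum>s\<in>?Sb. term_y (\<lambda>r. (-1) ^ par m i * u r) b s (dv_res \<Lambda> i)) = L"
    unfolding L_def by (rule sum.cong[OF refl])
  then have 3: "y_last * ((-1) ^ par m i * psdo_of (X i b)) = G - L"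
    by (simp only: x_column_last[OF b] G_def)
  have "R0 + R1 + G = 0"
    using replaced_bordered[OF b] unfolding R0_def R1_def G_def replaced_sum[OF b] .
  then show ?thesis unfolding 1 2 3 by (simp add: algebra_simps)
qed

end

section \<open>Schur complements and quasi-minors\<close>

definition order_le :: "int \<Rightarrow> 'a::zero psdo \<Rightarrow> bool" where
  "order_le N F \<longleftrightarrow> (\<forall>u>N. psdo_coeff F u = 0)"

lemma order_le_0 [simp]: "order_le N (0 :: 'a::ring_1 psdo)"
  by (simp add: order_le_def)

lemma order_le_add: "order_le N F \<Longrightarrow> order_le N G \<Longrightarrow> order_le N (F + G :: 'a::ring_1 psdo)"
  by (simp add: order_le_def psdo_coeff_add)

lemma order_le_uminus: "order_le N F \<Longrightarrow> order_le N (- F :: 'a::ring_1 psdo)"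
  by (simp add: order_le_def psdo_coeff_uminus)

lemma order_le_diff: "order_le N F \<Longrightarrow> order_le N G \<Longrightarrow> order_le N (F - G :: 'a::ring_1 psdo)"
  by (simp add: order_le_def psdo_coeff_diff)

lemma order_le_mult: "order_le N F \<Longrightarrow> order_le M G \<Longrightarrow> order_le (N + M) (F * G :: 'a::ring_1 psdo)"
  unfolding order_le_def times_psdo.rep_eq by (auto intro: psdo_times_0)

lemma order_le_mult_0: "order_le 0 F \<Longrightarrow> order_le 0 G \<Longrightarrow> order_le 0 (F * G :: 'a::ring_1 psdo)"
  using order_le_mult[of 0 F 0 G] by simp

lemma order_le_mono: "order_le N F \<Longrightarrow> N \<le> M \<Longrightarrow> order_le M F"
  by (simp add: order_le_def)

lemma order_le_sum: "(\<And>x. x \<in> A \<Longrightarrow> order_le N (f x)) \<Longrightarrow> order_le N (\<Sum>x\<in>A. f x :: 'a::ring_1 psdo)"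
  by (induction A rule: infinite_finite_induct) (auto intro: order_le_add)

lemma order_le_monom: "t \<le> N \<Longrightarrow> order_le N (psdo_monom f t)"
  by (simp add: order_le_def psdo_coeff_monom)

lemma order_le_1 [simp]: "order_le 0 (1 :: 'a::ring_1 psdo)"
  by (simp add: order_le_def psdo_coeff_1)

lemma order_le_power: "order_le (-1) H \<Longrightarrow> order_le (- int s) (H ^ s :: 'a::ring_1 psdo)"
proof (induction s)
  case (Suc s)
  then show ?case using order_le_mult[of "-1" H "- int s" "H ^ s"] by simp
qed simp

lemma psdo_eqI_order: "(\<And>t::nat. order_le (- int t) (F - G)) \<Longrightarrow> F = (G :: 'a::ring_1 psdo)"
proof (rule psdo_eqI)
  fix u assume *: "\<And>t::nat. order_le (- int t) (F - G)"
  have "psdo_coeff (F - G) u = 0"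
    using *[of "nat (1 - u)"] unfolding order_le_def by (cases "u \<ge> 1") auto
  then show "psdo_coeff F u = psdo_coeff G u" by (simp add: psdo_coeff_diff)
qed

lemma neumann_inverse:
  fixes H :: "'a::ring_1 psdo"
  assumes "order_le (-1) H"
  obtains E where "order_le 0 E" "(1 - H) * E = 1" "E * (1 - H) = 1"
proof -
  \<comment> \<open>Since \<open>H ^ s\<close> has order at most -s, the geometric series and its
    partial sum up to \<open>nat (- u)\<close> have the same coefficient at
    \<open>u\<close>.\<close>
  define E where "E = Abs_psdo (\<lambda>u. psdo_coeff (\<Sum>s\<le>nat (- u). H ^ s) u)"
  define E' where "E' t = (\<Sum>s\<le>t. H ^ s)" for t :: nat
  have E'0: "order_le 0 (E' t)" for t
    unfolding E'_def by (intro order_le_sum) (rule order_le_mono[OF order_le_power[OF assms]], simp)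
  have coeff_E: "psdo_coeff E u = psdo_coeff (E' (nat (- u))) u" for u
    unfolding E_def E'_def
    by (subst Abs_psdo_inverse) (use E'0 in \<open>auto simp: order_le_def E'_def intro!: exI[of _ 0]\<close>)
  have stable: "psdo_coeff (E' t) u = psdo_coeff (E' (nat (- u))) u" if "u > - int t - 1" for t u
  proof -
    have "nat (- u) \<le> t" using that by linarith
    then have "psdo_coeff (E' t) u = psdo_coeff (E' (nat (- u))) u"
    proof (induction t rule: dec_induct)
      case (step l)
      have "order_le (- int (Suc l)) (H ^ Suc l)" by (rule order_le_power[OF assms])
      moreover have "u > - int (Suc l)" using step.hyps by linarith
      ultimately have "psdo_coeff (H ^ Suc l) u = 0" by (simp add: order_le_def del: power_Suc)
      then show ?case using step.IH by (simp add: E'_def psdo_coeff_add del: power_Suc)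
    qed simp
    then show ?thesis .
  qed
  have diff: "order_le (- int t - 1) (E - E' t)" for t
    unfolding order_le_def psdo_coeff_diff coeff_E using stable[of t] by simp
  have E0: "order_le 0 E" unfolding order_le_def coeff_E using E'0 by (auto simp: order_le_def)
  have H0: "order_le 0 (1 - H)" using assms by (intro order_le_diff) (auto intro: order_le_mono)
  have tel: "(1 - H) * E' t = 1 - H ^ Suc t" "E' t * (1 - H) = 1 - H ^ Suc t" for t
  proof -
    have E'S: "E' (Suc t) = E' t + H ^ Suc t" for t by (simp add: E'_def)
    show "(1 - H) * E' t = 1 - H ^ Suc t"
    proof (induction t)
      case (Suc t)
      then show ?case unfolding E'S distrib_left by (simp add: left_diff_distrib)
    qed (simp add: E'_def)
    show "E' t * (1 - H) = 1 - H ^ Suc t"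
    proof (induction t)
      case (Suc t)
      then show ?case unfolding E'S distrib_right by (simp add: right_diff_distrib power_commutes mult.assoc)
    qed (simp add: E'_def)
  qed
  have small: "order_le (- int t) (H ^ Suc t)" for t
    by (rule order_le_mono[OF order_le_power[OF assms]]) simp
  have "(1 - H) * E = 1"
  proof (rule psdo_eqI_order)
    fix t
    have "(1 - H) * E - 1 = (1 - H) * (E - E' t) - H ^ Suc t" using tel(1)[of t] by (simp add: algebra_simps)
    moreover have "order_le (- int t) ((1 - H) * (E - E' t))"
      using order_le_mult[OF H0 diff[of t]] by (rule order_le_mono) simp
    ultimately show "order_le (- int t) ((1 - H) * E - 1)" using small by (simp only: order_le_diff)
  qed
  moreover have "E * (1 - H) = 1"
  proof (rule psdo_eqI_order)
    fix t
    have "E * (1 - H) - 1 = (E - E' t) * (1 - H) - H ^ Suc t" using tel(2)[of t] by (simp add: algebra_simps)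
    moreover have "order_le (- int t) ((E - E' t) * (1 - H))"
      using order_le_mult[OF diff[of t] H0] by (rule order_le_mono) simp
    ultimately show "order_le (- int t) (E * (1 - H) - 1)" using small by (simp only: order_le_diff)
  qed
  ultimately show thesis using that E0 by blast
qed

text \<open>With P the inverse of the derivation, \<partial>_v - G = (1 - G P) \<partial>_v, and G P
  has order at most -1.\<close>

lemma dv_plus_inverse:
  fixes G :: "('m::len0, 'n::len0, 'k::len0) weyl psdo"
  assumes "order_le 0 G"
  obtains E where "order_le 0 E" "(psdo_dv - G) * E = 1" "E * (psdo_dv - G) = 1"
proof -
  define P where "P = (dv_series fls_X :: ('m, 'n, 'k) weyl psdo)"
  have P: "order_le (-1) P" by (auto simp: order_le_def P_def weyl_scal_0)
  have X: "fls_X * fls_X_inv = (1 :: complex fls)" "fls_X_inv * fls_X = (1 :: complex fls)"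
    by (simp_all add: fls_X_times_conv_shift mult.commute)
  have PD: "P * psdo_dv = 1" "psdo_dv * P = 1"
    by (simp_all add: P_def X flip: dv_series_dv dv_series_mult)
  have "order_le (-1) (G * P)" using order_le_mult[OF assms P] by simp
  then obtain E where E: "order_le 0 E" "(1 - G * P) * E = 1" "E * (1 - G * P) = 1"
    by (rule neumann_inverse)
  have F: "psdo_dv - G = (1 - G * P) * psdo_dv"
    by (simp add: left_diff_distrib mult.assoc PD)
  have "(psdo_dv - G) * (P * E) = 1"
  proof -
    have "(psdo_dv - G) * (P * E) = (1 - G * P) * (psdo_dv * P) * E" by (simp only: F mult.assoc)
    then show ?thesis by (simp add: PD E)
  qed
  moreover have "P * E * (psdo_dv - G) = 1"
  proof -
    have "P * E * (psdo_dv - G) = P * (E * (1 - G * P)) * psdo_dv" by (simp only: F mult.assoc)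
    then show ?thesis by (simp add: PD E)
  qed
  moreover have "order_le 0 (P * E)"
    using order_le_mult[OF P E(1)] by (rule order_le_mono) simp
  ultimately show thesis using that by blast
qed

section \<open>Block inversion one row and column at a time\<close>

text \<open>Index functions instead of matrices: top-left blocks of all sizes then share one
  \<open>A\<close>.\<close>

definition inverse_on :: "nat \<Rightarrow> (nat \<Rightarrow> nat \<Rightarrow> 'a::ring_1) \<Rightarrow> (nat \<Rightarrow> nat \<Rightarrow> 'a) \<Rightarrow> bool" where
  "inverse_on l A B \<longleftrightarrow> (\<forall>p<l. \<forall>r<l. (\<Sum>q<l. A p q * B q r) = (if p = r then 1 else 0) \<and>
     (\<Sum>q<l. B p q * A q r) = (if p = r then 1 else 0))"

definition schur :: "nat \<Rightarrow> (nat \<Rightarrow> nat \<Rightarrow> 'a::ring_1) \<Rightarrow> (nat \<Rightarrow> nat \<Rightarrow> 'a) \<Rightarrow> 'a" where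
  "schur l A B = A l l - (\<Sum>p<l. \<Sum>q<l. A l p * B p q * A q l)"

text \<open>The block inversion formula over a noncommutative ring, where \<open>e\<close> is meant
  to be the inverse of the Schur complement. As \<open>e\<close> is the corner entry, the
  quasi-minor of the larger block is the Schur complement itself.\<close>

definition extend_inverse :: "nat \<Rightarrow> (nat \<Rightarrow> nat \<Rightarrow> 'a::ring_1) \<Rightarrow> (nat \<Rightarrow> nat \<Rightarrow> 'a) \<Rightarrow> 'a \<Rightarrow> nat \<Rightarrow> nat \<Rightarrow> 'a" where
  "extend_inverse l A B e p r =
     (let Bc = \<lambda>p. \<Sum>q<l. B p q * A q l; rB = \<lambda>r. \<Sum>q<l. A l q * B q r in
      if p < l then if r < l then B p r + Bc p * e * rB r else - (Bc p * e)
      else if r < l then - (e * rB r) else e)"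

lemma sum_delta_mult:
  fixes f :: "nat \<Rightarrow> 'a::ring_1"
  shows "p < l \<Longrightarrow> (\<Sum>q<l. (if p = q then 1 else 0) * f q) = f p"
    and "p < l \<Longrightarrow> (\<Sum>q<l. f q * (if q = p then 1 else 0)) = f p"
proof -
  assume p: "p < l"
  have "(\<Sum>q<l. (if p = q then 1 else 0) * f q) = (\<Sum>q<l. if p = q then f q else 0)"
    by (intro sum.cong) auto
  then show "(\<Sum>q<l. (if p = q then 1 else 0) * f q) = f p" using p by simp
  have "(\<Sum>q<l. f q * (if q = p then 1 else 0)) = (\<Sum>q<l. if p = q then f q else 0)"
    by (intro sum.cong) auto
  then show "(\<Sum>q<l. f q * (if q = p then 1 else 0)) = f p" using p by simp
qed

lemma inverse_on_extend:
  assumes inv: "inverse_on l A B" and de: "schur l A B * e = 1" "e * schur l A B = 1"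
  shows "inverse_on (Suc l) A (extend_inverse l A B e)"
proof -
  define Bc where "Bc = (\<lambda>p. \<Sum>q<l. B p q * A q l)"
  define rB where "rB = (\<lambda>r. \<Sum>q<l. A l q * B q r)"
  define B' where "B' = extend_inverse l A B e"
  have B': "p < l \<Longrightarrow> r < l \<Longrightarrow> B' p r = B p r + Bc p * e * rB r"
    "p < l \<Longrightarrow> B' p l = - (Bc p * e)" "r < l \<Longrightarrow> B' l r = - (e * rB r)" "B' l l = e" for p r
    by (simp_all add: B'_def extend_inverse_def Bc_def rB_def Let_def)
  have AB: "(\<Sum>q<l. A p q * B q r) = (if p = r then 1 else 0)" "(\<Sum>q<l. B p q * A q r) = (if p = r then 1 else 0)"
    if "p < l" "r < l" for p r
    using inv that by (auto simp: inverse_on_def)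
  have ABc: "(\<Sum>q<l. A p q * Bc q) = A p l" if "p < l" for p
  proof -
    have "(\<Sum>q<l. A p q * Bc q) = (\<Sum>q<l. \<Sum>s<l. A p q * B q s * A s l)"
      by (simp add: Bc_def sum_distrib_left mult.assoc)
    also have "\<dots> = (\<Sum>s<l. (\<Sum>q<l. A p q * B q s) * A s l)"
      by (subst sum.swap) (simp add: sum_distrib_right)
    also have "\<dots> = (\<Sum>s<l. (if p = s then 1 else 0) * A s l)"
      by (rule sum.cong[OF refl]) (use that in \<open>simp only: AB lessThan_iff\<close>)
    finally show ?thesis by (simp only: sum_delta_mult[OF that])
  qed
  have rBA: "(\<Sum>q<l. rB q * A q r) = A l r" if "r < l" for r
  proof -
    have "(\<Sum>q<l. rB q * A q r) = (\<Sum>q<l. \<Sum>s<l. A l s * (B s q * A q r))"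
      by (simp add: rB_def sum_distrib_right mult.assoc)
    also have "\<dots> = (\<Sum>s<l. A l s * (\<Sum>q<l. B s q * A q r))"
      by (subst sum.swap) (simp add: sum_distrib_left)
    also have "\<dots> = (\<Sum>s<l. A l s * (if s = r then 1 else 0))"
      by (rule sum.cong[OF refl]) (use that in \<open>simp only: AB lessThan_iff\<close>)
    finally show ?thesis by (simp only: sum_delta_mult[OF that])
  qed
  have d1: "(\<Sum>q<l. A l q * Bc q) = A l l - schur l A B"
    by (simp add: schur_def Bc_def sum_distrib_left mult.assoc)
  have d2: "(\<Sum>q<l. rB q * A q l) = A l l - schur l A B"
    unfolding rB_def sum_distrib_right by (subst sum.swap) (simp add: schur_def mult.assoc)
  have "(\<Sum>q<Suc l. A p q * B' q r) = (if p = r then 1 else 0) \<and> (\<Sum>q<Suc l. B' p q * A q r) = (if p = r then 1 else 0)"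
    if pr: "p < Suc l" "r < Suc l" for p r
  proof
    have s1: "(\<Sum>q<l. A p q * B' q r) = (\<Sum>q<l. A p q * B q r) + (\<Sum>q<l. A p q * Bc q) * (e * rB r)" if "r < l"
      using that by (simp add: B' distrib_left sum.distrib sum_distrib_right mult.assoc)
    have s2: "(\<Sum>q<l. A p q * B' q l) = - ((\<Sum>q<l. A p q * Bc q) * e)"
      by (simp add: B' sum_negf sum_distrib_right mult.assoc)
    show "(\<Sum>q<Suc l. A p q * B' q r) = (if p = r then 1 else 0)"
    proof (cases "r < l")
      case True
      show ?thesis
      proof (cases "p < l")
        case pl: True
        show ?thesis using True pl s1 ABc[OF pl] AB[OF pl True] by (simp add: B')
      next
        case False
        then have p: "p = l" using pr by simp
        have "(\<Sum>q<Suc l. A p q * B' q r) = rB r + (A l l - schur l A B) * (e * rB r) - A l l * (e * rB r)"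
          using True s1 d1 by (simp add: B' p rB_def)
        also have "\<dots> = rB r - schur l A B * e * rB r" by (simp add: algebra_simps)
        finally show ?thesis using True by (simp add: de p)
      qed
    next
      case False
      then have r: "r = l" using pr by simp
      show ?thesis
      proof (cases "p < l")
        case pl: True
        then show ?thesis using s2 ABc[OF pl] by (simp add: r B')
      next
        case False
        then have p: "p = l" using pr by simp
        have "(\<Sum>q<Suc l. A p q * B' q r) = - ((A l l - schur l A B) * e) + A l l * e"
          using s2 d1 by (simp add: B' p r)
        also have "\<dots> = schur l A B * e" by (simp add: algebra_simps)
        finally show ?thesis by (simp add: de p r)
      qed
    qed
    have t1: "(\<Sum>q<l. B' p q * A q r) = (\<Sum>q<l. B p q * A q r) + (Bc p * e) * (\<Sum>q<l. rB q * A q r)" if "p < l"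
      using that by (simp add: B' distrib_right sum.distrib sum_distrib_left mult.assoc)
    have t2: "(\<Sum>q<l. B' l q * A q r) = - (e * (\<Sum>q<l. rB q * A q r))"
      by (simp add: B' sum_negf sum_distrib_left mult.assoc)
    show "(\<Sum>q<Suc l. B' p q * A q r) = (if p = r then 1 else 0)"
    proof (cases "p < l")
      case True
      show ?thesis
      proof (cases "r < l")
        case rl: True
        show ?thesis using True rl t1 rBA[OF rl] AB[OF True rl] by (simp add: B')
      next
        case False
        then have r: "r = l" using pr by simp
        have "(\<Sum>q<Suc l. B' p q * A q r) = Bc p + Bc p * e * (A l l - schur l A B) - Bc p * e * A l l"
          using True t1 d2 by (simp add: B' r Bc_def)
        also have "\<dots> = Bc p - Bc p * (e * schur l A B)" by (simp add: algebra_simps)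
        finally show ?thesis using True by (simp add: de r)
      qed
    next
      case False
      then have p: "p = l" using pr by simp
      show ?thesis
      proof (cases "r < l")
        case rl: True
        then show ?thesis using t2 rBA[OF rl] by (simp add: p B')
      next
        case False
        then have r: "r = l" using pr by simp
        have "(\<Sum>q<Suc l. B' p q * A q r) = - (e * (A l l - schur l A B)) + e * A l l"
          using t2 d2 by (simp add: B' p r)
        also have "\<dots> = e * schur l A B" by (simp add: algebra_simps)
        finally show ?thesis by (simp add: de p r)
      qed
    qed
  qed
  then show ?thesis by (simp add: inverse_on_def B'_def)
qed

lemma mat_inv_eq:
  fixes A :: "nat \<Rightarrow> nat \<Rightarrow> 'a::ring_1"
  assumes "inverse_on l A B"
  shows "mat_inv (mat l l (\<lambda>(p, q). A p q)) = mat l l (\<lambda>(p, q). B p q)"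
proof -
  let ?A = "mat l l (\<lambda>(p, q). A p q)" and ?B = "mat l l (\<lambda>(p, q). B p q)"
  have AB: "?A * ?B = 1\<^sub>m l" "?B * ?A = 1\<^sub>m l"
    using assms by (auto simp: inverse_on_def scalar_prod_def atLeast0LessThan intro!: eq_matI)
  show ?thesis unfolding mat_inv_def
  proof (rule the_equality)
    show "?B \<in> carrier_mat (dim_row ?A) (dim_row ?A) \<and> inverts_mat ?A ?B \<and> inverts_mat ?B ?A"
      using AB by (simp add: inverts_mat_def)
    fix C assume C: "C \<in> carrier_mat (dim_row ?A) (dim_row ?A) \<and> inverts_mat ?A C \<and> inverts_mat C ?A"
    then have c: "C \<in> carrier_mat l l" "C * ?A = 1\<^sub>m l" by (auto simp: inverts_mat_def)
    have "C = C * (?A * ?B)" using c by (simp add: AB)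
    also have "\<dots> = C * ?A * ?B" by (rule assoc_mult_mat[symmetric, OF c(1)]) auto
    also have "\<dots> = ?B" by (simp add: c)
    finally show "C = ?B" .
  qed
qed

lemma quasi_minor_schur:
  fixes M :: "'a::ring_1 mat"
  assumes "inverse_on l (\<lambda>p q. M $$ (p, q)) B"
    and "schur l (\<lambda>p q. M $$ (p, q)) B * e = 1" "e * schur l (\<lambda>p q. M $$ (p, q)) B = 1"
  shows "quasi_minor (Suc l) M = schur l (\<lambda>p q. M $$ (p, q)) B"
proof -
  let ?B = "extend_inverse l (\<lambda>p q. M $$ (p, q)) B e"
  have "mat_inv (top_left (Suc l) M) = mat (Suc l) (Suc l) (\<lambda>(p, q). ?B p q)"
    unfolding top_left_def by (rule mat_inv_eq[OF inverse_on_extend[OF assms]])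
  then have "quasi_minor (Suc l) M = two_sided_inv e"
    by (simp add: quasi_minor_def extend_inverse_def)
  then show ?thesis using two_sided_inv_eq[of e] assms(2,3) by simp
qed

text \<open>The equations for the first \<open>l\<close> columns express every \<open>y p\<close>
  through \<open>y l\<close>; substituted into the last one they leave \<open>y l\<close> times the
  Schur complement. So the quasi-minor is related to \<open>y l\<close> and \<open>c\<close> without
  dividing by either.\<close>

lemma row_mult_schur:
  fixes A :: "nat \<Rightarrow> nat \<Rightarrow> 'a::ring_1"
  assumes inv: "inverse_on l A B"
    and 0: "\<And>q. q < l \<Longrightarrow> (\<Sum>p<l. y p * A p q) + y l * A l q = 0"
    and c: "(\<Sum>p<l. y p * A p l) + y l * A l l = c"
  shows "y l * schur l A B = c"
proof -
  have y: "y p = - (\<Sum>q<l. y l * A l q * B q p)" if "p < l" for p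
  proof -
    have "y p = (\<Sum>s<l. y s * (if s = p then 1 else 0))"
      by (rule sum_delta_mult(2)[OF that, symmetric])
    also have "\<dots> = (\<Sum>s<l. y s * (\<Sum>q<l. A s q * B q p))"
      using inv that by (intro sum.cong refl) (simp add: inverse_on_def)
    also have "\<dots> = (\<Sum>s<l. \<Sum>q<l. y s * A s q * B q p)"
      by (simp add: sum_distrib_left mult.assoc)
    also have "\<dots> = (\<Sum>q<l. (\<Sum>s<l. y s * A s q) * B q p)"
      by (subst sum.swap) (simp add: sum_distrib_right)
    also have "\<dots> = (\<Sum>q<l. - (y l * A l q) * B q p)"
    proof (rule sum.cong[OF refl])
      fix q assume "q \<in> {..<l}"
      then have "(\<Sum>s<l. y s * A s q) = - (y l * A l q)" using 0[of q] by (simp add: eq_neg_iff_add_eq_0)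
      then show "(\<Sum>s<l. y s * A s q) * B q p = - (y l * A l q) * B q p" by simp
    qed
    finally show ?thesis by (simp add: sum_negf)
  qed
  have "(\<Sum>p<l. y p * A p l) = (\<Sum>p<l. - (\<Sum>q<l. y l * A l q * B q p) * A p l)"
    by (rule sum.cong[OF refl]) (simp only: y lessThan_iff)
  also have "\<dots> = - (\<Sum>p<l. \<Sum>q<l. y l * A l q * B q p * A p l)"
    by (simp add: sum_negf sum_distrib_right)
  also have "(\<Sum>p<l. \<Sum>q<l. y l * A l q * B q p * A p l) = (\<Sum>q<l. \<Sum>p<l. y l * A l q * B q p * A p l)"
    by (rule sum.swap)
  also have "\<dots> = y l * (\<Sum>q<l. \<Sum>p<l. A l q * B q p * A p l)"
    by (simp add: sum_distrib_left mult.assoc)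
  finally show ?thesis using c by (simp add: schur_def right_diff_distrib)
qed

section \<open>The Berezinian as a normally ordered determinant\<close>

lemma B_hat_entry:
  assumes "p < LENGTH('k) + (LENGTH('m) + LENGTH('n))" "q < LENGTH('k) + (LENGTH('m) + LENGTH('n))"
  shows "(B_hat z \<Lambda> :: ('m::len0, 'n::len0, 'k::len0) weyl psdo mat) $$ (p, q) =
    (if p < LENGTH('k) then
       if q < LENGTH('k) then if p = q then psdo_v - psdo_scal (z (Suc p)) else 0
       else psdo_of (weyl_d (Suc (q - LENGTH('k))) (Suc p))
     else
       if q < LENGTH('k) then (-1) ^ par LENGTH('m) (Suc (p - LENGTH('k))) * psdo_of (weyl_x (Suc (p - LENGTH('k))) (Suc q))
       else if p = q then psdo_dv - psdo_scal (\<Lambda> (Suc (p - LENGTH('k)))) else 0)"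
  using assms by (auto simp: B_hat_def Let_def)

lemma B_hat_dim [simp]:
  "dim_row (B_hat z \<Lambda> :: ('m::len0, 'n::len0, 'k::len0) weyl psdo mat) = LENGTH('k) + (LENGTH('m) + LENGTH('n))"
  by (simp add: B_hat_def Let_def)

lemma sum_lessThan_split:
  fixes g :: "nat \<Rightarrow> 'a::comm_monoid_add"
  assumes "i \<ge> 1"
  shows "(\<Sum>p<k + i - 1. g p) = (\<Sum>b\<in>{1..k}. g (b - 1)) + (\<Sum>j\<in>{1..<i}. g (k + j - 1))"
proof -
  have "{..<k + i - 1} = {..<k} \<union> {k..<k + i - 1}" using assms by auto
  then have "(\<Sum>p<k + i - 1. g p) = (\<Sum>p<k. g p) + (\<Sum>p\<in>{k..<k + i - 1}. g p)"
    by (simp add: sum.union_disjoint ivl_disj_int)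
  moreover have "(\<Sum>p<k. g p) = (\<Sum>b\<in>{1..k}. g (b - 1))"
    by (rule sum.reindex_bij_witness[of _ "\<lambda>b. b - 1" Suc]) auto
  moreover have "(\<Sum>p\<in>{k..<k + i - 1}. g p) = (\<Sum>j\<in>{1..<i}. g (k + j - 1))"
    by (rule sum.reindex_bij_witness[of _ "\<lambda>j. k + j - 1" "\<lambda>p. p - k + 1"]) (use assms in auto)
  ultimately show ?thesis by simp
qed

context row_cofactors
begin

text \<open>Matrix rows count from 0 and the indices of the generators from 1, so the index
  \<open>i\<close> belongs to row \<open>k + i - 1\<close>.\<close>

definition y_row :: "nat \<Rightarrow> ('m, 'n, 'k) weyl psdo" where
  "y_row p = (if p < k then y_left (Suc p) else if p < k + i - 1 then y_mid (Suc (p - k)) else y_last)"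

lemma y_row_simps:
  "b \<in> K \<Longrightarrow> y_row (b - 1) = y_left b"
  "j \<in> {1..<i} \<Longrightarrow> y_row (k + j - 1) = y_mid j"
  "y_row (k + i - 1) = y_last"
  using i by (auto simp: y_row_def Suc_diff_le)

lemma row_equation:
  fixes A :: "nat \<Rightarrow> nat \<Rightarrow> ('m, 'n, 'k) weyl psdo"
  defines "A \<equiv> \<lambda>p q. B_hat z \<Lambda> $$ (p, q)"
  assumes q: "q < k + i"
  shows "(\<Sum>p<k + i - 1. y_row p * A p q) + y_row (k + i - 1) * A (k + i - 1) q =
    (if q = k + i - 1 then y_rhs else 0)"
proof -
  have i1: "i \<ge> 1" "i \<le> m + n" using i by auto
  have A: "A p q = (if p < k then
       if q < k then if p = q then psdo_v - psdo_scal (z (Suc p)) else 0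
       else psdo_of (D (Suc (q - k)) (Suc p))
     else
       if q < k then (-1) ^ par m (Suc (p - k)) * psdo_of (X (Suc (p - k)) (Suc q))
       else if p = q then psdo_dv - psdo_scal (\<Lambda> (Suc (p - k))) else 0)" if "p < k + i" for p
    unfolding A_def m k by (rule B_hat_entry) (use that q i1 in \<open>auto simp: m n k\<close>)
  have "(\<Sum>p<k + i - 1. y_row p * A p q) =
    (\<Sum>b\<in>K. y_row (b - 1) * A (b - 1) q) + (\<Sum>j\<in>{1..<i}. y_row (k + j - 1) * A (k + j - 1) q)"
    by (rule sum_lessThan_split[OF i1(1)])
  also have "\<dots> = (\<Sum>b\<in>K. y_left b * A (b - 1) q) + (\<Sum>j\<in>{1..<i}. y_mid j * A (k + j - 1) q)"
    by (intro arg_cong2[where f = "(+)"] sum.cong refl) (simp_all only: y_row_simps)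
  finally have split: "(\<Sum>p<k + i - 1. y_row p * A p q) + y_row (k + i - 1) * A (k + i - 1) q =
    (\<Sum>b\<in>K. y_left b * A (b - 1) q) + (\<Sum>j\<in>{1..<i}. y_mid j * A (k + j - 1) q) + y_last * A (k + i - 1) q"
    by (simp only: y_row_simps)
  show ?thesis
  proof (cases "q < k")
    case True
    have "(\<Sum>b\<in>K. y_left b * A (b - 1) q) = (\<Sum>b\<in>K. if b = Suc q then y_left b * (psdo_v - psdo_scal (z b)) else 0)"
      by (rule sum.cong[OF refl]) (use True in \<open>auto simp: A\<close>)
    also have "\<dots> = y_left (Suc q) * (psdo_v - psdo_scal (z (Suc q)))" using True by simp
    finally have 1: "(\<Sum>b\<in>K. y_left b * A (b - 1) q) = y_left (Suc q) * (psdo_v - psdo_scal (z (Suc q)))" .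
    have 2: "(\<Sum>j\<in>{1..<i}. y_mid j * A (k + j - 1) q) =
      (\<Sum>j\<in>{1..<i}. y_mid j * ((-1) ^ par m j * psdo_of (X j (Suc q))))"
      by (rule sum.cong[OF refl]) (use True in \<open>auto simp: A Suc_diff_le\<close>)
    have 3: "A (k + i - 1) q = (-1) ^ par m i * psdo_of (X i (Suc q))"
    proof -
      have "k + i - 1 < k + i" "\<not> k + i - 1 < k" "Suc (k + i - 1 - k) = i" using i1 by auto
      then show ?thesis using True by (simp only: A if_True if_False)
    qed
    have 4: "y_left (Suc q) * (psdo_v - psdo_scal (z (Suc q)))
      + (\<Sum>j\<in>{1..<i}. y_mid j * ((-1) ^ par m j * psdo_of (X j (Suc q))))
      + y_last * ((-1) ^ par m i * psdo_of (X i (Suc q))) = 0"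
      by (rule x_column) (use True in auto)
    have "q \<noteq> k + i - 1" using True i1 by auto
    then show ?thesis unfolding split unfolding 1 2 3 4 by simp
  next
    case False
    define j where "j = Suc (q - k)"
    have q': "q = k + j - 1" "1 \<le> j" "j \<le> i" using False q by (auto simp: j_def)
    have 1: "(\<Sum>b\<in>K. y_left b * A (b - 1) q) = (\<Sum>b\<in>K. y_left b * psdo_of (D j b))"
      by (rule sum.cong[OF refl]) (use False in \<open>auto simp: A j_def\<close>)
    have 2: "A (k + j' - 1) q = (if j' = j then psdo_dv - psdo_scal (\<Lambda> j) else 0)" if "1 \<le> j'" "j' \<le> i" for j'
      using that False q' by (subst A) auto
    have 3: "(\<Sum>j'\<in>{1..<i}. y_mid j' * A (k + j' - 1) q) = (\<Sum>j'\<in>{1..<i}. if j' = j then y_mid j * (psdo_dv - psdo_scal (\<Lambda> j)) else 0)"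
      by (rule sum.cong[OF refl]) (use 2 in auto)
    show ?thesis
    proof (cases "j = i")
      case True
      then show ?thesis unfolding split 1 3 using q' i1 last_column 2[of i] by simp
    next
      case ne: False
      then have "q \<noteq> k + i - 1" using q' i1 by auto
      then show ?thesis unfolding split 1 3 using ne q' i1 middle_column[of j] 2[of i] by simp
    qed
  qed
qed

end

section \<open>Partial symbols and the choice of weights\<close>

definition beta :: "nat \<Rightarrow> (nat \<Rightarrow> complex) \<Rightarrow> nat \<Rightarrow> complex fls" where
  "beta m \<Lambda> i = (\<Prod>j\<in>{1..i}. if par m j = 0 then fls_X_inv - fls_const (\<Lambda> j) else dv_res \<Lambda> j)"

lemma dv_res_cancel: "dv_res \<Lambda> j * (fls_X_inv - fls_const (\<Lambda> j)) = 1"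
  by (simp add: dv_res_def dv_minus_const_nz[simplified])

lemma beta_Suc: "beta m \<Lambda> (Suc i) = beta m \<Lambda> i *
    (if par m (Suc i) = 0 then fls_X_inv - fls_const (\<Lambda> (Suc i)) else dv_res \<Lambda> (Suc i))"
  by (simp add: beta_def mult.commute)

text \<open>A factor \<partial>_v - \<Lambda>_j contributes plus its resolvent to the logarithmic
  derivative, an inverted one minus its resolvent; this is the source of the numbers
  \<open>e j\<close>.\<close>

lemma v_deriv_beta:
  "v_deriv (beta m \<Lambda> i) = (\<Sum>j\<in>{1..i}. fls_const ((-1) ^ par m j) * (beta m \<Lambda> i * dv_res \<Lambda> j))"
proof (induction i)
  case 0
  then show ?case by (simp add: beta_def)
next
  case (Suc i)
  define t where "t = (if par m (Suc i) = 0 then fls_X_inv - fls_const (\<Lambda> (Suc i)) else dv_res \<Lambda> (Suc i))"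
  have dt: "v_deriv t = fls_const ((-1) ^ par m (Suc i)) * (t * dv_res \<Lambda> (Suc i))"
    using par_cases[of m "Suc i"] dv_res_cancel[of \<Lambda> "Suc i"]
    by (auto simp: t_def v_deriv_dv v_deriv_dv_res mult.commute fls_const_uminus)
  have b: "beta m \<Lambda> (Suc i) = beta m \<Lambda> i * t" by (simp only: beta_Suc t_def)
  have "v_deriv (beta m \<Lambda> (Suc i)) = (\<Sum>j\<in>{1..i}. fls_const ((-1) ^ par m j) * (beta m \<Lambda> i * dv_res \<Lambda> j)) * t +
    beta m \<Lambda> i * (fls_const ((-1) ^ par m (Suc i)) * (t * dv_res \<Lambda> (Suc i)))"
    by (simp only: b v_deriv_mult Suc dt)
  also have "(\<Sum>j\<in>{1..i}. fls_const ((-1) ^ par m j) * (beta m \<Lambda> i * dv_res \<Lambda> j)) * t =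
    (\<Sum>j\<in>{1..i}. fls_const ((-1) ^ par m j) * (beta m \<Lambda> i * t * dv_res \<Lambda> j))"
    unfolding sum_distrib_right by (simp only: mult_ac)
  also have "beta m \<Lambda> i * (fls_const ((-1) ^ par m (Suc i)) * (t * dv_res \<Lambda> (Suc i))) =
    fls_const ((-1) ^ par m (Suc i)) * (beta m \<Lambda> i * t * dv_res \<Lambda> (Suc i))"
    by (simp only: mult_ac)
  finally show ?case unfolding b[symmetric] by simp
qed

text \<open>The expression F_N of the overview, with the factor \<open>beta\<close> cut off at the
  index N as well.\<close>

definition ber_symbol :: "(nat \<Rightarrow> complex) \<Rightarrow> (nat \<Rightarrow> complex) \<Rightarrow> nat \<Rightarrow> ('m::len0, 'n::len0, 'k::len0) weyl psdo" where
  "ber_symbol z \<Lambda> N = (\<Sum>(\<sigma>, f)\<in>leibniz LENGTH('k) N.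
     nsym (fls_const (of_int (sign \<sigma>)) * hpart z {1..LENGTH('k)} f) (nord {1..LENGTH('k)} \<sigma> f)
       (gpart \<Lambda> {1..LENGTH('k)} f * beta LENGTH('m) \<Lambda> N))"

lemma leibniz_restrict:
  assumes "i \<ge> 1"
  shows "{(\<sigma>, f) \<in> leibniz k i. card (fiber k f i) = 0} = leibniz k (i - 1)"
proof -
  have "card (fiber k f i) = 0 \<longleftrightarrow> (\<forall>p\<in>{1..k}. f p \<noteq> i)" for f
    by (auto simp: fiber_def card_eq_0_iff)
  moreover have "x \<le> i - Suc 0 \<longleftrightarrow> x \<le> i \<and> x \<noteq> i" for x using assms by auto
  ultimately show ?thesis
    by (auto simp: leibniz_def PiE_def Pi_def)
qed

text \<open>A weight concentrated in r = 0 removes the index \<open>i\<close> from the sum; this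
  produces F_{i-1} out of a sum over \<open>leibniz k i\<close>.\<close>

lemma sum_leibniz_restrict:
  fixes t :: "(nat \<Rightarrow> nat) \<Rightarrow> (nat \<Rightarrow> nat) \<Rightarrow> complex fls \<Rightarrow> ('m::len0, 'n::len0, 'k::len0) weyl psdo"
  assumes "i \<ge> 1" "\<And>\<sigma> f. t \<sigma> f 0 = 0"
  shows "(\<Sum>(\<sigma>, f)\<in>leibniz k i. t \<sigma> f (fls_const (of_int (sign \<sigma>) * (if card (fiber k f i) = 0 then 1 else 0)))) =
    (\<Sum>(\<sigma>, f)\<in>leibniz k (i - 1). t \<sigma> f (fls_const (of_int (sign \<sigma>))))"
proof -
  have "(\<Sum>(\<sigma>, f)\<in>leibniz k (i - 1). t \<sigma> f (fls_const (of_int (sign \<sigma>)))) =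
    (\<Sum>s\<in>{s \<in> leibniz k i. card (fiber k (snd s) i) = 0}. t (fst s) (snd s) (fls_const (of_int (sign (fst s)))))"
    unfolding leibniz_restrict[OF assms(1), symmetric] by (rule sum.cong) (auto simp: case_prod_beta)
  also have "\<dots> = (\<Sum>s\<in>leibniz k i. if card (fiber k (snd s) i) = 0 then t (fst s) (snd s) (fls_const (of_int (sign (fst s)))) else 0)"
    by (rule sum.inter_filter) (rule finite_leibniz)
  also have "\<dots> = (\<Sum>(\<sigma>, f)\<in>leibniz k i. t \<sigma> f (fls_const (of_int (sign \<sigma>) * (if card (fiber k f i) = 0 then 1 else 0))))"
    by (rule sum.cong) (auto simp: assms(2))
  finally show ?thesis ..
qed

text \<open>Transposing two positions of the fiber leaves \<open>nord\<close> unchanged for even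
  \<open>i\<close>, while the sign of the permutation flips.\<close>

lemma even_multiple_vanishes:
  fixes g :: "(nat \<Rightarrow> nat) \<Rightarrow> complex fls"
  assumes i: "i \<ge> 1" "par LENGTH('m) i = 0" and k: "k = LENGTH('k)"
  shows "(\<Sum>(\<sigma>, f)\<in>{(\<sigma>, f)\<in>leibniz k i. card (fiber k f i) \<ge> 2}.
     nsym (fls_const (of_int (sign \<sigma>)) * hpart z {1..k} f) (nord {1..k} \<sigma> f) (g f)) = (0 :: ('m::len0, 'n::len0, 'k::len0) weyl psdo)"
proof (rule sum_cancel_involution)
  let ?S2 = "{(\<sigma>, f)\<in>leibniz k i. card (fiber k f i) \<ge> 2}"
  \<comment> \<open>The chosen pair depends on \<open>f\<close> alone, which \<open>T\<close> does
    not change; therefore \<open>T\<close> is an involution.\<close>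
  define P where "P = (\<lambda>f. SOME pq. fst pq \<in> fiber k f i \<and> snd pq \<in> fiber k f i \<and> fst pq \<noteq> snd pq)"
  define T where "T = (\<lambda>(\<sigma>::nat \<Rightarrow> nat, f). (\<sigma> \<circ> transpose (fst (P f)) (snd (P f)), f))"
  fix s assume s: "s \<in> ?S2"
  obtain \<sigma> f where se: "s = (\<sigma>, f)" by (cases s)
  have S: "\<sigma> permutes {1..k}" "f \<in> {1..k} \<rightarrow>\<^sub>E {0..i}" "\<And>p. p \<in> {1..k} \<Longrightarrow> f p = 0 \<Longrightarrow> \<sigma> p = p"
    "card (fiber k f i) \<ge> 2" using s by (auto simp: se leibniz_def)
  have "\<exists>pq. fst pq \<in> fiber k f i \<and> snd pq \<in> fiber k f i \<and> fst pq \<noteq> snd pq"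
  proof -
    have "finite (fiber k f i)" "\<not> card (fiber k f i) \<le> Suc 0" using S(4) by (auto simp: fiber_def)
    then obtain x y where "x \<in> fiber k f i" "y \<in> fiber k f i" "x \<noteq> y"
      by (auto simp: card_le_Suc0_iff_eq)
    then show ?thesis by (intro exI[of _ "(x, y)"]) simp
  qed
  then have "fst (P f) \<in> fiber k f i \<and> snd (P f) \<in> fiber k f i \<and> fst (P f) \<noteq> snd (P f)"
    unfolding P_def by (rule someI_ex)
  then obtain p q where P: "P f = (p, q)" and pq: "p \<in> {1..k}" "q \<in> {1..k}" "f p = i" "f q = i" "p \<noteq> q"
    by (cases "P f") (auto simp: fiber_def)
  have T: "T s = (\<sigma> \<circ> transpose p q, f)" by (simp add: T_def se P)
  have "(\<sigma> \<circ> transpose p q) permutes {1..k}"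
    using S(1) pq by (intro permutes_compose permutes_swap_id) auto
  moreover have "(\<sigma> \<circ> transpose p q) x = x" if "x \<in> {1..k}" "f x = 0" for x
    using that S(3)[of x] pq i by (auto simp: transpose_def)
  ultimately have "T s \<in> ?S2" using S(2,4) by (simp add: T leibniz_def)
  moreover have "T (T s) = s" unfolding T by (simp add: T_def P se comp_assoc)
  moreover have "nord {1..k} (\<sigma> \<circ> transpose p q) f = (nord {1..k} \<sigma> f :: ('m, 'n, 'k) weyl)"
    using nord_swap[of "{1..k}" p q f i \<sigma>, where 'm='m and 'n='n and 'k='k] pq i by simp
  then have "(case T s of (\<sigma>, f) \<Rightarrow> nsym (fls_const (of_int (sign \<sigma>)) * hpart z {1..k} f) (nord {1..k} \<sigma> f) (g f)) =
     - (case s of (\<sigma>, f) \<Rightarrow> nsym (fls_const (of_int (sign \<sigma>)) * hpart z {1..k} f) (nord {1..k} \<sigma> f :: ('m, 'n, 'k) weyl) (g f))"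
    using sign_transpose_comp[OF S(1) _ pq(5)]
    by (simp add: T[unfolded se] se fls_const_uminus nsym_uminus1)
  ultimately show "T s \<in> ?S2 \<and> T (T s) = s \<and>
    (case T s of (\<sigma>, f) \<Rightarrow> nsym (fls_const (of_int (sign \<sigma>)) * hpart z {1..k} f) (nord {1..k} \<sigma> f) (g f)) =
     - (case s of (\<sigma>, f) \<Rightarrow> nsym (fls_const (of_int (sign \<sigma>)) * hpart z {1..k} f) (nord {1..k} \<sigma> f :: ('m, 'n, 'k) weyl) (g f))"
    by blast
qed

lemma row_exists:
  fixes z \<Lambda> :: "nat \<Rightarrow> complex"
  defines "m \<equiv> LENGTH('m::len0)" and "n \<equiv> LENGTH('n::len0)" and "k \<equiv> LENGTH('k::len0)"
  defines "A \<equiv> \<lambda>p q. (B_hat z \<Lambda> :: ('m, 'n, 'k) weyl psdo mat) $$ (p, q)"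
  assumes i: "i \<in> {1..m + n}"
  shows "\<exists>y. y (k + i - 1) = (if i \<le> m then ber_symbol z \<Lambda> (i - 1) else ber_symbol z \<Lambda> i) \<and>
    (\<forall>q<k + i. (\<Sum>p<k + i - 1. y p * A p q) + y (k + i - 1) * A (k + i - 1) q =
      (if q = k + i - 1 then if i \<le> m then ber_symbol z \<Lambda> i else ber_symbol z \<Lambda> (i - 1) else 0))"
proof (cases "i \<le> m")
  case True
  then have p0: "par m i = 0" by (simp add: par_def)
  have i1: "{1..i} = insert i {1..<i}" "{1..i - 1} = {1..<i}" using i by auto
  \<comment> \<open>\<open>y_last\<close> is to be F_{i-1}, so \<open>u\<close> is the indicator of
    r = 0, and \<open>weight_x\<close> at r = 0 forces \<open>\<omega> 1 = -1\<close>. The series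
    \<gamma> does not involve the index \<open>i\<close>, hence \<open>e i = 0\<close>.\<close>
  interpret row_cofactors z \<Lambda> "\<lambda>r. if r = 1 then -1 else 0" "\<lambda>r. if r = 0 then 1 else 0" "beta m \<Lambda> (i - 1)"
    i m n k "\<lambda>j. if j < i then (-1) ^ par m j else 0" "TYPE(('m, 'n, 'k) weyl)"
  proof
    have "v_deriv (beta m \<Lambda> (i - 1)) = (\<Sum>j\<in>{1..<i}. fls_const ((-1) ^ par m j) * (beta m \<Lambda> (i - 1) * dv_res \<Lambda> j))"
      unfolding v_deriv_beta i1 ..
    also have "\<dots> = (\<Sum>j\<in>{1..<i}. fls_const (if j < i then (-1) ^ par m j else 0) * (beta m \<Lambda> (i - 1) * dv_res \<Lambda> j))"
      by (rule sum.cong) auto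
    finally show "v_deriv (beta m \<Lambda> (i - 1)) =
      (\<Sum>j\<in>{1..i}. fls_const (if j < i then (-1) ^ par m j else 0) * (beta m \<Lambda> (i - 1) * dv_res \<Lambda> j))"
      unfolding i1(1) by simp
  qed (use i p0 in \<open>auto simp: m_def n_def k_def\<close>)
  have b: "beta m \<Lambda> (i - 1) * (fls_X_inv - fls_const (\<Lambda> i)) = beta m \<Lambda> i"
    using beta_Suc[of m \<Lambda> "i - 1"] i p0 by simp
  have "y_last = ber_symbol z \<Lambda> (i - 1)"
    unfolding y_last_def signed_def ber_symbol_def m_def[symmetric] k_def[symmetric]
    by (rule sum_leibniz_restrict[of i "\<lambda>\<sigma> f c. nsym (c * hpart z K f) (nord K \<sigma> f) (gpart \<Lambda> K f * beta m \<Lambda> (i - 1))"])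
      (use i in auto)
  then have 1: "y_row (k + i - 1) = ber_symbol z \<Lambda> (i - 1)" by (simp only: y_row_simps)
  let ?t = "\<lambda>(\<sigma>, f). nsym (fls_const (of_int (sign \<sigma>)) * hpart z K f) (nord K \<sigma> f) (gpart \<Lambda> K f * beta m \<Lambda> i) :: ('m, 'n, 'k) weyl psdo"
  \<comment> \<open>The weight \<open>u r - r * \<omega> r\<close> is 1 for r = 0 and r = 1, and 0
    beyond. The omitted terms with r \<ge> 2 add up to 0, so the complete sum F_i results.\<close>
  have "y_rhs = (\<Sum>s\<in>S. if \<not> 2 \<le> r (snd s) then ?t s else 0)"
    unfolding y_rhs_def b
  proof (rule sum.cong[OF refl])
    fix s assume "s \<in> S"
    obtain \<sigma> f where s: "s = (\<sigma>, f)" by (cases s)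
    consider "r f = 0" | "r f = 1" | "2 \<le> r f" by linarith
    then show "(case s of (\<sigma>, f) \<Rightarrow> nsym (signed \<sigma> ((if r f = 0 then 1 else 0) - of_nat (r f) * (if r f = 1 then -1 else 0)) (hpart z K f))
        (nord K \<sigma> f) (gpart \<Lambda> K f * beta m \<Lambda> i)) = (if \<not> 2 \<le> r (snd s) then ?t s else 0)"
      by cases (simp_all add: s signed_def)
  qed
  also have "\<dots> = (\<Sum>s\<in>{s\<in>S. \<not> 2 \<le> r (snd s)}. ?t s)"
    by (rule sum.inter_filter[symmetric]) (rule finite_leibniz)
  also have "\<dots> = (\<Sum>s\<in>S. ?t s) - (\<Sum>s\<in>{s\<in>S. 2 \<le> r (snd s)}. ?t s)"
  proof -
    have "S = {s\<in>S. \<not> 2 \<le> r (snd s)} \<union> {s\<in>S. 2 \<le> r (snd s)}" by auto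
    then have "(\<Sum>s\<in>S. ?t s) = (\<Sum>s\<in>{s\<in>S. \<not> 2 \<le> r (snd s)} \<union> {s\<in>S. 2 \<le> r (snd s)}. ?t s)" by simp
    also have "\<dots> = (\<Sum>s\<in>{s\<in>S. \<not> 2 \<le> r (snd s)}. ?t s) + (\<Sum>s\<in>{s\<in>S. 2 \<le> r (snd s)}. ?t s)"
      by (rule sum.union_disjoint) (auto simp: finite_leibniz)
    finally have "(\<Sum>s\<in>S. ?t s) = (\<Sum>s\<in>{s\<in>S. \<not> 2 \<le> r (snd s)}. ?t s) + (\<Sum>s\<in>{s\<in>S. 2 \<le> r (snd s)}. ?t s)" .
    then show ?thesis by simp
  qed
  also have "(\<Sum>s\<in>{s\<in>S. 2 \<le> r (snd s)}. ?t s) = 0"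
  proof -
    have "{s\<in>S. 2 \<le> r (snd s)} = {(\<sigma>, f)\<in>S. r f \<ge> 2}" by auto
    then show ?thesis
      using even_multiple_vanishes[of i k z "\<lambda>f. gpart \<Lambda> K f * beta m \<Lambda> i", where 'm='m and 'n='n and 'k='k] i p0
      by (simp add: m_def k_def)
  qed
  finally have 2: "y_rhs = ber_symbol z \<Lambda> i" by (simp add: ber_symbol_def m_def k_def)
  show ?thesis
    by (rule exI[of _ y_row]) (use True 1 2 row_equation in \<open>auto simp: A_def\<close>)
next
  case False
  then have p1: "par m i = 1" by (simp add: par_def)
  \<comment> \<open>\<open>y_last\<close> is to be F_i, so \<open>u\<close> is constantly 1 and
    \<gamma> includes the odd factor of index \<open>i\<close>, with \<open>e i = -1\<close>. Then
    \<open>weight_v\<close> reads - r * \<omega> r = -1.\<close>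
  interpret row_cofactors z \<Lambda> "\<lambda>r. 1 / of_nat r" "\<lambda>r. 1" "beta m \<Lambda> i"
    i m n k "\<lambda>j. (-1) ^ par m j" "TYPE(('m, 'n, 'k) weyl)"
  proof
    show "v_deriv (beta m \<Lambda> i) = (\<Sum>j\<in>{1..i}. fls_const ((-1) ^ par m j) * (beta m \<Lambda> i * dv_res \<Lambda> j))"
      by (rule v_deriv_beta)
    show "1 / of_nat r * ((-1) ^ par m i - (of_nat r - 1)) = (-1) ^ par m i * (1 :: complex)" if "r \<ge> 1" for r :: nat
      using that by (simp add: p1 field_simps)
    show "1 / of_nat (r + 1) * (1 - (-1) ^ par m i * of_nat r) + (-1) ^ par m i * (1 :: complex) = 0" for r :: nat
    proof -
      have "of_nat (r + 1) \<noteq> (0 :: complex)" using of_nat_neq_0[of r] by simp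
      then show ?thesis by (simp add: p1 field_simps)
    qed
  qed (use i p1 in \<open>auto simp: m_def n_def k_def\<close>)
  have b: "beta m \<Lambda> i * (fls_X_inv - fls_const (\<Lambda> i)) = beta m \<Lambda> (i - 1)"
    using beta_Suc[of m \<Lambda> "i - 1"] i p1 dv_res_cancel[of \<Lambda> i] by (simp add: mult.assoc)
  have 1: "y_row (k + i - 1) = ber_symbol z \<Lambda> i"
    unfolding y_row_simps(3) y_last_def signed_def ber_symbol_def m_def[symmetric] k_def[symmetric] by simp
  \<comment> \<open>The weight in \<open>y_rhs\<close> is the indicator of r = 0, so only terms
    without the index \<open>i\<close> remain. At 0 the value \<open>1 / 0 = 0\<close> enters
    multiplied by 0.\<close>
  have "1 - of_nat x * (1 / of_nat x) = (if x = 0 then 1 else 0 :: complex)" for x :: nat by simp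
  then have "y_rhs = ber_symbol z \<Lambda> (i - 1)"
    unfolding y_rhs_def signed_def ber_symbol_def m_def[symmetric] k_def[symmetric] b
    using sum_leibniz_restrict[of i "\<lambda>\<sigma> f c. nsym (c * hpart z K f) (nord K \<sigma> f) (gpart \<Lambda> K f * beta m \<Lambda> (i - 1)) :: ('m, 'n, 'k) weyl psdo" k]
      i by simp
  then show ?thesis
    by (intro exI[of _ y_row]) (use False 1 row_equation in \<open>auto simp: A_def\<close>)
qed

section \<open>Invertibility of the top-left blocks\<close>

lemma psdo_v_minus_scal: "psdo_v - psdo_scal c = v_series (fls_X_inv - fls_const c)"
proof -
  have "fls_X_inv - fls_const c = fls_X_inv + - fls_const c" by simp
  then show ?thesis by (simp only: v_series_add v_series_uminus v_series_v v_series_const) simp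
qed

lemma order_le_psdo_of: "order_le 0 (psdo_of a)"
  by (simp add: psdo_of_def order_le_monom)

lemma order_le_off_diagonal:
  assumes "p < LENGTH('k) + (LENGTH('m) + LENGTH('n))" "q < LENGTH('k) + (LENGTH('m) + LENGTH('n))" "p \<noteq> q"
  shows "order_le 0 ((B_hat z \<Lambda> :: ('m::len0, 'n::len0, 'k::len0) weyl psdo mat) $$ (p, q))"
proof -
  have "order_le 0 ((-1) ^ par LENGTH('m) i * psdo_of a :: ('m, 'n, 'k) weyl psdo)" for i a
    using par_cases[of "LENGTH('m)" i] order_le_psdo_of[of a] order_le_uminus[OF order_le_psdo_of[of a]] by auto
  then show ?thesis
    unfolding B_hat_entry[OF assms(1,2)] using assms(3) by (auto intro: order_le_psdo_of)
qed

text \<open>In the first \<open>k\<close> rows nothing stands to the left of the diagonal, so the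
  Schur complement is v - z, a unit in the series in v. From then on it is \<partial>_v minus an
  operator of order at most 0, provided the inverse block has order at most 0. The bound on
  \<open>e\<close> preserves this provision for the next size.\<close>

lemma schur_B_hat:
  fixes z \<Lambda> :: "nat \<Rightarrow> complex" and B :: "nat \<Rightarrow> nat \<Rightarrow> ('m::len0, 'n::len0, 'k::len0) weyl psdo"
  defines "A \<equiv> \<lambda>p q. (B_hat z \<Lambda> :: ('m, 'n, 'k) weyl psdo mat) $$ (p, q)"
  assumes l: "l < LENGTH('k) + (LENGTH('m) + LENGTH('n))"
    and B: "\<And>p q. p < l \<Longrightarrow> q < l \<Longrightarrow> order_le 0 (B p q)"
  shows "\<exists>e. order_le 0 e \<and> schur l A B * e = 1 \<and> e * schur l A B = 1 \<and>
    (l < LENGTH('k) \<longrightarrow> schur l A B = psdo_v - psdo_scal (z (Suc l)))"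
proof (cases "l < LENGTH('k)")
  case True
  have "A l p = 0" if "p < l" for p
    using True that unfolding A_def by (subst B_hat_entry) auto
  then have s: "schur l A B = psdo_v - psdo_scal (z (Suc l))"
    using True unfolding schur_def by (simp add: A_def B_hat_entry)
  define e where "e = (v_series (inverse (fls_X_inv - fls_const (z (Suc l)))) :: ('m, 'n, 'k) weyl psdo)"
  have "order_le 0 e" by (simp add: e_def v_series_def order_le_monom)
  moreover have "schur l A B * e = 1" "e * schur l A B = 1"
    unfolding s psdo_v_minus_scal e_def v_series_mult[symmetric]
    using dv_minus_const_nz[of "z (Suc l)"] by simp_all
  ultimately show ?thesis using s by blast
next
  case False
  define S where "S = (\<Sum>p<l. \<Sum>q<l. A l p * B p q * A q l)"
  define G where "G = psdo_scal (\<Lambda> (Suc (l - LENGTH('k)))) + S"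
  have "A l l = psdo_dv - psdo_scal (\<Lambda> (Suc (l - LENGTH('k))))"
    using False l unfolding A_def by (subst B_hat_entry) auto
  then have s: "schur l A B = psdo_dv - G" unfolding schur_def G_def S_def[symmetric] by simp
  have "order_le 0 (A l p * B p q * A q l)" if "p < l" "q < l" for p q
    unfolding A_def using that l by (intro order_le_mult_0 B order_le_off_diagonal) auto
  then have "order_le 0 S" unfolding S_def by (intro order_le_sum) auto
  then have "order_le 0 G" unfolding G_def psdo_scal_def by (intro order_le_add order_le_psdo_of)
  then obtain e where "order_le 0 e" "(psdo_dv - G) * e = 1" "e * (psdo_dv - G) = 1"
    by (rule dv_plus_inverse)
  then show ?thesis using False s by auto
qed

text \<open>The order bound is part of the induction because invertibility of the next Schur
  complement rests on it.\<close>

lemma inverse_exists: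
  fixes z \<Lambda> :: "nat \<Rightarrow> complex"
  defines "A \<equiv> \<lambda>p q. (B_hat z \<Lambda> :: ('m::len0, 'n::len0, 'k::len0) weyl psdo mat) $$ (p, q)"
  assumes "l \<le> LENGTH('k) + (LENGTH('m) + LENGTH('n))"
  shows "\<exists>B. inverse_on l A B \<and> (\<forall>p<l. \<forall>q<l. order_le 0 (B p q))"
  using assms(2)
proof (induction l)
  case 0
  then show ?case by (simp add: inverse_on_def)
next
  case (Suc l)
  then obtain B where B: "inverse_on l A B" "\<And>p q. p < l \<Longrightarrow> q < l \<Longrightarrow> order_le 0 (B p q)" by auto
  obtain e where e: "order_le 0 e" "schur l A B * e = 1" "e * schur l A B = 1"
    using schur_B_hat[of l B z \<Lambda>] B(2) Suc.prems unfolding A_def by auto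
  have col: "order_le 0 (\<Sum>q<l. B p q * A q l)" if "p < l" for p
    unfolding A_def using that Suc.prems by (intro order_le_sum order_le_mult_0 B order_le_off_diagonal) auto
  have row: "order_le 0 (\<Sum>q<l. A l q * B q r)" if "r < l" for r
    unfolding A_def using that Suc.prems by (intro order_le_sum order_le_mult_0 B order_le_off_diagonal) auto
  have "order_le 0 (extend_inverse l A B e p r)" if "p < Suc l" "r < Suc l" for p r
    unfolding extend_inverse_def Let_def
    using that e(1) by (auto intro!: order_le_add order_le_uminus order_le_mult_0 B col row)
  then show ?case using inverse_on_extend[OF B(1) e(2,3)] by blast
qed

text \<open>Without any index, \<open>f\<close> is 0 everywhere and \<sigma> is the
  identity.\<close>

lemma ber_symbol_0:
  "(ber_symbol z \<Lambda> 0 :: ('m::len0, 'n::len0, 'k::len0) weyl psdo) =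
    v_series (\<Prod>p\<in>{1..LENGTH('k)}. fls_X_inv - fls_const (z p))"
proof -
  let ?K = "{1..LENGTH('k)}"
  define f where "f = (\<lambda>p\<in>?K. 0 :: nat)"
  have f: "g = f" if "g \<in> ?K \<rightarrow>\<^sub>E {0..0}" for g
    unfolding f_def using that by (intro extensionalityI[of _ ?K]) (auto simp: PiE_def Pi_def)
  have id: "\<sigma> = id" if "\<sigma> permutes ?K" "\<forall>p\<in>?K. \<sigma> p = p" for \<sigma>
    using that by (auto simp: fun_eq_iff permutes_def)
  have "leibniz LENGTH('k) 0 = {(id, f)}"
  proof
    show "leibniz LENGTH('k) 0 \<subseteq> {(id, f)}"
    proof
      fix s assume "s \<in> leibniz LENGTH('k) 0"
      then obtain \<sigma> g where s: "s = (\<sigma>, g)" "\<sigma> permutes ?K" "g \<in> ?K \<rightarrow>\<^sub>E {0..0}"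
        "\<forall>p\<in>?K. g p = 0 \<longrightarrow> \<sigma> p = p"
        by (auto simp: leibniz_def)
      have "g = f" by (rule f[OF s(3)])
      then have "\<forall>p\<in>?K. \<sigma> p = p" using s(4) by (simp add: f_def)
      then show "s \<in> {(id, f)}" using id[OF s(2)] \<open>g = f\<close> s(1) by simp
    qed
    show "{(id, f)} \<subseteq> leibniz LENGTH('k) 0"
      by (auto simp: leibniz_def f_def permutes_id)
  qed
  moreover have "hpart z ?K f = (\<Prod>p\<in>?K. fls_X_inv - fls_const (z p))"
    unfolding hpart_def by (rule prod.cong) (auto simp: f_def)
  moreover have "gpart \<Lambda> ?K f = 1"
    unfolding gpart_def by (rule prod.neutral) (auto simp: f_def)
  moreover have "nord A \<sigma> f = (1 :: ('m, 'n, 'k) weyl)" if "finite A" "A \<subseteq> ?K" for A \<sigma>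
    using that by (induction A) (auto simp: nord_insert f_def)
  ultimately show ?thesis
    by (simp add: ber_symbol_def sign_id beta_def nsym_def)
qed

section \<open>The product of the quasi-minors\<close>

lemma s_hat_nth:
  "l < k + m \<Longrightarrow> s_hat m n k ! l = 1"
  "k + m \<le> l \<Longrightarrow> l < k + (m + n) \<Longrightarrow> s_hat m n k ! l = -1"
  by (auto simp: s_hat_def nth_append)

lemma int_pow_1 [simp]: "int_pow x 1 = x"
  by (simp add: int_pow_def)

lemma int_pow_m1: "x * y = 1 \<Longrightarrow> y * x = 1 \<Longrightarrow> int_pow x (-1) = y"
  by (simp add: int_pow_def two_sided_inv_eq)

lemma Ber_B_hat:
  "Ber (s_hat LENGTH('m) LENGTH('n) LENGTH('k)) (B_hat z \<Lambda> :: ('m::len0, 'n::len0, 'k::len0) weyl psdo mat) =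
    ber_symbol z \<Lambda> (LENGTH('m) + LENGTH('n))"
proof -
  define m where "m = LENGTH('m)"
  define n where "n = LENGTH('n)"
  define k where "k = LENGTH('k)"
  define M where "M = (B_hat z \<Lambda> :: ('m, 'n, 'k) weyl psdo mat)"
  define A where "A = (\<lambda>p q. M $$ (p, q))"
  define P where "P l = (\<Prod>i\<leftarrow>[1..<Suc l]. int_pow (quasi_minor i M) (s_hat m n k ! (i - 1)))" for l
  have P_Suc: "P (Suc l) = P l * int_pow (quasi_minor (Suc l) M) (s_hat m n k ! l)" for l
    by (simp add: P_def)
  have step: "\<exists>B d e. inverse_on l A B \<and> schur l A B = d \<and> d * e = 1 \<and> e * d = 1 \<and> quasi_minor (Suc l) M = d
      \<and> (l < k \<longrightarrow> d = psdo_v - psdo_scal (z (Suc l)))" if l: "l < k + (m + n)" for l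
  proof -
    obtain B where B: "inverse_on l A B" "\<And>p q. p < l \<Longrightarrow> q < l \<Longrightarrow> order_le 0 (B p q)"
      using inverse_exists[of l z \<Lambda>, where 'm='m and 'n='n and 'k='k] l
      by (auto simp: A_def M_def m_def n_def k_def)
    obtain e where e: "schur l A B * e = 1" "e * schur l A B = 1"
      and s: "l < k \<Longrightarrow> schur l A B = psdo_v - psdo_scal (z (Suc l))"
      using schur_B_hat[of l B z \<Lambda>] l B(2) by (auto simp: A_def M_def m_def n_def k_def)
    have "quasi_minor (Suc l) M = schur l A B"
      using B(1) e unfolding A_def by (rule quasi_minor_schur)
    then show ?thesis using B(1) e s by blast
  qed
  have P1: "P l = v_series (\<Prod>p\<in>{1..l}. fls_X_inv - fls_const (z p))" if "l \<le> k" for l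
    using that
  proof (induction l)
    case (Suc l)
    then have "quasi_minor (Suc l) M = psdo_v - psdo_scal (z (Suc l))" using step[of l] by auto
    then show ?case
      using Suc by (simp add: P_Suc s_hat_nth psdo_v_minus_scal mult.commute flip: v_series_mult)
  qed (simp add: P_def)
  have "P (k + i) = ber_symbol z \<Lambda> i" if "i \<le> m + n" for i
    using that
  proof (induction i)
    case 0
    show ?case using P1[of k] by (simp add: ber_symbol_0 k_def)
  next
    case (Suc i)
    obtain B d e where B: "inverse_on (k + i) A B" "schur (k + i) A B = d" "d * e = 1" "e * d = 1"
      "quasi_minor (Suc (k + i)) M = d"
      using step[of "k + i"] Suc.prems by auto
    have "Suc i \<in> {1..LENGTH('m) + LENGTH('n)}" using Suc.prems by (auto simp: m_def n_def)
    then have "\<exists>y. y (k + i) = (if Suc i \<le> m then ber_symbol z \<Lambda> i else ber_symbol z \<Lambda> (Suc i)) \<and>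
      (\<forall>q<k + Suc i. (\<Sum>p<k + i. y p * A p q) + y (k + i) * A (k + i) q =
      (if q = k + i then if Suc i \<le> m then ber_symbol z \<Lambda> (Suc i) else ber_symbol z \<Lambda> i else 0))"
      using row_exists[of "Suc i" z \<Lambda>, where 'm='m and 'n='n and 'k='k]
      by (simp only: A_def M_def m_def k_def add_Suc_right diff_Suc_1)
    then obtain y where y: "y (k + i) = (if Suc i \<le> m then ber_symbol z \<Lambda> i else ber_symbol z \<Lambda> (Suc i))"
      "\<And>q. q < k + Suc i \<Longrightarrow> (\<Sum>p<k + i. y p * A p q) + y (k + i) * A (k + i) q =
      (if q = k + i then if Suc i \<le> m then ber_symbol z \<Lambda> (Suc i) else ber_symbol z \<Lambda> i else 0)"
      by blast
    have yd: "y (k + i) * d = (if Suc i \<le> m then ber_symbol z \<Lambda> (Suc i) else ber_symbol z \<Lambda> i)"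
      unfolding B(2)[symmetric]
    proof (rule row_mult_schur[OF B(1)])
      show "(\<Sum>p<k + i. y p * A p q) + y (k + i) * A (k + i) q = 0" if "q < k + i" for q
        using y(2)[of q] that by simp
      show "(\<Sum>p<k + i. y p * A p (k + i)) + y (k + i) * A (k + i) (k + i) =
        (if Suc i \<le> m then ber_symbol z \<Lambda> (Suc i) else ber_symbol z \<Lambda> i)"
        using y(2)[of "k + i"] by simp
    qed
    have IH: "P (k + i) = ber_symbol z \<Lambda> i" using Suc by simp
    show ?case
    proof (cases "Suc i \<le> m")
      case True
      then show ?thesis using yd y(1) B(5) P_Suc[of "k + i"] IH by (simp add: s_hat_nth)
    next
      case False
      have "int_pow d (s_hat m n k ! (k + i)) = e"
        using False Suc.prems int_pow_m1[OF B(3,4)] by (simp add: s_hat_nth)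
      then have "P (k + Suc i) = ber_symbol z \<Lambda> i * e" using P_Suc[of "k + i"] B(5) IH by simp
      also have "\<dots> = ber_symbol z \<Lambda> (Suc i) * (d * e)" using False yd y(1) by (simp add: mult.assoc[symmetric])
      finally show ?thesis by (simp add: B(3))
    qed
  qed
  from this[of "m + n"] show ?thesis
    by (simp add: Ber_def P_def M_def m_def n_def k_def)
qed

section \<open>Permutations within fibers\<close>

text \<open>A pair (i, a) stands for the generator x_{i,a} or \<partial>_{i,a}. Sorting is by a, and
  a sign arises only where two odd generators pass each other.\<close>

definition crossings :: "nat \<Rightarrow> nat \<times> nat \<Rightarrow> (nat \<times> nat) list \<Rightarrow> nat" where
  "crossings m e es = length (filter (\<lambda>e'. snd e' < snd e \<and> m < fst e \<and> m < fst e') es)"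

fun odd_inversions :: "nat \<Rightarrow> (nat \<times> nat) list \<Rightarrow> nat" where
  "odd_inversions m [] = 0"
| "odd_inversions m (e # es) = crossings m e es + odd_inversions m es"

text \<open>\<open>G\<close> is any family with the sign rule of the generators, so one argument
  serves the x and the derivatives.\<close>

lemma prod_list_insort_key:
  fixes G :: "nat \<times> nat \<Rightarrow> 'a::ring_1"
  assumes comm: "\<And>e e'. G e * G e' = (-1) ^ (par m (fst e) * par m (fst e')) * (G e' * G e)"
    and "sorted (map snd es)"
  shows "G e * prod_list (map G es) = (-1) ^ crossings m e es * prod_list (map G (insort_key snd e es))"
  using assms(2)
proof (induction es)
  case (Cons y es)
  show ?case
  proof (cases "snd e \<le> snd y")
    case True
    then have "crossings m e (y # es) = 0" using Cons.prems by (auto simp: crossings_def filter_empty_conv)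
    then show ?thesis using True by simp
  next
    case False
    have c: "crossings m e (y # es) = par m (fst e) * par m (fst y) + crossings m e es"
      using False by (auto simp: crossings_def par_def)
    have sg: "G y * ((-1) ^ a * x) = (-1) ^ a * (G y * x)" for a :: nat and x
      by (cases "even a") auto
    have "G e * prod_list (map G (y # es)) = (G e * G y) * prod_list (map G es)" by (simp add: mult.assoc)
    also have "\<dots> = (-1) ^ (par m (fst e) * par m (fst y)) * (G y * (G e * prod_list (map G es)))"
      unfolding comm[of e y] by (simp only: mult.assoc)
    also have "G e * prod_list (map G es) = (-1) ^ crossings m e es * prod_list (map G (insort_key snd e es))"
      using Cons by simp
    finally show ?thesis using False unfolding sg c by (simp add: power_add mult.assoc)
  qed
qed (simp add: crossings_def)

lemma prod_list_sort_key:
  fixes G :: "nat \<times> nat \<Rightarrow> 'a::ring_1"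
  assumes comm: "\<And>e e'. G e * G e' = (-1) ^ (par m (fst e) * par m (fst e')) * (G e' * G e)"
  shows "prod_list (map G es) = (-1) ^ odd_inversions m es * prod_list (map G (sort_key snd es))"
proof (induction es)
  case (Cons e es)
  have sg: "G e * ((-1) ^ a * x) = (-1) ^ a * (G e * x)" for a :: nat and x
    by (cases "even a") auto
  have "crossings m e (sort_key snd es) = crossings m e es"
  proof -
    have "mset (filter P (sort_key snd es)) = mset (filter P es)" for P by simp
    then show ?thesis unfolding crossings_def by (simp only: size_mset[symmetric])
  qed
  then have "G e * prod_list (map G (sort_key snd es)) =
      (-1) ^ crossings m e es * prod_list (map G (insort_key snd e (sort_key snd es)))"
    using prod_list_insort_key[OF comm, of "sort_key snd es" e] by simp
  then show ?case using Cons sg by (simp add: power_add mult.assoc[symmetric] power_commutes)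
    (metis (no_types, lifting) mult.assoc power_add add.commute)
qed simp

lemma sort_key_graph:
  assumes "distinct (map snd es)" "set (map snd es) = A" "\<And>e. e \<in> set es \<Longrightarrow> fst e = j (snd e)"
  shows "sort_key snd es = map (\<lambda>q. (j q, q)) (sorted_list_of_set A)"
proof -
  have "finite A" using assms(2) by (metis List.finite_set)
  have "distinct (map snd (sort_key snd es))"
    using assms(1) by (metis (no_types, lifting) distinct_map distinct_sort set_sort)
  then have "map snd (sort_key snd es) = sorted_list_of_set A"
    using assms(2) \<open>finite A\<close> by (intro sorted_distinct_set_unique) auto
  then have "map (\<lambda>q. (j q, q)) (sorted_list_of_set A) = map (\<lambda>q. (j q, q)) (map snd (sort_key snd es))"
    by (simp only:)
  also have "\<dots> = map (\<lambda>e. (j (snd e), snd e)) (sort_key snd es)" by (simp add: comp_def)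
  also have "\<dots> = sort_key snd es" by (rule map_idI) (use assms(3) in \<open>force simp: prod_eq_iff\<close>)
  finally show ?thesis ..
qed

text \<open>\<open>R\<close> is the order in which the list is written: (<) for the x, and (>) for
  the derivatives, which come in reverse.\<close>

lemma odd_inversions_card:
  assumes "sorted_wrt R L" "distinct L" "\<And>x y. R x y \<Longrightarrow> \<not> R y x"
  shows "odd_inversions m (map h L) =
    card {(p, p'). p \<in> set L \<and> p' \<in> set L \<and> R p p' \<and> snd (h p') < snd (h p) \<and> m < fst (h p) \<and> m < fst (h p')}"
  using assms(1,2)
proof (induction L)
  case (Cons a L)
  let ?Q = "\<lambda>p p'. snd (h p') < snd (h p) \<and> m < fst (h p) \<and> m < fst (h p')"
  let ?S = "\<lambda>L. {(p, p'). p \<in> set L \<and> p' \<in> set L \<and> R p p' \<and> ?Q p p'}"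
  have fin: "finite (?S L)" by (rule finite_subset[of _ "set L \<times> set L"]) auto
  have S: "?S (a # L) = Pair a ` {p' \<in> set L. ?Q a p'} \<union> ?S L"
    using Cons.prems assms(3) by (auto simp: image_iff)
  have "card (?S (a # L)) = card (Pair a ` {p' \<in> set L. ?Q a p'}) + card (?S L)"
    unfolding S by (rule card_Un_disjoint) (use fin Cons.prems in auto)
  also have "card (Pair a ` {p' \<in> set L. ?Q a p'}) = card (set (filter (?Q a) L))"
    by (subst card_image) (auto simp: inj_on_def)
  also have "\<dots> = crossings m (h a) (map h L)"
    using Cons.prems by (simp add: crossings_def filter_map comp_def distinct_card del: set_filter)
  finally show ?case using Cons by simp
qed simp

text \<open>Wrapping from the inside outwards lists the derivatives in the reverse order of the
  x.\<close>

lemma nord_list: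
  assumes "distinct L" "\<And>a. a \<in> set L \<Longrightarrow> f a \<noteq> 0"
  shows "nord (set L) \<sigma> f = prod_list (map (\<lambda>a. weyl_x (f a) (\<sigma> a)) L) * prod_list (map (\<lambda>a. weyl_d (f a) a) (rev L) :: ('m::len0, 'n::len0, 'k::len0) weyl list)"
  using assms
proof (induction L)
  case (Cons a L)
  then have "f a \<noteq> 0" by simp
  then have n: "nord (insert a (set L)) \<sigma> f = weyl_x (f a) (\<sigma> a) * nord (set L) \<sigma> f * (weyl_d (f a) a :: ('m, 'n, 'k) weyl)"
    using Cons.prems(1) by (simp add: nord_insert)
  have "nord (set L) \<sigma> f = prod_list (map (\<lambda>a. weyl_x (f a) (\<sigma> a)) L) * prod_list (map (\<lambda>a. weyl_d (f a) a) (rev L) :: ('m, 'n, 'k) weyl list)"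
    by (rule Cons.IH) (use Cons.prems in auto)
  then show ?case by (simp add: n mult.assoc)
qed simp

text \<open>Sorting the x gives one sign for each odd pair that \<sigma> inverts; turning round the
  derivatives gives one for every odd pair. The inverted pairs drop out of the product, and the odd
  pairs kept in order by \<sigma> remain. This explains why sgn(\<open>j\<^sub>1\<close>,
  \<open>j\<^sub>2\<close>) counts pairs with \<sigma> s < \<sigma> s' and not inversions.\<close>

lemma nord_sorted:
  assumes A: "finite A" and \<sigma>: "\<sigma> permutes A" and f: "\<And>a. a \<in> A \<Longrightarrow> f a \<noteq> 0"
    and j: "\<And>a. a \<in> A \<Longrightarrow> j (\<sigma> a) = f a"
  shows "nord A \<sigma> f = (-1) ^ card {(p, p'). p \<in> A \<and> p' \<in> A \<and> p < p' \<and> \<sigma> p < \<sigma> p' \<and>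
      LENGTH('m) < f p \<and> LENGTH('m) < f p'} *
    (x_mono A j * d_mono A f :: ('m::len0, 'n::len0, 'k::len0) weyl)"
proof -
  let ?m = "LENGTH('m)"
  define L where "L = sorted_list_of_set A"
  have L: "distinct L" "set L = A" "sorted_wrt (<) L"
    using A by (simp_all add: L_def)
  let ?Gx = "\<lambda>(i, q). weyl_x i q :: ('m, 'n, 'k) weyl"
  let ?Gd = "\<lambda>(i, q). weyl_d i q :: ('m, 'n, 'k) weyl"
  let ?odd = "\<lambda>p p'. ?m < f p \<and> ?m < f p'"
  have cx: "?Gx e * ?Gx e' = (-1) ^ (par ?m (fst e) * par ?m (fst e')) * (?Gx e' * ?Gx e)" for e e'
    unfolding case_prod_beta by (rule weyl_x_x)
  have cd: "?Gd e * ?Gd e' = (-1) ^ (par ?m (fst e) * par ?m (fst e')) * (?Gd e' * ?Gd e)" for e e'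
    unfolding case_prod_beta by (rule weyl_d_d)
  define xs where "xs = map (\<lambda>a. (f a, \<sigma> a)) L"
  define ds where "ds = map (\<lambda>a. (f a, a)) (rev L)"
  have inj: "inj_on \<sigma> A" using \<sigma> by (simp add: permutes_inj_on)
  have sx: "sort_key snd xs = map (\<lambda>q. (j q, q)) L"
    unfolding L_def
    by (rule sort_key_graph) (use L inj \<sigma> j in \<open>auto simp: xs_def comp_def distinct_map permutes_image\<close>)
  have sd: "sort_key snd ds = map (\<lambda>q. (f q, q)) L"
    unfolding L_def by (rule sort_key_graph) (use L in \<open>auto simp: ds_def comp_def\<close>)
  have ix: "odd_inversions ?m xs = card {(p, p'). p \<in> A \<and> p' \<in> A \<and> p < p' \<and> \<sigma> p' < \<sigma> p \<and> ?odd p p'}"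
    unfolding xs_def using odd_inversions_card[OF L(3,1), of ?m "\<lambda>a. (f a, \<sigma> a)"] L(2) by simp
  have "odd_inversions ?m ds = card {(p, p'). p \<in> A \<and> p' \<in> A \<and> p' < p \<and> p' < p \<and> ?odd p p'}"
    unfolding ds_def using odd_inversions_card[of "(>)" "rev L" ?m "\<lambda>a. (f a, a)"] L
    by (simp add: sorted_wrt_rev)
  also have "\<dots> = card {(p, p'). p \<in> A \<and> p' \<in> A \<and> p < p' \<and> ?odd p p'}"
    by (rule bij_betw_same_card[of prod.swap]) (auto simp: bij_betw_def inj_on_def image_iff)
  also have "{(p, p'). p \<in> A \<and> p' \<in> A \<and> p < p' \<and> ?odd p p'} =
      {(p, p'). p \<in> A \<and> p' \<in> A \<and> p < p' \<and> \<sigma> p' < \<sigma> p \<and> ?odd p p'} \<union>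
      {(p, p'). p \<in> A \<and> p' \<in> A \<and> p < p' \<and> \<sigma> p < \<sigma> p' \<and> ?odd p p'}"
    using inj by (auto simp: inj_on_def) (metis linorder_neqE_nat less_irrefl)+
  also have "card \<dots> = odd_inversions ?m xs + card {(p, p'). p \<in> A \<and> p' \<in> A \<and> p < p' \<and> \<sigma> p < \<sigma> p' \<and> ?odd p p'}"
    unfolding ix by (rule card_Un_disjoint) (auto intro: finite_subset[OF _ finite_cartesian_product[OF A A]])
  finally have id: "odd_inversions ?m ds = odd_inversions ?m xs +
      card {(p, p'). p \<in> A \<and> p' \<in> A \<and> p < p' \<and> \<sigma> p < \<sigma> p' \<and> ?odd p p'}" .
  have X: "prod_list (map (\<lambda>a. weyl_x (f a) (\<sigma> a)) L) = (-1) ^ odd_inversions ?m xs * (x_mono A j :: ('m, 'n, 'k) weyl)"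
    using prod_list_sort_key[OF cx, of xs] unfolding sx by (simp add: xs_def comp_def x_mono_def L_def)
  have D: "prod_list (map (\<lambda>a. weyl_d (f a) a) (rev L)) = (-1) ^ odd_inversions ?m ds * (d_mono A f :: ('m, 'n, 'k) weyl)"
    using prod_list_sort_key[OF cd, of ds] unfolding sd by (simp add: ds_def comp_def d_mono_def L_def)
  have "nord A \<sigma> f = (-1) ^ odd_inversions ?m xs * x_mono A j * ((-1) ^ odd_inversions ?m ds * d_mono A f :: ('m, 'n, 'k) weyl)"
    using nord_list[of L f \<sigma>, where 'm='m and 'n='n and 'k='k] L f unfolding X D by simp
  also have "\<dots> = (-1) ^ (odd_inversions ?m xs + odd_inversions ?m ds) * (x_mono A j * d_mono A f)"
    by (cases "even (odd_inversions ?m xs)"; cases "even (odd_inversions ?m ds)") auto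
  also have "(-1) ^ (odd_inversions ?m xs + odd_inversions ?m ds) =
      ((-1) ^ card {(p, p'). p \<in> A \<and> p' \<in> A \<and> p < p' \<and> \<sigma> p < \<sigma> p' \<and> ?odd p p'} :: ('m, 'n, 'k) weyl)"
    unfolding id add.assoc[symmetric] power_add by (cases "even (odd_inversions ?m xs)") simp_all
  finally show ?thesis .
qed

text \<open>Induction on the number of points moved by \<tau>. Composing \<tau> with the
  transposition of a moved point p and its preimage q fixes p. Both lie in one fiber of odd index,
  so the sign of the permutation and \<open>nord\<close> change sign together.\<close>

lemma sign_nord_comp:
  assumes K: "finite K" and \<sigma>: "\<sigma> permutes K" and \<tau>: "\<tau> permutes K"
    and f: "\<And>p. p \<in> K \<Longrightarrow> f (\<tau> p) = f p" "\<And>p. p \<in> K \<Longrightarrow> f p = 0 \<Longrightarrow> \<tau> p = p"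
    and even: "\<And>p q. p \<in> K \<Longrightarrow> q \<in> K \<Longrightarrow> f p = f q \<Longrightarrow> f p \<noteq> 0 \<Longrightarrow> par LENGTH('m) (f p) = 0 \<Longrightarrow> p = q"
  shows "of_int (sign (\<sigma> \<circ> \<tau>)) * nord K (\<sigma> \<circ> \<tau>) f = of_int (sign \<sigma>) * (nord K \<sigma> f :: ('m::len0, 'n::len0, 'k::len0) weyl)"
  using \<tau> f
proof (induction "card {p\<in>K. \<tau> p \<noteq> p}" arbitrary: \<tau> rule: less_induct)
  case less
  show ?case
  proof (cases "\<forall>p\<in>K. \<tau> p = p")
    case True
    then have "\<tau> = id" using less.prems(1) by (auto simp: fun_eq_iff permutes_def)
    then show ?thesis by simp
  next
    case False
    then obtain p where p: "p \<in> K" "\<tau> p \<noteq> p" by blast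
    define q where "q = inv_into UNIV \<tau> p"
    have q: "\<tau> q = p" "q \<in> K"
      using permutes_inverses(1)[OF less.prems(1)] permutes_in_image[OF permutes_inv[OF less.prems(1)], of p] p(1)
      by (auto simp: q_def)
    have pq: "p \<noteq> q" "f q = f p" using p q less.prems(2)[of q] by auto
    have f0: "f p \<noteq> 0" using less.prems(3)[OF p(1)] p(2) by auto
    have odd: "par LENGTH('m) (f p) = 1"
      using even[OF p(1) q(2)] pq f0 par_cases[of "LENGTH('m)" "f p"] by auto
    define \<rho> where "\<rho> = \<tau> \<circ> transpose p q"
    have \<rho>: "\<rho> permutes K" unfolding \<rho>_def
      using less.prems(1) p q by (intro permutes_compose permutes_swap_id) auto
    have \<rho>v: "\<rho> p = p" "\<rho> q = \<tau> p" "\<And>x. x \<noteq> p \<Longrightarrow> x \<noteq> q \<Longrightarrow> \<rho> x = \<tau> x"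
      using q by (simp_all add: \<rho>_def transpose_def)
    have "{x\<in>K. \<rho> x \<noteq> x} \<subset> {x\<in>K. \<tau> x \<noteq> x}"
    proof
      show "{x\<in>K. \<rho> x \<noteq> x} \<subseteq> {x\<in>K. \<tau> x \<noteq> x}"
      proof
        fix x assume "x \<in> {x\<in>K. \<rho> x \<noteq> x}"
        then show "x \<in> {x\<in>K. \<tau> x \<noteq> x}" using \<rho>v q pq by (cases "x = p"; cases "x = q") auto
      qed
      show "{x\<in>K. \<rho> x \<noteq> x} \<noteq> {x\<in>K. \<tau> x \<noteq> x}" using p \<rho>v(1) by auto
    qed
    then have "card {x\<in>K. \<rho> x \<noteq> x} < card {x\<in>K. \<tau> x \<noteq> x}"
      using K by (intro psubset_card_mono) auto
    moreover have "f (\<rho> x) = f x" if "x \<in> K" for x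
      using less.prems(2)[OF that] less.prems(2)[OF p(1)] \<rho>v pq by (cases "x = p"; cases "x = q") auto
    moreover have "\<rho> x = x" if "x \<in> K" "f x = 0" for x
      using less.prems(3)[OF that] \<rho>v pq f0 that by (cases "x = p"; cases "x = q") auto
    ultimately have IH: "of_int (sign (\<sigma> \<circ> \<rho>)) * nord K (\<sigma> \<circ> \<rho>) f = of_int (sign \<sigma>) * (nord K \<sigma> f :: ('m, 'n, 'k) weyl)"
      using \<rho> less.hyps by blast
    have \<tau>: "\<sigma> \<circ> \<tau> = (\<sigma> \<circ> \<rho>) \<circ> transpose p q" by (simp add: \<rho>_def comp_assoc)
    have "(\<sigma> \<circ> \<rho>) permutes K" using \<rho> \<sigma> by (rule permutes_compose)
    then have "sign (\<sigma> \<circ> \<tau>) = - sign (\<sigma> \<circ> \<rho>)"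
      unfolding \<tau> by (rule sign_transpose_comp) (use K pq in auto)
    moreover have "nord K (\<sigma> \<circ> \<tau>) f = - (nord K (\<sigma> \<circ> \<rho>) f :: ('m, 'n, 'k) weyl)"
      unfolding \<tau> using nord_swap[of K p q f "f p" "\<sigma> \<circ> \<rho>", where 'm='m and 'n='n and 'k='k] K p q pq f0 odd by simp
    ultimately show ?thesis using IH by simp
  qed
qed

lemma restrict_id_permutes:
  assumes "\<tau> permutes A" "finite B" "\<And>x. x \<in> B \<Longrightarrow> \<tau> x \<in> B"
  shows "restrict_id \<tau> B permutes B"
proof (rule bij_imp_permutes)
  have "inj_on \<tau> B" using permutes_inj[OF assms(1)] by (rule inj_on_subset) simp
  moreover have "\<tau> ` B \<subseteq> B" using assms(3) by blast
  ultimately have "bij_betw \<tau> B B" using endo_inj_surj[OF assms(2)] by (simp add: bij_betw_def)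
  then show "bij_betw (restrict_id \<tau> B) B B" by (subst bij_betw_cong[of B _ \<tau>]) simp_all
qed simp

text \<open>The permutations preserving \<open>f\<close> form the product of the symmetric groups of
  its fibers (a Young subgroup); the induction splits off one fiber.\<close>

lemma card_fiber_permutations:
  fixes f :: "nat \<Rightarrow> nat"
  assumes "finite I" "finite A" "f ` A \<subseteq> I"
  shows "card {\<tau>. \<tau> permutes A \<and> (\<forall>a\<in>A. f (\<tau> a) = f a)} = (\<Prod>i\<in>I. fact (card {a\<in>A. f a = i}))"
  using assms
proof (induction I arbitrary: A rule: finite_induct)
  case empty
  then have "{\<tau>. \<tau> permutes A \<and> (\<forall>a\<in>A. f (\<tau> a) = f a)} = {id}" by auto
  then show ?case by simp
next
  case (insert i I)
  define B where "B = {a\<in>A. f a = i}"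
  define C where "C = A - B"
  have BC: "finite B" "finite C" "B \<inter> C = {}" "A = B \<union> C" using insert.prems by (auto simp: B_def C_def)
  let ?P = "\<lambda>A. {\<tau>. \<tau> permutes A \<and> (\<forall>a\<in>A. f (\<tau> a) = f a)}"
  have "bij_betw (\<lambda>\<tau>. (restrict_id \<tau> B, restrict_id \<tau> C)) (?P A) ({\<tau>. \<tau> permutes B} \<times> ?P C)"
  proof (rule bij_betw_byWitness[where f' = "\<lambda>(\<tau>1, \<tau>2). \<tau>1 \<circ> \<tau>2"])
    have pres: "x \<in> B \<Longrightarrow> \<tau> x \<in> B" "x \<in> C \<Longrightarrow> \<tau> x \<in> C" if "\<tau> \<in> ?P A" for \<tau> x
    proof -
      have "x \<in> A \<Longrightarrow> \<tau> x \<in> A \<and> f (\<tau> x) = f x" using that permutes_in_image[of \<tau> A x] by blast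
      then show "x \<in> B \<Longrightarrow> \<tau> x \<in> B" "x \<in> C \<Longrightarrow> \<tau> x \<in> C" by (auto simp: B_def C_def)
    qed
    show "\<forall>\<tau>\<in>?P A. (case (restrict_id \<tau> B, restrict_id \<tau> C) of (\<tau>1, \<tau>2) \<Rightarrow> \<tau>1 \<circ> \<tau>2) = \<tau>"
    proof
      fix \<tau> assume \<tau>: "\<tau> \<in> ?P A"
      have "(restrict_id \<tau> B \<circ> restrict_id \<tau> C) x = \<tau> x" for x
      proof (cases "x \<in> C")
        case True
        then show ?thesis using pres(2)[OF \<tau> True] BC(3) by (auto simp: restrict_id_def)
      next
        case False
        then show ?thesis using \<tau> BC(4) by (auto simp: restrict_id_def permutes_not_in)
      qed
      then show "(case (restrict_id \<tau> B, restrict_id \<tau> C) of (\<tau>1, \<tau>2) \<Rightarrow> \<tau>1 \<circ> \<tau>2) = \<tau>" by (simp add: fun_eq_iff)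
    qed
    have two: "x \<in> B \<Longrightarrow> (\<tau>1 \<circ> \<tau>2) x = \<tau>1 x" "x \<notin> B \<Longrightarrow> (\<tau>1 \<circ> \<tau>2) x = \<tau>2 x"
      if "\<tau>1 permutes B" "\<tau>2 permutes C" for \<tau>1 \<tau>2 x
    proof -
      assume "x \<in> B"
      then have "x \<notin> C" using BC(3) by auto
      then show "(\<tau>1 \<circ> \<tau>2) x = \<tau>1 x" using permutes_not_in[OF that(2)] by simp
    next
      assume "x \<notin> B"
      then have "\<tau>2 x \<notin> B"
        using BC(3) permutes_in_image[OF that(2), of x] permutes_not_in[OF that(2), of x] by (cases "x \<in> C") auto
      then show "(\<tau>1 \<circ> \<tau>2) x = \<tau>2 x" using permutes_not_in[OF that(1)] by simp
    qed
    show "\<forall>\<tau>\<in>{\<tau>. \<tau> permutes B} \<times> ?P C.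
      (restrict_id (case \<tau> of (\<tau>1, \<tau>2) \<Rightarrow> \<tau>1 \<circ> \<tau>2) B, restrict_id (case \<tau> of (\<tau>1, \<tau>2) \<Rightarrow> \<tau>1 \<circ> \<tau>2) C) = \<tau>"
    proof
      fix \<tau> assume "\<tau> \<in> {\<tau>. \<tau> permutes B} \<times> ?P C"
      then obtain \<tau>1 \<tau>2 where \<tau>: "\<tau> = (\<tau>1, \<tau>2)" "\<tau>1 permutes B" "\<tau>2 permutes C" by auto
      have "restrict_id (\<tau>1 \<circ> \<tau>2) B x = \<tau>1 x" for x
        using two[OF \<tau>(2,3), of x] permutes_not_in[OF \<tau>(2), of x] by (cases "x \<in> B") (auto simp: restrict_id_def)
      moreover have "restrict_id (\<tau>1 \<circ> \<tau>2) C x = \<tau>2 x" for x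
        using two[OF \<tau>(2,3), of x] permutes_not_in[OF \<tau>(3), of x] BC(3) by (cases "x \<in> C") (auto simp: restrict_id_def)
      ultimately show "(restrict_id (case \<tau> of (\<tau>1, \<tau>2) \<Rightarrow> \<tau>1 \<circ> \<tau>2) B, restrict_id (case \<tau> of (\<tau>1, \<tau>2) \<Rightarrow> \<tau>1 \<circ> \<tau>2) C) = \<tau>"
        by (simp add: \<tau>(1) fun_eq_iff)
    qed
    show "(\<lambda>\<tau>. (restrict_id \<tau> B, restrict_id \<tau> C)) ` ?P A \<subseteq> {\<tau>. \<tau> permutes B} \<times> ?P C"
    proof
      fix y assume "y \<in> (\<lambda>\<tau>. (restrict_id \<tau> B, restrict_id \<tau> C)) ` ?P A"
      then obtain \<tau> where \<tau>: "\<tau> \<in> ?P A" "y = (restrict_id \<tau> B, restrict_id \<tau> C)" by blast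
      then show "y \<in> {\<tau>. \<tau> permutes B} \<times> ?P C"
        using restrict_id_permutes[of \<tau> A B] restrict_id_permutes[of \<tau> A C] pres[OF \<tau>(1)] BC
        by auto
    qed
    show "(\<lambda>(\<tau>1, \<tau>2). \<tau>1 \<circ> \<tau>2) ` ({\<tau>. \<tau> permutes B} \<times> ?P C) \<subseteq> ?P A"
    proof
      fix y assume "y \<in> (\<lambda>(\<tau>1, \<tau>2). \<tau>1 \<circ> \<tau>2) ` ({\<tau>. \<tau> permutes B} \<times> ?P C)"
      then obtain \<tau>1 \<tau>2 where \<tau>: "y = \<tau>1 \<circ> \<tau>2" "\<tau>1 permutes B" "\<tau>2 permutes C" "\<forall>a\<in>C. f (\<tau>2 a) = f a" by auto
      have "y permutes A"
        unfolding \<tau>(1) using \<tau>(2,3) BC(4) by (intro permutes_compose) (auto intro: permutes_subset)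
      moreover have "f (y a) = f a" if "a \<in> A" for a
      proof (cases "a \<in> B")
        case True
        then have "\<tau>1 a \<in> B" using permutes_in_image[OF \<tau>(2)] by blast
        then show ?thesis using two(1)[OF \<tau>(2,3) True] True by (simp add: \<tau>(1) B_def)
      next
        case False
        then show ?thesis using two(2)[OF \<tau>(2,3) False] \<tau>(4) that BC(4) by (simp add: \<tau>(1))
      qed
      ultimately show "y \<in> ?P A" by simp
    qed
  qed
  then have "card (?P A) = card {\<tau>. \<tau> permutes B} * card (?P C)"
    using bij_betw_same_card by (fastforce simp: card_cartesian_product)
  also have "card {\<tau>. \<tau> permutes B} = fact (card B)" by (rule card_permutations) (use BC in auto)
  also have "card (?P C) = (\<Prod>j\<in>I. fact (card {a\<in>C. f a = j}))"
    by (rule insert.IH) (use insert.prems in \<open>auto simp: C_def B_def\<close>)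
  also have "\<dots> = (\<Prod>j\<in>I. fact (card {a\<in>A. f a = j}))"
  proof (rule prod.cong[OF refl])
    fix j assume "j \<in> I"
    then have "{a\<in>C. f a = j} = {a\<in>A. f a = j}" using insert.hyps by (auto simp: C_def B_def)
    then show "fact (card {a\<in>C. f a = j}) = fact (card {a\<in>A. f a = j})" by simp
  qed
  finally show ?case using insert.hyps by (simp add: B_def)
qed

section \<open>Existence and uniqueness of the fiberwise increasing permutation\<close>

lemma strict_mono_bij_exists:
  fixes X Y :: "nat set"
  assumes "finite X" "finite Y" "card X = card Y"
  shows "\<exists>h. bij_betw h X Y \<and> strict_mono_on X h"
proof -
  obtain a where a: "bij_betw a {..<card X} X" "strict_mono_on {..<card X} a"
    using ex_bij_betw_strict_mono_card[OF assms(1)] by blast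
  obtain b where b: "bij_betw b {..<card Y} Y" "strict_mono_on {..<card Y} b"
    using ex_bij_betw_strict_mono_card[OF assms(2)] by blast
  define a' where "a' = inv_into {..<card X} a"
  have a': "bij_betw a' X {..<card X}" unfolding a'_def by (rule bij_betw_inv_into[OF a(1)])
  have "bij_betw (b \<circ> a') X Y" using a' b(1) assms(3) by (auto intro: bij_betw_trans)
  moreover have "strict_mono_on X (b \<circ> a')"
  proof (rule strict_mono_onI)
    fix x y assume xy: "x \<in> X" "y \<in> X" "x < y"
    have in': "a' x \<in> {..<card X}" "a' y \<in> {..<card X}" using a' xy by (auto simp: bij_betw_def)
    have inv: "a (a' x) = x" "a (a' y) = y"
      using xy a(1) unfolding a'_def by (auto simp: bij_betw_inv_into_right)
    have "a' x < a' y"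
    proof (rule ccontr)
      assume "\<not> a' x < a' y"
      then have "a' y = a' x \<or> a' y < a' x" by auto
      then have "a (a' y) \<le> a (a' x)" using strict_mono_onD[OF a(2) in'(2,1)] by auto
      then show False using inv xy by simp
    qed
    then show "(b \<circ> a') x < (b \<circ> a') y"
      using strict_mono_onD[OF b(2), of "a' x" "a' y"] in' assms(3) by simp
  qed
  ultimately show ?thesis by blast
qed

lemma strict_mono_image_unique:
  fixes f g :: "nat \<Rightarrow> nat"
  assumes "finite X" "f ` X = g ` X" "strict_mono_on X f" "strict_mono_on X g" "x \<in> X"
  shows "f x = g x"
proof -
  let ?L = "sorted_list_of_set X"
  have "sorted (map h ?L) \<and> distinct (map h ?L)" if "strict_mono_on X h" for h :: "nat \<Rightarrow> nat"
  proof -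
    have "sorted_wrt (\<lambda>x y. h x < h y) ?L"
      by (rule sorted_wrt_mono_rel[OF _ strict_sorted_list_of_set])
        (use that assms(1) in \<open>auto dest: strict_mono_onD\<close>)
    then have "sorted_wrt (<) (map h ?L)" by (simp add: sorted_wrt_map)
    then show ?thesis by (simp only: strict_sorted_iff)
  qed
  then have "map f ?L = map g ?L"
    using assms by (intro sorted_distinct_set_unique) auto
  then show ?thesis using assms(1,5) by (auto simp: map_eq_conv)
qed

lemma elt_bij:
  assumes "finite A"
  shows "bij_betw (elt A) {1..card A} A" "strict_mono_on {1..card A} (elt A)"
proof -
  let ?L = "sorted_list_of_set A"
  have L: "length ?L = card A" "set ?L = A" "distinct ?L" "sorted_wrt (<) ?L" using assms by auto
  show mono: "strict_mono_on {1..card A} (elt A)"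
  proof (rule strict_mono_onI)
    fix r s assume "r \<in> {1..card A}" "s \<in> {1..card A}" "r < s"
    then show "elt A r < elt A s" unfolding elt_def
      using sorted_wrt_nth_less[OF L(4), of "r - 1" "s - 1"] L(1) by auto
  qed
  have "elt A ` {1..card A} = A"
  proof
    show "elt A ` {1..card A} \<subseteq> A"
    proof
      fix x assume "x \<in> elt A ` {1..card A}"
      then obtain s where s: "s \<in> {1..card A}" "x = ?L ! (s - 1)" by (auto simp: elt_def)
      then have "s - 1 < length ?L" using L(1) by auto
      then show "x \<in> A" using nth_mem[of "s - 1" ?L] s(2) L(2) by simp
    qed
    show "A \<subseteq> elt A ` {1..card A}"
    proof
      fix x assume "x \<in> A"
      then obtain l where "l < length ?L" "?L ! l = x" using L(2) by (metis in_set_conv_nth)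
      then show "x \<in> elt A ` {1..card A}" using L(1) by (intro image_eqI[of _ _ "Suc l"]) (auto simp: elt_def)
    qed
  qed
  then show "bij_betw (elt A) {1..card A} A"
    using strict_mono_on_imp_inj_on[OF mono] by (simp add: bij_betw_def)
qed

text \<open>Conjugation by the enumeration of \<open>A\<close> preserves signs. The map
  \<open>perm_act\<close> is meaningful on \<open>A\<close> only; \<pi> is the permutation that
  agrees with it there and fixes all other points.\<close>

lemma perm_act_map_permutation:
  assumes "finite A" "\<sigma> permutes {1..card A}"
  defines "\<pi> \<equiv> map_permutation {1..card A} (elt A) \<sigma>"
  shows "\<pi> permutes A" "sign \<pi> = sign \<sigma>" "\<And>s. s \<in> {1..card A} \<Longrightarrow> \<pi> (elt A s) = elt A (\<sigma> s)"
    "\<And>a. a \<in> A \<Longrightarrow> perm_act A \<sigma> a = \<pi> a"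
proof -
  note e = elt_bij(1)[OF assms(1)]
  have inj: "inj_on (elt A) {1..card A}" using e by (simp add: bij_betw_def)
  show "\<pi> permutes A" unfolding \<pi>_def by (rule map_permutation_permutes[OF e assms(2)])
  show "sign \<pi> = sign \<sigma>" unfolding \<pi>_def by (rule sign_map_permutation) (use inj assms(2) in auto)
  show el: "\<pi> (elt A s) = elt A (\<sigma> s)" if "s \<in> {1..card A}" for s
    unfolding \<pi>_def by (rule map_permutation_apply[OF inj that])
  fix a assume "a \<in> A"
  then have im: "a \<in> elt A ` {1..card A}" using e by (simp add: bij_betw_def)
  show "perm_act A \<sigma> a = \<pi> a"
    using el[OF inv_into_into[OF im]] by (simp only: perm_act_def f_inv_into_f[OF im])
qed

lemma J_setD:
  assumes "j \<in> J_set m n k A" "A \<subseteq> {1..k}"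
  shows "j \<in> {1..k} \<rightarrow>\<^sub>E {0..m + n}" "\<And>a. a \<in> {1..k} \<Longrightarrow> j a = 0 \<longleftrightarrow> a \<notin> A"
    "\<And>a. a \<in> A \<Longrightarrow> j a \<in> {1..m + n}" "\<And>i. i \<in> {1..m} \<Longrightarrow> card (fiber k j i) \<le> 1"
    "\<And>i. i \<noteq> 0 \<Longrightarrow> fiber k j i = {a \<in> A. j a = i}"
proof -
  show j: "j \<in> {1..k} \<rightarrow>\<^sub>E {0..m + n}" and 0: "\<And>a. a \<in> {1..k} \<Longrightarrow> j a = 0 \<longleftrightarrow> a \<notin> A"
    and "\<And>i. i \<in> {1..m} \<Longrightarrow> card (fiber k j i) \<le> 1"
    using assms(1) by (auto simp: J_set_def)
  show "j a \<in> {1..m + n}" if "a \<in> A" for a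
    using PiE_mem[OF j, of a] 0[of a] that assms(2) by auto
  show "fiber k j i = {a \<in> A. j a = i}" if "i \<noteq> 0" for i
  proof -
    have "a \<in> {1..k} \<and> j a = i \<longleftrightarrow> a \<in> A \<and> j a = i" for a
      using 0[of a] that assms(2) by (cases "a \<in> {1..k}") auto
    then show ?thesis by (simp add: fiber_def)
  qed
qed

text \<open>The increasing bijections between corresponding fibers are glued to a permutation of
  \<open>A\<close>, which is then carried over to ranks by the inverse of
  \<open>elt A\<close>.\<close>

lemma sigma_exists:
  assumes A: "A \<subseteq> {1..k}" and j1: "j\<^sub>1 \<in> J_set m n k A" and j2: "j\<^sub>2 \<in> J_set m n k A"
    and eq: "j_equiv m n k j\<^sub>1 j\<^sub>2"
  shows "\<exists>\<sigma>. \<sigma> permutes {1..card A} \<and> (\<forall>i\<in>{1..m+n}. perm_act A \<sigma> ` fiber k j\<^sub>2 i = fiber k j\<^sub>1 i \<and>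
    strict_mono_on (fiber k j\<^sub>2 i) (perm_act A \<sigma>))"
proof -
  have fin: "finite A" by (rule finite_subset[OF A]) simp
  have ff: "finite (fiber k j i)" for j i by (simp add: fiber_def)
  have "\<exists>h. bij_betw h (fiber k j\<^sub>2 i) (fiber k j\<^sub>1 i) \<and> strict_mono_on (fiber k j\<^sub>2 i) h" if "i \<in> {1..m + n}" for i
    by (rule strict_mono_bij_exists) (use ff eq that in \<open>auto simp: j_equiv_def\<close>)
  then obtain h where h: "\<And>i. i \<in> {1..m + n} \<Longrightarrow> bij_betw (h i) (fiber k j\<^sub>2 i) (fiber k j\<^sub>1 i)"
    "\<And>i. i \<in> {1..m + n} \<Longrightarrow> strict_mono_on (fiber k j\<^sub>2 i) (h i)"
    by metis
  define \<rho> where "\<rho> = restrict_id (\<lambda>a. h (j\<^sub>2 a) a) A"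
  have \<rho>: "\<rho> a = h (j\<^sub>2 a) a" if "a \<in> A" for a using that by (simp add: \<rho>_def)
  have mem: "a \<in> fiber k j\<^sub>2 (j\<^sub>2 a)" if "a \<in> A" for a using that A by (auto simp: fiber_def)
  have \<rho>f: "\<rho> a \<in> fiber k j\<^sub>1 (j\<^sub>2 a)" if "a \<in> A" for a
    using h(1)[OF J_setD(3)[OF j2 A that]] mem[OF that] that by (auto simp: \<rho> bij_betw_def)
  have \<rho>A: "\<rho> a \<in> A" if "a \<in> A" for a
    using \<rho>f[OF that] J_setD(5)[OF j1 A, of "j\<^sub>2 a"] J_setD(3)[OF j2 A that] by auto
  have "inj_on \<rho> A"
  proof (rule inj_onI)
    fix a b assume ab: "a \<in> A" "b \<in> A" "\<rho> a = \<rho> b"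
    then have "j\<^sub>2 a = j\<^sub>2 b" using \<rho>f[OF ab(1)] \<rho>f[OF ab(2)] by (auto simp: fiber_def)
    then show "a = b"
      using h(1)[OF J_setD(3)[OF j2 A ab(1)]] mem[OF ab(1)] mem[OF ab(2)] ab \<rho>
      by (auto simp: bij_betw_def inj_on_def)
  qed
  then have "bij_betw \<rho> A A" using endo_inj_surj[OF fin, of \<rho>] \<rho>A by (auto simp: bij_betw_def)
  then have \<rho>p: "\<rho> permutes A" by (rule bij_imp_permutes) (simp add: \<rho>_def)
  note e = elt_bij(1)[OF fin]
  let ?I = "inv_into {1..card A} (elt A)"
  have e': "bij_betw ?I A {1..card A}" by (rule bij_betw_inv_into[OF e])
  define \<sigma> where "\<sigma> = map_permutation A ?I \<rho>"
  have \<sigma>: "\<sigma> permutes {1..card A}" unfolding \<sigma>_def by (rule map_permutation_permutes[OF e' \<rho>p])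
  have act: "perm_act A \<sigma> a = \<rho> a" if "a \<in> A" for a
  proof -
    have "\<sigma> (?I a) = ?I (\<rho> a)"
      unfolding \<sigma>_def by (rule map_permutation_apply) (use e' that in \<open>auto simp: bij_betw_def\<close>)
    then show ?thesis using \<rho>A[OF that] e by (simp add: perm_act_def bij_betw_inv_into_right)
  qed
  show ?thesis
  proof (intro exI[of _ \<sigma>] conjI ballI \<sigma>)
    fix i assume i: "i \<in> {1..m + n}"
    have "fiber k j\<^sub>2 i = {a \<in> A. j\<^sub>2 a = i}" by (rule J_setD(5)[OF j2 A]) (use i in auto)
    then have eq: "perm_act A \<sigma> a = h i a" if "a \<in> fiber k j\<^sub>2 i" for a using that act \<rho> by auto
    show "perm_act A \<sigma> ` fiber k j\<^sub>2 i = fiber k j\<^sub>1 i"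
      using h(1)[OF i] eq by (simp add: bij_betw_def cong: image_cong)
    show "strict_mono_on (fiber k j\<^sub>2 i) (perm_act A \<sigma>)"
      using h(2)[OF i] eq by (simp add: strict_mono_on_def)
  qed
qed

text \<open>An increasing map on a finite set is determined by its image, so the permutation is
  unique and the definite description in \<open>sigma\<close> denotes it.\<close>

lemma sigma_spec:
  assumes A: "A \<subseteq> {1..k}" and j1: "j\<^sub>1 \<in> J_set m n k A" and j2: "j\<^sub>2 \<in> J_set m n k A"
    and eq: "j_equiv m n k j\<^sub>1 j\<^sub>2"
  shows "sigma m n k A j\<^sub>1 j\<^sub>2 permutes {1..card A} \<and>
    (\<forall>i\<in>{1..m+n}. perm_act A (sigma m n k A j\<^sub>1 j\<^sub>2) ` fiber k j\<^sub>2 i = fiber k j\<^sub>1 i \<and>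
      strict_mono_on (fiber k j\<^sub>2 i) (perm_act A (sigma m n k A j\<^sub>1 j\<^sub>2)))"
proof -
  define P where "P = (\<lambda>\<sigma>. \<sigma> permutes {1..card A} \<and>
    (\<forall>i\<in>{1..m+n}. perm_act A \<sigma> ` fiber k j\<^sub>2 i = fiber k j\<^sub>1 i \<and>
      strict_mono_on (fiber k j\<^sub>2 i) (perm_act A \<sigma>)))"
  have fin: "finite A" by (rule finite_subset[OF A]) simp
  have unique: "\<sigma> = \<tau>" if P: "P \<sigma>" "P \<tau>" for \<sigma> \<tau>
  proof -
    note \<sigma> = P(1)[unfolded P_def] and \<tau> = P(2)[unfolded P_def]
    have act: "perm_act A \<sigma> a = perm_act A \<tau> a" if "a \<in> A" for a
    proof -
      have i: "j\<^sub>2 a \<in> {1..m + n}" by (rule J_setD(3)[OF j2 A that])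
      have "finite (fiber k j\<^sub>2 (j\<^sub>2 a))" "a \<in> fiber k j\<^sub>2 (j\<^sub>2 a)"
        using that A by (auto simp: fiber_def)
      moreover have "perm_act A \<sigma> ` fiber k j\<^sub>2 (j\<^sub>2 a) = perm_act A \<tau> ` fiber k j\<^sub>2 (j\<^sub>2 a)"
        using conjunct2[OF \<sigma>] conjunct2[OF \<tau>] i by metis
      moreover have "strict_mono_on (fiber k j\<^sub>2 (j\<^sub>2 a)) (perm_act A \<sigma>)"
        "strict_mono_on (fiber k j\<^sub>2 (j\<^sub>2 a)) (perm_act A \<tau>)"
        using conjunct2[OF \<sigma>] conjunct2[OF \<tau>] i by blast+
      ultimately show ?thesis by (intro strict_mono_image_unique)
    qed
    have inj: "inj_on (elt A) {1..card A}" using elt_bij(1)[OF fin] by (simp add: bij_betw_def)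
    show ?thesis
    proof
      fix s
      show "\<sigma> s = \<tau> s"
      proof (cases "s \<in> {1..card A}")
        case True
        then have "elt A s \<in> A" using elt_bij(1)[OF fin] by (auto simp: bij_betw_def)
        from act[OF this] have "elt A (\<sigma> s) = elt A (\<tau> s)"
          using inj True by (simp add: perm_act_def)
        moreover have "\<sigma> s \<in> {1..card A}" "\<tau> s \<in> {1..card A}"
          using True \<sigma> \<tau> permutes_in_image[of \<sigma> "{1..card A}"] permutes_in_image[of \<tau> "{1..card A}"] by blast+
        ultimately show ?thesis using inj by (simp only: inj_on_eq_iff)
      next
        case False
        then show ?thesis
          using permutes_not_in[OF conjunct1[OF \<sigma>]] permutes_not_in[OF conjunct1[OF \<tau>]] by simp
      qed
    qed
  qed
  have "\<exists>\<sigma>. P \<sigma>" unfolding P_def by (rule sigma_exists[OF assms])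
  then have "\<exists>!\<sigma>. P \<sigma>" by (rule ex_ex1I) (rule unique)
  then have "P (THE \<sigma>. P \<sigma>)" by (rule theI')
  then show ?thesis unfolding P_def sigma_def .
qed

text \<open>Passage from ranks to elements of \<open>A\<close>; since \<open>elt A\<close> is
  increasing, the counted pairs correspond. Monotonicity on fibers is dropped at this point: by
  \<open>sign_nord_comp\<close>, every permutation carrying \<open>j\<^sub>2\<close> to
  \<open>j\<^sub>1\<close> gives the same signed product.\<close>

lemma sigma_permutation:
  assumes A: "A \<subseteq> {1..k}" and j1: "j\<^sub>1 \<in> J_set m n k A" and j2: "j\<^sub>2 \<in> J_set m n k A"
    and eq: "j_equiv m n k j\<^sub>1 j\<^sub>2"
  shows "\<exists>\<pi>. \<pi> permutes A \<and> (\<forall>a\<in>A. j\<^sub>1 (\<pi> a) = j\<^sub>2 a) \<and>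
    c_coeff m n k A j\<^sub>1 j\<^sub>2 = (-1) ^ card {(p, p'). p \<in> A \<and> p' \<in> A \<and> p < p' \<and> \<pi> p < \<pi> p' \<and>
      m < j\<^sub>2 p \<and> m < j\<^sub>2 p'} * sign \<pi> * (-1) ^ card A"
proof -
  have fin: "finite A" by (rule finite_subset[OF A]) simp
  define \<sigma> where "\<sigma> = sigma m n k A j\<^sub>1 j\<^sub>2"
  have \<sigma>: "\<sigma> permutes {1..card A}"
    "\<And>i. i \<in> {1..m + n} \<Longrightarrow> perm_act A \<sigma> ` fiber k j\<^sub>2 i = fiber k j\<^sub>1 i"
    using sigma_spec[OF assms] by (simp_all add: \<sigma>_def)
  define \<pi> where "\<pi> = map_permutation {1..card A} (elt A) \<sigma>"
  note \<pi> = perm_act_map_permutation[OF fin \<sigma>(1), folded \<pi>_def]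
  have j: "j\<^sub>1 (\<pi> a) = j\<^sub>2 a" if "a \<in> A" for a
  proof -
    have "a \<in> fiber k j\<^sub>2 (j\<^sub>2 a)" using that A by (auto simp: fiber_def)
    then have "\<pi> a \<in> fiber k j\<^sub>1 (j\<^sub>2 a)" using \<sigma>(2)[OF J_setD(3)[OF j2 A that]] \<pi>(4)[OF that] by force
    then show ?thesis by (simp add: fiber_def)
  qed
  note e = elt_bij[OF fin]
  have lt: "elt A s < elt A s' \<longleftrightarrow> s < s'" if "s \<in> {1..card A}" "s' \<in> {1..card A}" for s s'
    by (rule strict_mono_on_less[OF e(2) that])
  have im: "\<sigma> s \<in> {1..card A}" if "s \<in> {1..card A}" for s using permutes_in_image[OF \<sigma>(1)] that by blast
  let ?P = "{(s, s'). 1 \<le> s \<and> s < s' \<and> s' \<le> card A \<and> \<sigma> s < \<sigma> s' \<and> m < j\<^sub>2 (elt A s) \<and> m < j\<^sub>2 (elt A s')}"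
  let ?Q = "{(p, p'). p \<in> A \<and> p' \<in> A \<and> p < p' \<and> \<pi> p < \<pi> p' \<and> m < j\<^sub>2 p \<and> m < j\<^sub>2 p'}"
  have "bij_betw (map_prod (elt A) (elt A)) ?P ?Q"
  proof (rule bij_betw_imageI)
    show "inj_on (map_prod (elt A) (elt A)) ?P"
    proof (rule inj_on_subset)
      have "inj_on (elt A) {1..card A}" using e(1) by (simp add: bij_betw_def)
      then show "inj_on (map_prod (elt A) (elt A)) ({1..card A} \<times> {1..card A})" by (intro map_prod_inj_on)
    qed auto
    show "map_prod (elt A) (elt A) ` ?P = ?Q"
    proof
      show "map_prod (elt A) (elt A) ` ?P \<subseteq> ?Q"
      proof
        fix x assume "x \<in> map_prod (elt A) (elt A) ` ?P"
        then obtain s s' where x: "x = (elt A s, elt A s')" and ss: "1 \<le> s" "s < s'" "s' \<le> card A" "\<sigma> s < \<sigma> s'"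
          "m < j\<^sub>2 (elt A s)" "m < j\<^sub>2 (elt A s')" by auto
        have s: "s \<in> {1..card A}" "s' \<in> {1..card A}" using ss by auto
        have "elt A s \<in> A" "elt A s' \<in> A" using e(1) s by (auto simp: bij_betw_def)
        then show "x \<in> ?Q" using x ss lt[OF s] lt[OF im[OF s(1)] im[OF s(2)]] \<pi>(3)[OF s(1)] \<pi>(3)[OF s(2)] by simp
      qed
      show "?Q \<subseteq> map_prod (elt A) (elt A) ` ?P"
      proof
        fix x assume "x \<in> ?Q"
        then obtain p p' where x: "x = (p, p')" and pp: "p \<in> A" "p' \<in> A" "p < p'" "\<pi> p < \<pi> p'" "m < j\<^sub>2 p" "m < j\<^sub>2 p'" by auto
        obtain s s' where s: "s \<in> {1..card A}" "s' \<in> {1..card A}" "p = elt A s" "p' = elt A s'"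
          using e(1) pp(1,2) unfolding bij_betw_def by blast
        have "(s, s') \<in> ?P"
          using pp s lt[OF s(1,2)] lt[OF im[OF s(1)] im[OF s(2)]] \<pi>(3)[OF s(1)] \<pi>(3)[OF s(2)] by auto
        then show "x \<in> map_prod (elt A) (elt A) ` ?P" using x s(3,4) by force
      qed
    qed
  qed
  then have "card ?P = card ?Q" by (rule bij_betw_same_card)
  then have "c_coeff m n k A j\<^sub>1 j\<^sub>2 = (-1) ^ card ?Q * sign \<pi> * (-1) ^ card A"
    unfolding c_coeff_def sgn_j_def \<sigma>_def[symmetric] Let_def \<pi>(2) by simp
  then show ?thesis using \<pi>(1) j by blast
qed

section \<open>The expansion\<close>

lemma v_series_prod_list: "v_series (prod_list (map g xs)) = prod_list (map (\<lambda>x. v_series (g x)) xs)"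
  by (induction xs) (simp_all add: v_series_mult)

lemma dv_series_prod_list: "dv_series (prod_list (map g xs)) = prod_list (map (\<lambda>x. dv_series (g x)) xs)"
  by (induction xs) (simp_all add: dv_series_mult)

lemma two_sided_inv_dv_series: "g \<noteq> 0 \<Longrightarrow> two_sided_inv (dv_series g) = dv_series (inverse g)"
  by (rule two_sided_inv_eq) (simp_all flip: dv_series_mult)

lemma nsym_sign: "nsym (fls_const (of_int (sign \<sigma>)) * h) a g = nsym h (of_int (sign \<sigma>) * a) g"
  by (cases rule: sign_cases[of \<sigma>]) (simp_all add: fls_const_uminus nsym_uminus1 nsym_uminus2)

lemma psdo_of_of_nat: "psdo_of (of_nat q) = (of_nat q :: 'a::ring_1 psdo)"
  using psdo_of_of_int[of "int q", where 'a = 'a] by simp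

lemma nsym_sum2: "nsym h (\<Sum>x\<in>A. F x) g = (\<Sum>x\<in>A. nsym h (F x) g)"
  by (induction A rule: infinite_finite_induct) (auto simp: nsym_add2)

lemma beta_split:
  "beta m \<Lambda> (m + n) = (\<Prod>i\<in>{1..m}. fls_X_inv - fls_const (\<Lambda> i)) * inverse (\<Prod>i\<in>{m+1..m+n}. fls_X_inv - fls_const (\<Lambda> i))"
proof -
  have "{1..m + n} = {1..m} \<union> {m+1..m+n}" by auto
  then have "beta m \<Lambda> (m + n) = (\<Prod>j\<in>{1..m}. if par m j = 0 then fls_X_inv - fls_const (\<Lambda> j) else dv_res \<Lambda> j) *
    (\<Prod>j\<in>{m+1..m+n}. if par m j = 0 then fls_X_inv - fls_const (\<Lambda> j) else dv_res \<Lambda> j)"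
    unfolding beta_def by (simp only:) (rule prod.union_disjoint; auto)
  also have "(\<Prod>j\<in>{1..m}. if par m j = 0 then fls_X_inv - fls_const (\<Lambda> j) else dv_res \<Lambda> j) =
      (\<Prod>i\<in>{1..m}. fls_X_inv - fls_const (\<Lambda> i))"
    by (rule prod.cong) (auto simp: par_def)
  also have "(\<Prod>j\<in>{m+1..m+n}. if par m j = 0 then fls_X_inv - fls_const (\<Lambda> j) else dv_res \<Lambda> j) =
      (\<Prod>i\<in>{m+1..m+n}. inverse (fls_X_inv - fls_const (\<Lambda> i)))"
    by (rule prod.cong) (auto simp: par_def dv_res_def)
  also have "\<dots> = inverse (\<Prod>i\<in>{m+1..m+n}. fls_X_inv - fls_const (\<Lambda> i))"
    using prod_inversef[of "\<lambda>i. fls_X_inv - fls_const (\<Lambda> i)" "{m+1..m+n}"] by (simp add: comp_def)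
  finally show ?thesis .
qed

lemma ber_factor:
  "(\<Prod>i\<leftarrow>[1..<m+1]. psdo_dv - psdo_scal (\<Lambda> i)) * two_sided_inv (\<Prod>i\<leftarrow>[m+1..<m+n+1]. psdo_dv - psdo_scal (\<Lambda> i)) =
    dv_series (beta m \<Lambda> (m + n))"
proof -
  have "prod_list (map g [a..<b]) = prod g {a..<b}" for g :: "nat \<Rightarrow> complex fls" and a b
    by (simp add: prod.distinct_set_conv_list[of "[a..<b]", symmetric])
  moreover have "{1..<m+1} = {1..m}" "{m+1..<m+n+1} = {m+1..m+n}" by auto
  moreover have nz: "(\<Prod>i\<in>{m+1..m+n}. fls_X_inv - fls_const (\<Lambda> i)) \<noteq> (0 :: complex fls)"
    by (simp add: dv_minus_const_nz[simplified])
  ultimately show ?thesis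
    by (simp only: psdo_dv_minus_scal dv_series_prod_list[symmetric] two_sided_inv_dv_series[OF nz] beta_split dv_series_mult)
qed

text \<open>Each summand of the formula is a single normally ordered symbol: the Weyl factor
  commutes with functions of v, and all factors to the right of these are series in the
  derivation.\<close>

lemma rhs_term:
  fixes A :: "nat set" and j :: "nat \<Rightarrow> nat" and z \<Lambda> :: "nat \<Rightarrow> complex"
  assumes "A \<subseteq> {1..k}" "finite A"
  shows "of_int c * of_nat q * psdo_of a
      * (\<Prod>a\<leftarrow>sorted_list_of_set ({1..k} - A). psdo_v - psdo_scal (z a))
      * (\<Prod>a\<leftarrow>sorted_list_of_set A. two_sided_inv (psdo_dv - psdo_scal (\<Lambda> (j a))))
      * ((\<Prod>i\<leftarrow>[1..<m+1]. psdo_dv - psdo_scal (\<Lambda> i)) * two_sided_inv (\<Prod>i\<leftarrow>[m+1..<m+n+1]. psdo_dv - psdo_scal (\<Lambda> i)))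
    = nsym (\<Prod>p\<in>{1..k} - A. fls_X_inv - fls_const (z p)) (of_int c * of_nat q * a)
        ((\<Prod>p\<in>A. dv_res \<Lambda> (j p)) * beta m \<Lambda> (m + n))"
proof -
  have plist: "prod_list (map g (sorted_list_of_set X)) = prod g X" if "finite X" for g :: "nat \<Rightarrow> complex fls" and X
    using prod.distinct_set_conv_list[of "sorted_list_of_set X" g] that by simp
  have 1: "(\<Prod>a\<leftarrow>sorted_list_of_set ({1..k} - A). psdo_v - psdo_scal (z a)) =
      v_series (\<Prod>p\<in>{1..k} - A. fls_X_inv - fls_const (z p))"
    unfolding psdo_v_minus_scal v_series_prod_list[symmetric] by (simp only: plist finite_Diff finite_atLeastAtMost)
  have 2: "(\<Prod>a\<leftarrow>sorted_list_of_set A. two_sided_inv (psdo_dv - psdo_scal (\<Lambda> (j a)))) =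
      dv_series (\<Prod>p\<in>A. dv_res \<Lambda> (j p))"
    unfolding psdo_dv_minus_scal two_sided_inv_dv_series[OF dv_minus_const_nz] dv_series_prod_list[symmetric]
    by (simp only: plist assms dv_res_def)
  have "of_int c * of_nat q * psdo_of a = psdo_of (of_int c * of_nat q * a)"
    by (simp add: psdo_of_mult psdo_of_of_int psdo_of_of_nat)
  then show ?thesis
    unfolding 1 2 ber_factor nsym_def by (simp add: v_series_psdo_of dv_series_mult mult.assoc)
qed

lemma nord_support:
  assumes "finite K"
  shows "nord K \<sigma> f = nord {p\<in>K. f p \<noteq> 0} \<sigma> f"
  using assms
proof (induction K)
  case (insert c K)
  have "{p\<in>insert c K. f p \<noteq> 0} = (if f c = 0 then {p\<in>K. f p \<noteq> 0} else insert c {p\<in>K. f p \<noteq> 0})" by auto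
  then show ?case using insert by (simp add: nord_insert)
qed simp

lemma hpart_support:
  assumes "finite K"
  shows "hpart z K f = (-1) ^ card {p\<in>K. f p \<noteq> 0} * (\<Prod>p\<in>K - {p\<in>K. f p \<noteq> 0}. fls_X_inv - fls_const (z p))"
proof -
  have "hpart z K f = (\<Prod>p\<in>{p\<in>K. f p \<noteq> 0}. if f p = 0 then fls_X_inv - fls_const (z p) else -1) *
    (\<Prod>p\<in>K - {p\<in>K. f p \<noteq> 0}. if f p = 0 then fls_X_inv - fls_const (z p) else -1)"
    unfolding hpart_def using assms by (subst prod.subset_diff[of "{p\<in>K. f p \<noteq> 0}"]) (auto simp: mult.commute)
  also have "(\<Prod>p\<in>{p\<in>K. f p \<noteq> 0}. if f p = 0 then fls_X_inv - fls_const (z p) else -1) = (-1) ^ card {p\<in>K. f p \<noteq> 0}"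
    by (subst prod.cong[of _ _ _ "\<lambda>_. -1"]) auto
  also have "(\<Prod>p\<in>K - {p\<in>K. f p \<noteq> 0}. if f p = 0 then fls_X_inv - fls_const (z p) else -1) =
     (\<Prod>p\<in>K - {p\<in>K. f p \<noteq> 0}. fls_X_inv - fls_const (z p))"
    by (rule prod.cong) auto
  finally show ?thesis .
qed

lemma gpart_support:
  assumes "finite K"
  shows "gpart \<Lambda> K f = (\<Prod>p\<in>{p\<in>K. f p \<noteq> 0}. dv_res \<Lambda> (f p))"
  unfolding gpart_def using assms by (intro prod.mono_neutral_cong_right) auto

text \<open>The permutations in question form a coset of the group preserving
  \<open>j\<^sub>2\<close>, and all of them contribute equally. So the sum is one representative,
  with sign given by \<open>c_coeff\<close>, times the order of that group.\<close>

lemma fiber_class_sum: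
  assumes k: "k = LENGTH('k)" and m: "m = LENGTH('m)" and n: "n = LENGTH('n)"
    and A: "A \<subseteq> {1..k}" and j1: "j\<^sub>1 \<in> J_set m n k A" and j2: "j\<^sub>2 \<in> J_set m n k A"
    and eq: "j_equiv m n k j\<^sub>1 j\<^sub>2"
  shows "(\<Sum>\<sigma>\<in>{\<sigma>. \<sigma> permutes A \<and> (\<forall>a\<in>A. j\<^sub>1 (\<sigma> a) = j\<^sub>2 a)}. (-1) ^ card A * (of_int (sign \<sigma>) * nord A \<sigma> j\<^sub>2)) =
    of_int (c_coeff m n k A j\<^sub>1 j\<^sub>2) * of_nat (\<Prod>i=m+1..m+n. fact (card (fiber k j\<^sub>2 i))) *
      (x_mono A j\<^sub>1 * d_mono A j\<^sub>2 :: ('m::len0, 'n::len0, 'k::len0) weyl)"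
proof -
  have fin: "finite A" by (rule finite_subset[OF A]) simp
  obtain \<pi> where \<pi>: "\<pi> permutes A" "\<And>a. a \<in> A \<Longrightarrow> j\<^sub>1 (\<pi> a) = j\<^sub>2 a"
    and c: "c_coeff m n k A j\<^sub>1 j\<^sub>2 = (-1) ^ card {(p, p'). p \<in> A \<and> p' \<in> A \<and> p < p' \<and> \<pi> p < \<pi> p' \<and>
      m < j\<^sub>2 p \<and> m < j\<^sub>2 p'} * sign \<pi> * (-1) ^ card A"
    using sigma_permutation[OF A j1 j2 eq] by blast
  have j0: "j\<^sub>2 a \<noteq> 0" if "a \<in> A" for a using J_setD(3)[OF j2 A that] by auto
  define T where "T = {\<tau>. \<tau> permutes A \<and> (\<forall>a\<in>A. j\<^sub>2 (\<tau> a) = j\<^sub>2 a)}"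
  define N where "N = ((-1) ^ card A * (of_int (sign \<pi>) * nord A \<pi> j\<^sub>2) :: ('m, 'n, 'k) weyl)"
  have "(\<Sum>\<sigma>\<in>{\<sigma>. \<sigma> permutes A \<and> (\<forall>a\<in>A. j\<^sub>1 (\<sigma> a) = j\<^sub>2 a)}. (-1) ^ card A * (of_int (sign \<sigma>) * nord A \<sigma> j\<^sub>2)) = (\<Sum>\<tau>\<in>T. N)"
  proof (rule sum.reindex_bij_witness[where i = "\<lambda>\<tau>. \<pi> \<circ> \<tau>" and j = "\<lambda>\<sigma>. inv_into UNIV \<pi> \<circ> \<sigma>"])
    fix \<sigma> assume s: "\<sigma> \<in> {\<sigma>. \<sigma> permutes A \<and> (\<forall>a\<in>A. j\<^sub>1 (\<sigma> a) = j\<^sub>2 a)}"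
    define \<tau> where "\<tau> = inv_into UNIV \<pi> \<circ> \<sigma>"
    show e: "\<pi> \<circ> (inv_into UNIV \<pi> \<circ> \<sigma>) = \<sigma>"
      by (simp add: fun_eq_iff permutes_inverses(1)[OF \<pi>(1)])
    have \<tau>: "\<tau> permutes A" unfolding \<tau>_def using s permutes_inv[OF \<pi>(1)] by (auto intro: permutes_compose)
    have f: "j\<^sub>2 (\<tau> a) = j\<^sub>2 a" if "a \<in> A" for a
    proof -
      have "\<tau> a \<in> A" using permutes_in_image[OF \<tau>] that by blast
      then have "j\<^sub>2 (\<tau> a) = j\<^sub>1 (\<pi> (\<tau> a))" using \<pi>(2) by simp
      also have "\<pi> (\<tau> a) = \<sigma> a" using permutes_inverses(1)[OF \<pi>(1)] by (simp add: \<tau>_def)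
      finally show ?thesis using s that by simp
    qed
    show "inv_into UNIV \<pi> \<circ> \<sigma> \<in> T" using \<tau> f by (simp add: T_def \<tau>_def)
    have "of_int (sign (\<pi> \<circ> \<tau>)) * nord A (\<pi> \<circ> \<tau>) j\<^sub>2 = of_int (sign \<pi>) * (nord A \<pi> j\<^sub>2 :: ('m, 'n, 'k) weyl)"
    proof (rule sign_nord_comp[where f = j\<^sub>2, OF fin \<pi>(1) \<tau> f])
      fix p q assume pq: "p \<in> A" "q \<in> A" "j\<^sub>2 p = j\<^sub>2 q" "par LENGTH('m) (j\<^sub>2 p) = 0"
      then have "j\<^sub>2 p \<in> {1..m}" using J_setD(3)[OF j2 A pq(1)] by (auto simp: m par_def split: if_splits)
      then have "card (fiber k j\<^sub>2 (j\<^sub>2 p)) \<le> 1" by (rule J_setD(4)[OF j2 A])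
      moreover have "p \<in> fiber k j\<^sub>2 (j\<^sub>2 p)" "q \<in> fiber k j\<^sub>2 (j\<^sub>2 p)" "finite (fiber k j\<^sub>2 (j\<^sub>2 p))"
        using pq A by (auto simp: fiber_def)
      ultimately show "p = q" by (metis One_nat_def card_le_Suc0_iff_eq)
    qed (use j0 in auto)
    then show "N = (-1) ^ card A * (of_int (sign \<sigma>) * nord A \<sigma> j\<^sub>2)"
      using e by (simp add: N_def \<tau>_def)
  next
    fix \<tau> assume t: "\<tau> \<in> T"
    show "inv_into UNIV \<pi> \<circ> (\<pi> \<circ> \<tau>) = \<tau>"
      by (simp add: fun_eq_iff permutes_inverses(2)[OF \<pi>(1)])
    have "\<tau> permutes A" using t by (simp add: T_def)
    moreover have "j\<^sub>1 (\<pi> (\<tau> a)) = j\<^sub>2 a" if "a \<in> A" for a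
    proof -
      have "\<tau> a \<in> A" using permutes_in_image[OF \<open>\<tau> permutes A\<close>] that by blast
      then show ?thesis using \<pi>(2)[of "\<tau> a"] t that by (simp add: T_def)
    qed
    ultimately show "\<pi> \<circ> \<tau> \<in> {\<sigma>. \<sigma> permutes A \<and> (\<forall>a\<in>A. j\<^sub>1 (\<sigma> a) = j\<^sub>2 a)}"
      using \<pi>(1) by (simp add: permutes_compose)
  qed
  also have "\<dots> = of_nat (card T) * N" by simp
  also have "card T = (\<Prod>i\<in>{1..m+n}. fact (card {a\<in>A. j\<^sub>2 a = i}))"
    unfolding T_def by (rule card_fiber_permutations) (use fin J_setD(3)[OF j2 A] in auto)
  also have "\<dots> = (\<Prod>i\<in>{1..m+n}. fact (card (fiber k j\<^sub>2 i)))"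
    by (rule prod.cong[OF refl]) (simp add: J_setD(5)[OF j2 A])
  \<comment> \<open>Fibers over even indices have at most one element, so their factorials are
    1.\<close>
  also have "\<dots> = (\<Prod>i\<in>{m+1..m+n}. fact (card (fiber k j\<^sub>2 i)))"
  proof (rule prod.mono_neutral_right)
    show "\<forall>i\<in>{1..m+n} - {m+1..m+n}. fact (card (fiber k j\<^sub>2 i)) = (1 :: nat)"
    proof
      fix i assume "i \<in> {1..m+n} - {m+1..m+n}"
      then have "i \<in> {1..m}" by auto
      then have "card (fiber k j\<^sub>2 i) = 0 \<or> card (fiber k j\<^sub>2 i) = 1" using J_setD(4)[OF j2 A, of i] by linarith
      then show "fact (card (fiber k j\<^sub>2 i)) = (1 :: nat)" by auto
    qed
  qed auto
  also have "N = of_int (c_coeff m n k A j\<^sub>1 j\<^sub>2) * (x_mono A j\<^sub>1 * d_mono A j\<^sub>2)"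
  proof -
    let ?C = "{(p, p'). p \<in> A \<and> p' \<in> A \<and> p < p' \<and> \<pi> p < \<pi> p' \<and> m < j\<^sub>2 p \<and> m < j\<^sub>2 p'}"
    have "nord A \<pi> j\<^sub>2 = (-1) ^ card ?C * (x_mono A j\<^sub>1 * d_mono A j\<^sub>2 :: ('m, 'n, 'k) weyl)"
      using nord_sorted[where f = j\<^sub>2 and j = j\<^sub>1 and 'm='m and 'n='n and 'k='k, OF fin \<pi>(1) j0 \<pi>(2)] by (simp add: m)
    then have "N = (-1) ^ card A * of_int (sign \<pi>) * (-1) ^ card ?C * (x_mono A j\<^sub>1 * d_mono A j\<^sub>2)"
      by (simp add: N_def mult.assoc)
    also have "(-1) ^ card A * of_int (sign \<pi>) * (-1) ^ card ?C =
        (of_int ((-1) ^ card A * sign \<pi> * (-1) ^ card ?C) :: ('m, 'n, 'k) weyl)" by simp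
    also have "(-1) ^ card A * sign \<pi> * (-1) ^ card ?C = c_coeff m n k A j\<^sub>1 j\<^sub>2"
      unfolding c by (simp only: mult_ac)
    finally show ?thesis .
  qed
  finally show ?thesis by (simp only: mult.assoc[symmetric] mult_of_nat_commute)
qed

text \<open>Each \<sigma> belongs to exactly one \<open>j\<^sub>1\<close>, namely
  \<open>j\<^sub>2\<close> composed with the inverse of \<sigma>.\<close>

lemma fiber_sum_split:
  assumes k: "k = LENGTH('k)" and m: "m = LENGTH('m)" and n: "n = LENGTH('n)"
    and A: "A \<subseteq> {1..k}" and j2: "j\<^sub>2 \<in> J_set m n k A"
  shows "(\<Sum>\<sigma>\<in>{\<sigma>. \<sigma> permutes A}. (-1) ^ card A * (of_int (sign \<sigma>) * nord A \<sigma> j\<^sub>2)) =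
    (\<Sum>j\<^sub>1\<in>{j\<^sub>1\<in>J_set m n k A. j_equiv m n k j\<^sub>1 j\<^sub>2}.
      of_int (c_coeff m n k A j\<^sub>1 j\<^sub>2) * of_nat (\<Prod>i=m+1..m+n. fact (card (fiber k j\<^sub>2 i))) *
      (x_mono A j\<^sub>1 * d_mono A j\<^sub>2 :: ('m::len0, 'n::len0, 'k::len0) weyl))"
proof -
  let ?K = "{1..k}"
  let ?J = "{j\<^sub>1\<in>J_set m n k A. j_equiv m n k j\<^sub>1 j\<^sub>2}"
  let ?t = "\<lambda>\<sigma>. (-1) ^ card A * (of_int (sign \<sigma>) * nord A \<sigma> j\<^sub>2) :: ('m, 'n, 'k) weyl"
  have fin: "finite A" by (rule finite_subset[OF A]) simp
  have finJ: "finite ?J"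
    by (rule finite_subset[of _ "?K \<rightarrow>\<^sub>E {0..m + n}"]) (auto simp: J_set_def intro!: finite_PiE)
  \<comment> \<open>The restriction to \<open>?K\<close> is needed for \<open>G \<sigma>\<close> to
    be extensional, as members of \<open>J_set\<close> are.\<close>
  define G where "G = (\<lambda>\<sigma>. \<lambda>p\<in>?K. j\<^sub>2 (inv_into UNIV \<sigma> p))"
  have G: "G \<sigma> \<in> ?J" and G_iff: "j\<^sub>1 \<in> ?J \<Longrightarrow> G \<sigma> = j\<^sub>1 \<longleftrightarrow> (\<forall>a\<in>A. j\<^sub>1 (\<sigma> a) = j\<^sub>2 a)"
    if \<sigma>: "\<sigma> permutes A" for \<sigma> j\<^sub>1
  proof -
    have \<sigma>K: "\<sigma> permutes ?K" by (rule permutes_subset[OF \<sigma> A])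
    note inv = permutes_inverses[OF \<sigma>]
    have invK: "inv_into UNIV \<sigma> p \<in> ?K \<longleftrightarrow> p \<in> ?K" for p
      by (rule permutes_in_image[OF permutes_inv[OF \<sigma>K]])
    have invA: "inv_into UNIV \<sigma> p \<in> A \<longleftrightarrow> p \<in> A" for p
      by (rule permutes_in_image[OF permutes_inv[OF \<sigma>]])
    have card: "card (fiber k (G \<sigma>) i) = card (fiber k j\<^sub>2 i)" for i
    proof (rule bij_betw_same_card[symmetric], rule bij_betw_byWitness[where f' = "inv_into UNIV \<sigma>"])
      show "\<sigma> ` fiber k j\<^sub>2 i \<subseteq> fiber k (G \<sigma>) i"
        using permutes_in_image[OF \<sigma>K] inv by (auto simp: fiber_def G_def)
      show "inv_into UNIV \<sigma> ` fiber k (G \<sigma>) i \<subseteq> fiber k j\<^sub>2 i"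
        using invK by (auto simp: fiber_def G_def)
    qed (simp_all add: inv)
    have "G \<sigma> \<in> ?K \<rightarrow>\<^sub>E {0..m + n}"
    proof (rule PiE_I)
      fix p assume p: "p \<in> ?K"
      then show "G \<sigma> p \<in> {0..m + n}"
        using PiE_mem[OF J_setD(1)[OF j2 A], of "inv_into UNIV \<sigma> p"] invK[of p] by (simp only: G_def restrict_apply' p)
    qed (auto simp: G_def)
    moreover have "G \<sigma> p = 0 \<longleftrightarrow> p \<notin> A" if "p \<in> ?K" for p
      using J_setD(2)[OF j2 A, of "inv_into UNIV \<sigma> p"] invK[of p] invA[of p] that
      by (simp only: G_def restrict_apply' that)
    moreover have "card (fiber k (G \<sigma>) i) \<le> 1" if "i \<in> {1..m}" for i
      unfolding card by (rule J_setD(4)[OF j2 A that])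
    ultimately have "G \<sigma> \<in> J_set m n k A" by (simp add: J_set_def)
    then show G: "G \<sigma> \<in> ?J" using card by (simp add: j_equiv_def)
    show "G \<sigma> = j\<^sub>1 \<longleftrightarrow> (\<forall>a\<in>A. j\<^sub>1 (\<sigma> a) = j\<^sub>2 a)" if j1: "j\<^sub>1 \<in> ?J"
    proof
      assume *: "G \<sigma> = j\<^sub>1"
      show "\<forall>a\<in>A. j\<^sub>1 (\<sigma> a) = j\<^sub>2 a"
      proof
        fix a assume "a \<in> A"
        then have "\<sigma> a \<in> ?K" using permutes_in_image[OF \<sigma>] A by blast
        then show "j\<^sub>1 (\<sigma> a) = j\<^sub>2 a" unfolding *[symmetric] G_def by (simp only: restrict_apply' inv)
      qed
    next
      assume *: "\<forall>a\<in>A. j\<^sub>1 (\<sigma> a) = j\<^sub>2 a"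
      have j1': "j\<^sub>1 \<in> J_set m n k A" using j1 by simp
      have G': "G \<sigma> \<in> J_set m n k A" using G by simp
      show "G \<sigma> = j\<^sub>1"
      proof (rule PiE_ext[OF J_setD(1)[OF G' A] J_setD(1)[OF j1' A]])
        fix p assume p: "p \<in> ?K"
        show "G \<sigma> p = j\<^sub>1 p"
        proof (cases "p \<in> A")
          case True
          then have "j\<^sub>1 (\<sigma> (inv_into UNIV \<sigma> p)) = j\<^sub>2 (inv_into UNIV \<sigma> p)" using * invA by blast
          then show ?thesis by (simp only: inv G_def restrict_apply' p)
        next
          case False
          then show ?thesis using J_setD(2)[OF G' A p] J_setD(2)[OF j1' A p] by simp
        qed
      qed
    qed
  qed
  have "(\<Sum>\<sigma>\<in>{\<sigma>. \<sigma> permutes A}. ?t \<sigma>) = (\<Sum>j\<^sub>1\<in>?J. \<Sum>\<sigma>\<in>{\<sigma>\<in>{\<sigma>. \<sigma> permutes A}. G \<sigma> = j\<^sub>1}. ?t \<sigma>)"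
    by (rule sum.group[symmetric]) (use G finJ fin in \<open>auto simp: finite_permutations\<close>)
  also have "\<dots> = (\<Sum>j\<^sub>1\<in>?J. \<Sum>\<sigma>\<in>{\<sigma>. \<sigma> permutes A \<and> (\<forall>a\<in>A. j\<^sub>1 (\<sigma> a) = j\<^sub>2 a)}. ?t \<sigma>)"
  proof (rule sum.cong[OF refl], rule sum.cong)
    fix j\<^sub>1 assume j1: "j\<^sub>1 \<in> ?J"
    show "{\<sigma>\<in>{\<sigma>. \<sigma> permutes A}. G \<sigma> = j\<^sub>1} = {\<sigma>. \<sigma> permutes A \<and> (\<forall>a\<in>A. j\<^sub>1 (\<sigma> a) = j\<^sub>2 a)}"
    proof (rule Collect_cong)
      fix \<sigma> show "\<sigma> \<in> {\<sigma>. \<sigma> permutes A} \<and> G \<sigma> = j\<^sub>1 \<longleftrightarrow> \<sigma> permutes A \<and> (\<forall>a\<in>A. j\<^sub>1 (\<sigma> a) = j\<^sub>2 a)"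
        using G_iff[OF _ j1, of \<sigma>] by blast
    qed
  qed simp
  also have "\<dots> = (\<Sum>j\<^sub>1\<in>?J. of_int (c_coeff m n k A j\<^sub>1 j\<^sub>2) * of_nat (\<Prod>i=m+1..m+n. fact (card (fiber k j\<^sub>2 i))) *
      (x_mono A j\<^sub>1 * d_mono A j\<^sub>2))"
    by (rule sum.cong[OF refl]) (use fiber_class_sum[OF k m n A _ j2] in blast)
  finally show ?thesis .
qed

text \<open>The expansion yields resolvents at the values of \<open>j\<^sub>2\<close>, the formula
  has those of \<open>j\<^sub>1\<close>; both functions take each value equally often.\<close>

lemma prod_dv_res_fibers:
  assumes A: "A \<subseteq> {1..k}" and j1: "j\<^sub>1 \<in> J_set m n k A" and j2: "j\<^sub>2 \<in> J_set m n k A"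
    and eq: "j_equiv m n k j\<^sub>1 j\<^sub>2"
  shows "(\<Prod>p\<in>A. dv_res \<Lambda> (j\<^sub>1 p)) = (\<Prod>p\<in>A. dv_res \<Lambda> (j\<^sub>2 p))"
proof -
  obtain \<pi> where \<pi>: "\<pi> permutes A" "\<forall>a\<in>A. j\<^sub>1 (\<pi> a) = j\<^sub>2 a"
    using sigma_permutation[OF assms] by blast
  have "(\<Prod>p\<in>A. dv_res \<Lambda> (j\<^sub>1 p)) = (\<Prod>p\<in>A. dv_res \<Lambda> (j\<^sub>1 (\<pi> p)))"
    by (rule prod.reindex_bij_betw[symmetric]) (rule permutes_imp_bij[OF \<pi>(1)])
  also have "\<dots> = (\<Prod>p\<in>A. dv_res \<Lambda> (j\<^sub>2 p))"
    by (rule prod.cong[OF refl]) (use \<pi>(2) in simp)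
  finally show ?thesis .
qed

text \<open>Precomposing with the transposition of \<open>p\<close> and \<open>q\<close> preserves
  \<open>nord\<close> and flips the sign. This discards the functions that take an even value twice
  and so lie outside \<open>J_set\<close>.\<close>

lemma even_collision_vanishes:
  fixes h g :: "complex fls"
  assumes fin: "finite A" and f: "\<And>a. a \<in> A \<Longrightarrow> f a \<noteq> 0"
    and pq: "p \<in> A" "q \<in> A" "p \<noteq> q" "f p = f q" "par LENGTH('m) (f p) = 0"
  shows "(\<Sum>\<sigma>\<in>{\<sigma>. \<sigma> permutes A}. nsym h (of_int (sign \<sigma>) * nord A \<sigma> f) g) = (0 :: ('m::len0, 'n::len0, 'k::len0) weyl psdo)"
proof (rule sum_cancel_involution[where t = "\<lambda>\<sigma>. \<sigma> \<circ> transpose p q"])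
  fix \<sigma> assume "\<sigma> \<in> {\<sigma>. \<sigma> permutes A}"
  then have \<sigma>: "\<sigma> permutes A" by simp
  have "(\<sigma> \<circ> transpose p q) permutes A"
    using \<sigma> pq by (intro permutes_compose permutes_swap_id) auto
  moreover have "nord A (\<sigma> \<circ> transpose p q) f = (nord A \<sigma> f :: ('m, 'n, 'k) weyl)"
    using nord_swap[of A p q f "f p" \<sigma>, where 'm='m and 'n='n and 'k='k, OF fin pq(1-3) refl pq(4)[symmetric] f[OF pq(1)]]
    by (simp only: pq(5) power_0 mult_1_left)
  ultimately show "\<sigma> \<circ> transpose p q \<in> {\<sigma>. \<sigma> permutes A} \<and> \<sigma> \<circ> transpose p q \<circ> transpose p q = \<sigma> \<and>
    nsym h (of_int (sign (\<sigma> \<circ> transpose p q)) * nord A (\<sigma> \<circ> transpose p q) f) g =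
    - nsym h (of_int (sign \<sigma>) * nord A \<sigma> f :: ('m, 'n, 'k) weyl) g"
    using sign_transpose_comp[OF \<sigma> fin pq(3)] by (simp add: comp_assoc nsym_uminus2)
qed

text \<open>Terms are grouped by the support \<open>A\<close> of \<open>f\<close>. As \<sigma> fixes
  every position with \<open>f p = 0\<close>, it is just a permutation of \<open>A\<close>, and the
  signs in \<open>hpart\<close> combine to (-1)^|A|. Among the functions with support
  \<open>A\<close>, those outside \<open>J_set\<close> contribute 0.\<close>

lemma ber_symbol_support:
  fixes z \<Lambda> :: "nat \<Rightarrow> complex"
  assumes k: "k = LENGTH('k)" and m: "m = LENGTH('m)" and n: "n = LENGTH('n)"
  shows "ber_symbol z \<Lambda> (m + n) = (\<Sum>A\<in>Pow {1..k}. \<Sum>f\<in>J_set m n k A.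
    \<Sum>\<sigma>\<in>{\<sigma>. \<sigma> permutes A}. nsym (\<Prod>p\<in>{1..k} - A. fls_X_inv - fls_const (z p))
      ((-1) ^ card A * (of_int (sign \<sigma>) * nord A \<sigma> f :: ('m::len0, 'n::len0, 'k::len0) weyl))
      ((\<Prod>p\<in>A. dv_res \<Lambda> (f p)) * beta m \<Lambda> (m + n)))"
proof -
  let ?K = "{1..k}"
  let ?F = "?K \<rightarrow>\<^sub>E {0..m + n}"
  define supp where "supp = (\<lambda>f::nat \<Rightarrow> nat. {p\<in>?K. f p \<noteq> 0})"
  define t where "t = (\<lambda>A f \<sigma>. nsym (\<Prod>p\<in>?K - A. fls_X_inv - fls_const (z p))
      ((-1) ^ card A * (of_int (sign \<sigma>) * nord A \<sigma> f :: ('m, 'n, 'k) weyl))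
      ((\<Prod>p\<in>A. dv_res \<Lambda> (f p)) * beta m \<Lambda> (m + n)))"
  have sp: "{p\<in>?K. f p \<noteq> 0} = supp f" for f by (simp add: supp_def)
  have finF: "finite ?F" by (intro finite_PiE) auto
  have finp: "finite {\<sigma>. \<sigma> permutes supp f}" for f by (rule finite_permutations) (simp add: supp_def)
  have perm: "\<sigma> permutes ?K \<and> (\<forall>p\<in>?K. f p = 0 \<longrightarrow> \<sigma> p = p) \<longleftrightarrow> \<sigma> permutes supp f" for \<sigma> f
  proof
    assume "\<sigma> permutes ?K \<and> (\<forall>p\<in>?K. f p = 0 \<longrightarrow> \<sigma> p = p)"
    then show "\<sigma> permutes supp f" by (auto intro: permutes_superset simp: supp_def)
  next
    assume *: "\<sigma> permutes supp f"
    have "supp f \<subseteq> ?K" by (auto simp: supp_def)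
    with * have "\<sigma> permutes ?K" by (rule permutes_subset)
    then show "\<sigma> permutes ?K \<and> (\<forall>p\<in>?K. f p = 0 \<longrightarrow> \<sigma> p = p)"
      using permutes_not_in[OF *] by (auto simp: supp_def)
  qed
  have "ber_symbol z \<Lambda> (m + n) = (\<Sum>(f, \<sigma>)\<in>Sigma ?F (\<lambda>f. {\<sigma>. \<sigma> permutes supp f}). t (supp f) f \<sigma>)"
    unfolding ber_symbol_def k[symmetric] m[symmetric]
  proof (rule sum.reindex_bij_witness[where i = "\<lambda>(f, \<sigma>). (\<sigma>, f)" and j = "\<lambda>(\<sigma>, f). (f, \<sigma>)"])
    fix s assume "s \<in> leibniz k (m + n)"
    then obtain \<sigma> f where s: "s = (\<sigma>, f)" "\<sigma> permutes supp f" "f \<in> ?F"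
      using perm by (auto simp: leibniz_def)
    show "(case s of (\<sigma>, f) \<Rightarrow> (f, \<sigma>)) \<in> Sigma ?F (\<lambda>f. {\<sigma>. \<sigma> permutes supp f})" using s by simp
    have "nsym (fls_const (of_int (sign \<sigma>)) * hpart z ?K f) (nord ?K \<sigma> f) g =
      (nsym (\<Prod>p\<in>?K - supp f. fls_X_inv - fls_const (z p)) ((-1) ^ card (supp f) * (of_int (sign \<sigma>) * nord (supp f) \<sigma> f)) g :: ('m, 'n, 'k) weyl psdo)" for g
      unfolding nsym_sign hpart_support[OF finite_atLeastAtMost] nsym_sign2[symmetric]
        nord_support[OF finite_atLeastAtMost, of 1 k \<sigma> f] supp_def ..
    then show "(case (case s of (\<sigma>, f) \<Rightarrow> (f, \<sigma>)) of (f, \<sigma>) \<Rightarrow> t (supp f) f \<sigma>) =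
      (case s of (\<sigma>, f) \<Rightarrow> nsym (fls_const (of_int (sign \<sigma>)) * hpart z ?K f) (nord ?K \<sigma> f) (gpart \<Lambda> ?K f * beta m \<Lambda> (m + n)))"
      unfolding s prod.case t_def gpart_support[OF finite_atLeastAtMost] sp by simp
  next
    fix y assume "y \<in> Sigma ?F (\<lambda>f. {\<sigma>. \<sigma> permutes supp f})"
    then show "(case y of (f, \<sigma>) \<Rightarrow> (\<sigma>, f)) \<in> leibniz k (m + n)"
      using perm by (auto simp: leibniz_def)
  qed auto
  also have "\<dots> = (\<Sum>f\<in>?F. \<Sum>\<sigma>\<in>{\<sigma>. \<sigma> permutes supp f}. t (supp f) f \<sigma>)"
    by (rule sum.Sigma[symmetric]) (use finF finp in auto)
  also have "\<dots> = (\<Sum>A\<in>Pow ?K. \<Sum>f\<in>{f\<in>?F. supp f = A}. \<Sum>\<sigma>\<in>{\<sigma>. \<sigma> permutes supp f}. t (supp f) f \<sigma>)"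
    by (rule sum.group[symmetric]) (use finF in \<open>auto simp: supp_def\<close>)
  also have "\<dots> = (\<Sum>A\<in>Pow ?K. \<Sum>f\<in>J_set m n k A. \<Sum>\<sigma>\<in>{\<sigma>. \<sigma> permutes A}. t A f \<sigma>)"
  proof (rule sum.cong[OF refl])
    fix A assume "A \<in> Pow ?K"
    then have A: "A \<subseteq> ?K" "finite A" using finite_subset[of A ?K] by auto
    have "(\<Sum>f\<in>{f\<in>?F. supp f = A}. \<Sum>\<sigma>\<in>{\<sigma>. \<sigma> permutes supp f}. t (supp f) f \<sigma>) =
      (\<Sum>f\<in>{f\<in>?F. supp f = A}. \<Sum>\<sigma>\<in>{\<sigma>. \<sigma> permutes A}. t A f \<sigma>)"
      by (rule sum.cong) auto
    also have "\<dots> = (\<Sum>f\<in>J_set m n k A. \<Sum>\<sigma>\<in>{\<sigma>. \<sigma> permutes A}. t A f \<sigma>)"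
    proof (rule sum.mono_neutral_right)
      show "finite {f\<in>?F. supp f = A}" using finF by simp
      show "J_set m n k A \<subseteq> {f\<in>?F. supp f = A}"
      proof
        fix f assume f: "f \<in> J_set m n k A"
        have "p \<in> supp f \<longleftrightarrow> p \<in> A" for p
          using J_setD(2)[OF f A(1), of p] A(1) by (cases "p \<in> {1..k}") (auto simp: supp_def)
        then have "supp f = A" by blast
        then show "f \<in> {f\<in>?F. supp f = A}" using J_setD(1)[OF f A(1)] by simp
      qed
      show "\<forall>f\<in>{f\<in>?F. supp f = A} - J_set m n k A. (\<Sum>\<sigma>\<in>{\<sigma>. \<sigma> permutes A}. t A f \<sigma>) = 0"
      proof
        fix f assume f: "f \<in> {f\<in>?F. supp f = A} - J_set m n k A"
        then have "\<forall>a\<in>?K. f a = 0 \<longleftrightarrow> a \<notin> A" by (auto simp: supp_def)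
        then obtain i where i: "i \<in> {1..m}" "\<not> card (fiber k f i) \<le> Suc 0"
          using f by (auto simp: J_set_def)
        have "finite (fiber k f i)" by (simp add: fiber_def)
        then obtain p q where pq: "p \<in> fiber k f i" "q \<in> fiber k f i" "p \<noteq> q"
          using i(2) by (auto simp: card_le_Suc0_iff_eq)
        have pA: "p \<in> A" "q \<in> A" "f p = i" "f q = i" using pq f i(1) by (auto simp: fiber_def supp_def)
        have f0: "f a \<noteq> 0" if "a \<in> A" for a using that f by (auto simp: supp_def)
        have "par LENGTH('m) (f p) = 0" using i(1) pA by (simp add: par_def m)
        moreover have "f p = f q" using pA by simp
        ultimately show "(\<Sum>\<sigma>\<in>{\<sigma>. \<sigma> permutes A}. t A f \<sigma>) = 0"
          unfolding t_def nsym_sign2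
          by (intro even_collision_vanishes[where f = f and p = p and q = q]) (use A(2) f0 pA pq(3) in auto)
      qed
    qed
    finally show "(\<Sum>f\<in>{f\<in>?F. supp f = A}. \<Sum>\<sigma>\<in>{\<sigma>. \<sigma> permutes supp f}. t (supp f) f \<sigma>) =
      (\<Sum>f\<in>J_set m n k A. \<Sum>\<sigma>\<in>{\<sigma>. \<sigma> permutes A}. t A f \<sigma>)" .
  qed
  finally show ?thesis by (simp only: t_def)
qed

theorem proposition5p5:
  fixes m n k :: nat and z \<Lambda> :: "nat \<Rightarrow> complex"
  assumes "m = LENGTH('m::len0)" "n = LENGTH('n::len0)" "k = LENGTH('k::len0)"
    and "k \<ge> 1" "m + n \<ge> 1"
  shows "Ber (s_hat m n k) (B_hat z \<Lambda> :: ('m, 'n, 'k) weyl psdo mat) =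
    (\<Sum>A\<in>Pow {1..k}.
      \<Sum>(j\<^sub>1, j\<^sub>2)\<in>{(j\<^sub>1, j\<^sub>2). j\<^sub>1 \<in> J_set m n k A \<and> j\<^sub>2 \<in> J_set m n k A \<and> j_equiv m n k j\<^sub>1 j\<^sub>2}.
        of_int (c_coeff m n k A j\<^sub>1 j\<^sub>2)
        * of_nat (\<Prod>i=m+1..m+n. fact (card (fiber k j\<^sub>2 i)))
        * psdo_of (x_mono A j\<^sub>1 * d_mono A j\<^sub>2)
        * (\<Prod>a\<leftarrow>sorted_list_of_set ({1..k} - A). psdo_v - psdo_scal (z a))
        * (\<Prod>a\<leftarrow>sorted_list_of_set A. two_sided_inv (psdo_dv - psdo_scal (\<Lambda> (j\<^sub>1 a))))
        * ((\<Prod>i\<leftarrow>[1..<m+1]. psdo_dv - psdo_scal (\<Lambda> i))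
           * two_sided_inv (\<Prod>i\<leftarrow>[m+1..<m+n+1]. psdo_dv - psdo_scal (\<Lambda> i))))"
proof -
  let ?h = "\<lambda>A. \<Prod>p\<in>{1..k} - A. fls_X_inv - fls_const (z p)"
  let ?g = "\<lambda>A j. (\<Prod>p\<in>A. dv_res \<Lambda> (j p)) * beta m \<Lambda> (m + n)"
  let ?c = "\<lambda>A j\<^sub>1 j\<^sub>2. of_int (c_coeff m n k A j\<^sub>1 j\<^sub>2) * of_nat (\<Prod>i=m+1..m+n. fact (card (fiber k j\<^sub>2 i)))
    * (x_mono A j\<^sub>1 * d_mono A j\<^sub>2) :: ('m, 'n, 'k) weyl"
  have "Ber (s_hat m n k) (B_hat z \<Lambda> :: ('m, 'n, 'k) weyl psdo mat) = ber_symbol z \<Lambda> (m + n)"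
    using Ber_B_hat[of z \<Lambda>, where 'm='m and 'n='n and 'k='k] assms(1-3) by simp
  also have "\<dots> = (\<Sum>A\<in>Pow {1..k}. \<Sum>(j\<^sub>1, j\<^sub>2)\<in>{(j\<^sub>1, j\<^sub>2). j\<^sub>1 \<in> J_set m n k A \<and> j\<^sub>2 \<in> J_set m n k A \<and> j_equiv m n k j\<^sub>1 j\<^sub>2}.
      nsym (?h A) (?c A j\<^sub>1 j\<^sub>2) (?g A j\<^sub>1))"
    unfolding ber_symbol_support[OF assms(3,1,2)]
  proof (rule sum.cong[OF refl])
    fix A assume "A \<in> Pow {1..k}"
    then have A: "A \<subseteq> {1..k}" by simp
    let ?P = "{(j\<^sub>1, j\<^sub>2). j\<^sub>1 \<in> J_set m n k A \<and> j\<^sub>2 \<in> J_set m n k A \<and> j_equiv m n k j\<^sub>1 j\<^sub>2}"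
    let ?J = "\<lambda>j\<^sub>2. {j\<^sub>1\<in>J_set m n k A. j_equiv m n k j\<^sub>1 j\<^sub>2}"
    have finJ: "finite (J_set m n k A)"
      by (rule finite_subset[of _ "{1..k} \<rightarrow>\<^sub>E {0..m + n}"]) (auto simp: J_set_def intro!: finite_PiE)
    have "(\<Sum>f\<in>J_set m n k A. \<Sum>\<sigma>\<in>{\<sigma>. \<sigma> permutes A}. nsym (?h A)
        ((-1) ^ card A * (of_int (sign \<sigma>) * nord A \<sigma> f :: ('m, 'n, 'k) weyl)) (?g A f)) =
      (\<Sum>j\<^sub>2\<in>J_set m n k A. \<Sum>j\<^sub>1\<in>?J j\<^sub>2. nsym (?h A) (?c A j\<^sub>1 j\<^sub>2) (?g A j\<^sub>2))"
      by (rule sum.cong[OF refl]) (simp only: nsym_sum2[symmetric] fiber_sum_split[OF assms(3,1,2) A])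
    also have "\<dots> = (\<Sum>j\<^sub>2\<in>J_set m n k A. \<Sum>j\<^sub>1\<in>?J j\<^sub>2. nsym (?h A) (?c A j\<^sub>1 j\<^sub>2) (?g A j\<^sub>1))"
    proof (rule sum.cong[OF refl], rule sum.cong[OF refl])
      fix j\<^sub>2 j\<^sub>1 assume j: "j\<^sub>2 \<in> J_set m n k A" "j\<^sub>1 \<in> ?J j\<^sub>2"
      have "(\<Prod>p\<in>A. dv_res \<Lambda> (j\<^sub>1 p)) = (\<Prod>p\<in>A. dv_res \<Lambda> (j\<^sub>2 p))"
        by (rule prod_dv_res_fibers[OF A _ j(1)]) (use j(2) in auto)
      then show "nsym (?h A) (?c A j\<^sub>1 j\<^sub>2) (?g A j\<^sub>2) = nsym (?h A) (?c A j\<^sub>1 j\<^sub>2) (?g A j\<^sub>1)" by simp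
    qed
    also have "\<dots> = (\<Sum>(j\<^sub>2, j\<^sub>1)\<in>Sigma (J_set m n k A) ?J. nsym (?h A) (?c A j\<^sub>1 j\<^sub>2) (?g A j\<^sub>1))"
      by (rule sum.Sigma) (use finJ in auto)
    also have "\<dots> = (\<Sum>(j\<^sub>1, j\<^sub>2)\<in>?P. nsym (?h A) (?c A j\<^sub>1 j\<^sub>2) (?g A j\<^sub>1))"
      by (rule sum.reindex_bij_witness[where i = prod.swap and j = prod.swap]) auto
    finally show "(\<Sum>f\<in>J_set m n k A. \<Sum>\<sigma>\<in>{\<sigma>. \<sigma> permutes A}. nsym (?h A)
        ((-1) ^ card A * (of_int (sign \<sigma>) * nord A \<sigma> f :: ('m, 'n, 'k) weyl)) (?g A f)) =
      (\<Sum>(j\<^sub>1, j\<^sub>2)\<in>?P. nsym (?h A) (?c A j\<^sub>1 j\<^sub>2) (?g A j\<^sub>1))" .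
  qed
  finally show ?thesis
  proof (rule trans, intro sum.cong refl)
    fix A x assume "A \<in> Pow {1..k}"
    then have A: "A \<subseteq> {1..k}" "finite A" using finite_subset[of A "{1..k}"] by auto
    show "(case x of (j\<^sub>1, j\<^sub>2) \<Rightarrow> nsym (?h A) (?c A j\<^sub>1 j\<^sub>2) (?g A j\<^sub>1)) = (case x of (j\<^sub>1, j\<^sub>2) \<Rightarrow>
        of_int (c_coeff m n k A j\<^sub>1 j\<^sub>2)
        * of_nat (\<Prod>i=m+1..m+n. fact (card (fiber k j\<^sub>2 i)))
        * psdo_of (x_mono A j\<^sub>1 * d_mono A j\<^sub>2)
        * (\<Prod>a\<leftarrow>sorted_list_of_set ({1..k} - A). psdo_v - psdo_scal (z a))
        * (\<Prod>a\<leftarrow>sorted_list_of_set A. two_sided_inv (psdo_dv - psdo_scal (\<Lambda> (j\<^sub>1 a))))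
        * ((\<Prod>i\<leftarrow>[1..<m+1]. psdo_dv - psdo_scal (\<Lambda> i))
           * two_sided_inv (\<Prod>i\<leftarrow>[m+1..<m+n+1]. psdo_dv - psdo_scal (\<Lambda> i))))"
      unfolding rhs_term[OF A] ..
  qed
qed

end
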